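(* Let $B_t=(r_t,\theta_t,z_t)$ be an $\widetilde{\operatorname{SL}(2)}$-Brownian motion (in cylindrical coordinates) started from the origin $(0,0,0)$, and let $F_t(x)$ be the cumulative distribution function of $z_t/\sqrt t$. Let $\Phi$ be the cumulative distribution function of the standard normal distribution. Then there exist positive constants $c$ and $T_0$ such that \[ \Phi(x)\le F_t(x)\le\Phi(x)+cx\quad\text{for all } x\ge0 \text{ and } t>T_0 . \]
   Context: $\widetilde{\operatorname{SL}(2)}$ is the universal cover of $\operatorname{SL}(2,\mathbb{R})$ with its standard left-invariant sub-Riemannian structure, having global cylindrical coordinates $(r,\theta,z)\in\mathbb{R}^+\times[0,2\pi]\times\mathbb{R}$ in which the sub-Laplacian is $\Delta_{\mathcal{H}}=\partial_r^2+\coth r\,\partial_r+\frac{1}{\sinh^2r}\partial_\theta^2+\frac{1}{\cosh^2(r/2)}\partial_\theta\partial_z+\tanh^2(r/2)\partial_z^2$. $\widetilde{\operatorname{SL}(2)}$-Brownian motion is the diffusion generated by $\frac12\Delta_{\mathcal{H}}$, solving $dr_t=dW^{(1)}_t+\frac12\coth(r_t)dt$, $d\theta_t=\frac{1}{\sinh r_t}dW^{(2)}_t$, $dz_t=\tanh(r_t/2)dW^{(2)}_t$ with independent one-dimensional Brownian motions $W^{(1)},W^{(2)}$ ($(r_t,\theta_t)$ is Brownian motion on the hyperbolic plane of curvature $-1$ in polar coordinates). *)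

theory Defs
  imports "HOL-Analysis.Analysis" "HOL-Probability.Probability"
begin

definition D1 :: "(real \<Rightarrow> real \<Rightarrow> real \<Rightarrow> real) \<Rightarrow> real \<Rightarrow> real \<Rightarrow> real \<Rightarrow> real" where
  "D1 f x y z = deriv (\<lambda>s. f s y z) x"
definition D2 :: "(real \<Rightarrow> real \<Rightarrow> real \<Rightarrow> real) \<Rightarrow> real \<Rightarrow> real \<Rightarrow> real \<Rightarrow> real" where
  "D2 f x y z = deriv (\<lambda>s. f x s z) y"
definition D3 :: "(real \<Rightarrow> real \<Rightarrow> real \<Rightarrow> real) \<Rightarrow> real \<Rightarrow> real \<Rightarrow> real \<Rightarrow> real" where
  "D3 f x y z = deriv (\<lambda>s. f x y s) z"

coinductive smooth3 :: "(real \<Rightarrow> real \<Rightarrow> real \<Rightarrow> real) \<Rightarrow> bool" where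
  "continuous_on UNIV (\<lambda>(p::real \<times> real \<times> real). f (fst p) (fst (snd p)) (snd (snd p)))
   \<Longrightarrow> (\<forall>x y z. (\<lambda>s. f s y z) differentiable (at x)
               \<and> (\<lambda>s. f x s z) differentiable (at y)
               \<and> (\<lambda>s. f x y s) differentiable (at z))
   \<Longrightarrow> smooth3 (D1 f) \<Longrightarrow> smooth3 (D2 f) \<Longrightarrow> smooth3 (D3 f) \<Longrightarrow> smooth3 f"

text \<open>Test functions: smooth with compact support (in the global chart
  (x,y,z) = (r cos theta, r sin theta, z)).\<close>
definition test_fun :: "(real \<Rightarrow> real \<Rightarrow> real \<Rightarrow> real) \<Rightarrow> bool" where
  "test_fun f \<longleftrightarrow> smooth3 f \<and> bounded {(x, y, z). f x y z \<noteq> 0}"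

definition cyl :: "(real \<Rightarrow> real \<Rightarrow> real \<Rightarrow> real) \<Rightarrow> real \<Rightarrow> real \<Rightarrow> real \<Rightarrow> real" where
  "cyl f r \<theta> z = f (r * cos \<theta>) (r * sin \<theta>) z"

text \<open>Sub-Laplacian of f at the point with cylindrical coordinates (r,theta,z), r > 0:
  d_r^2 + coth r d_r + sinh^-2 r d_theta^2 + cosh^-2(r/2) d_theta d_z + tanh^2(r/2) d_z^2
  applied to the cylindrical expression of f.  At r = 0 (the axis) we use its continuous
  extension, which for smooth f equals f_xx + f_yy there.\<close>
definition subLap :: "(real \<Rightarrow> real \<Rightarrow> real \<Rightarrow> real) \<Rightarrow> real \<Rightarrow> real \<Rightarrow> real \<Rightarrow> real" where
  "subLap f r \<theta> z =
     (if r = 0 then D1 (D1 f) 0 0 z + D2 (D2 f) 0 0 z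
      else let g = cyl f in
        D1 (D1 g) r \<theta> z + (cosh r / sinh r) * D1 g r \<theta> z
        + (1 / (sinh r)\<^sup>2) * D2 (D2 g) r \<theta> z
        + (1 / (cosh (r / 2))\<^sup>2) * D3 (D2 g) r \<theta> z
        + (tanh (r / 2))\<^sup>2 * D3 (D3 g) r \<theta> z)"

section \<open>SL(2)~-Brownian motion from the origin, via the martingale problem for (1/2) Delta_H\<close>

definition nat_filtration ::
  "'a measure \<Rightarrow> (real \<Rightarrow> 'a \<Rightarrow> real) \<Rightarrow> (real \<Rightarrow> 'a \<Rightarrow> real) \<Rightarrow> (real \<Rightarrow> 'a \<Rightarrow> real)
   \<Rightarrow> real \<Rightarrow> 'a measure" where
  "nat_filtration M r \<theta> z s =
     sigma (space M)
       (\<Union>u\<in>{0..s}. \<Union>A\<in>sets (borel :: (real \<times> real \<times> real) measure).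
          {(\<lambda>\<omega>. (r u \<omega>, \<theta> u \<omega>, z u \<omega>)) -` A \<inter> space M})"

definition mp_process ::
  "(real \<Rightarrow> real \<Rightarrow> real \<Rightarrow> real) \<Rightarrow> (real \<Rightarrow> 'a \<Rightarrow> real) \<Rightarrow> (real \<Rightarrow> 'a \<Rightarrow> real)
   \<Rightarrow> (real \<Rightarrow> 'a \<Rightarrow> real) \<Rightarrow> real \<Rightarrow> 'a \<Rightarrow> real" where
  "mp_process f r \<theta> z t \<omega> =
     cyl f (r t \<omega>) (\<theta> t \<omega>) (z t \<omega>)
     - integral {0..t} (\<lambda>u. (1/2) * subLap f (r u \<omega>) (\<theta> u \<omega>) (z u \<omega>))"

definition SL2_brownian_motion_from_origin ::
  "'a measure \<Rightarrow> (real \<Rightarrow> 'a \<Rightarrow> real) \<Rightarrow> (real \<Rightarrow> 'a \<Rightarrow> real) \<Rightarrow> (real \<Rightarrow> 'a \<Rightarrow> real) \<Rightarrow> bool"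
  where
  "SL2_brownian_motion_from_origin M r \<theta> z \<longleftrightarrow>
     prob_space M
     \<and> (\<forall>t\<ge>0. r t \<in> borel_measurable M \<and> \<theta> t \<in> borel_measurable M \<and> z t \<in> borel_measurable M)
     \<and> (\<forall>t\<ge>0. \<forall>\<omega>\<in>space M. r t \<omega> \<ge> 0)
     \<and> (\<forall>\<omega>\<in>space M. r 0 \<omega> = 0 \<and> z 0 \<omega> = 0)
     \<and> (\<forall>\<omega>\<in>space M. continuous_on {0..}
          (\<lambda>t. (r t \<omega> * cos (\<theta> t \<omega>), r t \<omega> * sin (\<theta> t \<omega>), z t \<omega>)))
     \<and> (\<forall>f. test_fun f \<longrightarrow> (\<forall>s t. 0 \<le> s \<longrightarrow> s \<le> t \<longrightarrow>
          integrable M (mp_process f r \<theta> z t)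
          \<and> (\<forall>A\<in>sets (nat_filtration M r \<theta> z s).
               (\<integral>\<omega>. mp_process f r \<theta> z t \<omega> * indicator A \<omega> \<partial>M)
             = (\<integral>\<omega>. mp_process f r \<theta> z s \<omega> * indicator A \<omega> \<partial>M))))"

definition Phi :: "real \<Rightarrow> real" where
  "Phi x = (LBINT y:{..x}. std_normal_density y)"

end

theory Submission
  imports Defs
begin

text \<open>
  Given the radial part, z is a centred Gaussian with variance A = int tanh^2(r/2) ds, which is
  at most t. Hence F_t(x) is the expectation of Phi(x sqrt(t/A)), which gives the lower bound, and the upper
  bound follows from a uniform bound on the expectation of sqrt(t/A).

  In the variable y = sech^2(r/2) the radial part of half the generator is
  (1/2)(y^2(1-y) d^2/dy^2 - y^2 d/dy). With the potential -(l^2/2)(1-y) it maps y^k to a combination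
  of y^k and y^(k+1) only. So both E[y^k cos(l z)] and E[y^k exp(-l^2 A/2)] solve the same
  system of evolution equations indexed by real k. After a Laplace transform in time this system
  becomes a two-term recursion in k. At the positive root k of k^2 - k - l^2 - 2 alpha = 0 it forces the
  transforms of the difference to vanish at k+1, k+2, ..., and the theorems of Weierstrass and Lerch
  show that the two sides agree. So E cos(l z) = E exp(-l^2 A/2), which together with
  E sin(l z) = 0 identifies the law of z.

  For the upper bound, convexity of u^(-1/2) gives sqrt(t/A) <= (1/t) int coth(r/2) ds, and
  the expectation of the integral grows at most linearly in t, because half the generator applied to
  tanh(r/2) is y^2 coth(r/2)/8.
\<close>

section \<open>Smooth functions\<close>

text \<open>Only the martingale problem for compactly supported test functions is given, without
  driving Brownian motions or a conditional law of z given the radius. The law of z is therefore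
  found by comparing two characteristic functions through a closed linear system rather than by
  conditioning. Closing the system dictates the variable y: in it the radial generator and the
  coefficient tanh^2(r/2) = 1 - y of d_z^2 are polynomial. The exponents have to be real because the
  root k need not be an integer; the moment of order 0, below that root, is recovered by
  approximating y^(-k-1) by continuous functions.

  Two boundary points shape the details. At y = 1, the axis, derivatives are taken within {0<..1};
  at y = 0, infinite radius, functions are cut off. As tanh(r/2) is not smooth on the axis, sqrt(1 +
  e - y) replaces it and e tends to 0 at the end. The final constant 18 is 16 + 2: 16 is 8 times the
  bound 2 on this function, and 2 bounds (1 - y^2) / sqrt(1 + e - y).\<close>

primrec Cn_on :: "real set \<Rightarrow> nat \<Rightarrow> (real \<Rightarrow> real) \<Rightarrow> bool" where
  "Cn_on S 0 f \<longleftrightarrow> continuous_on S f"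
| "Cn_on S (Suc n) f \<longleftrightarrow>
     (\<exists>f'. (\<forall>x\<in>S. (f has_real_derivative f' x) (at x within S)) \<and> Cn_on S n f')"

lemma Cn_on_SucD: "Cn_on S (Suc n) f \<Longrightarrow> Cn_on S n f"
proof (induction n arbitrary: f)
  case 0
  then obtain f' where "\<forall>x\<in>S. (f has_real_derivative f' x) (at x within S)" by auto
  then show ?case by (auto intro!: DERIV_continuous_on)
next
  case (Suc n)
  then obtain f' where d: "\<forall>x\<in>S. (f has_real_derivative f' x) (at x within S)"
    and c: "Cn_on S (Suc n) f'" by auto
  have "Cn_on S n f'" using Suc.IH[OF c] .
  with d show ?case by auto
qed

lemma Cn_on_SucI:
  "(\<And>x. x \<in> S \<Longrightarrow> (f has_real_derivative f' x) (at x within S)) \<Longrightarrow> Cn_on S n f' \<Longrightarrow> Cn_on S (Suc n) f"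
  by auto

lemma Cn_on_cont: "Cn_on S n f \<Longrightarrow> continuous_on S f"
  by (induction n) (auto dest: Cn_on_SucD simp del: Cn_on.simps(2))

lemma Cn_on_cong: "(\<And>x. x \<in> S \<Longrightarrow> f x = g x) \<Longrightarrow> Cn_on S n f \<longleftrightarrow> Cn_on S n g"
proof (induction n)
  case 0 then show ?case by (simp cong: continuous_on_cong)
next
  case (Suc n)
  have "(f has_real_derivative f' x) (at x within S) \<longleftrightarrow> (g has_real_derivative f' x) (at x within S)"
    if "x \<in> S" for x f'
    using that Suc.prems by (intro has_field_derivative_cong_eventually)
      (auto simp: eventually_at_filter)
  then show ?case by simp
qed

lemma Cn_on_const [intro]: "Cn_on S n (\<lambda>_. c)"
  by (induction n arbitrary: c) (auto intro!: exI[of _ "\<lambda>_. 0"])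

lemma Cn_on_id [intro]: "Cn_on S n (\<lambda>x. x)"
  by (cases n) (auto intro!: exI[of _ "\<lambda>_. 1"] DERIV_ident)

lemma Cn_on_add [intro]: "Cn_on S n f \<Longrightarrow> Cn_on S n g \<Longrightarrow> Cn_on S n (\<lambda>x. f x + g x)"
proof (induction n arbitrary: f g)
  case 0 then show ?case by (auto intro: continuous_intros)
next
  case (Suc n)
  from Suc.prems obtain f' g' where
    d: "\<forall>x\<in>S. (f has_real_derivative f' x) (at x within S)" "Cn_on S n f'"
    "\<forall>x\<in>S. (g has_real_derivative g' x) (at x within S)" "Cn_on S n g'" by auto
  then show ?case using Suc.IH[of f' g']
    by (auto intro!: exI[of _ "\<lambda>x. f' x + g' x"] DERIV_add)
qed

lemma Cn_on_mult [intro]: "Cn_on S n f \<Longrightarrow> Cn_on S n g \<Longrightarrow> Cn_on S n (\<lambda>x. f x * g x)"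
proof (induction n arbitrary: f g)
  case 0 then show ?case by (auto intro: continuous_intros)
next
  case (Suc n)
  from Suc.prems obtain f' g' where
    d: "\<forall>x\<in>S. (f has_real_derivative f' x) (at x within S)" "Cn_on S n f'"
    "\<forall>x\<in>S. (g has_real_derivative g' x) (at x within S)" "Cn_on S n g'" by auto
  have "Cn_on S n f" "Cn_on S n g" using Suc.prems Cn_on_SucD by blast+
  then have "Cn_on S n (\<lambda>x. f' x * g x + g' x * f x)"
    using Suc.IH d by (intro Cn_on_add) auto
  then show ?case using d
    by (auto intro!: exI[of _ "\<lambda>x. f' x * g x + g' x * f x"] DERIV_mult)
qed

lemma Cn_on_diff [intro]: "Cn_on S n f \<Longrightarrow> Cn_on S n g \<Longrightarrow> Cn_on S n (\<lambda>x. f x - g x)"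
  using Cn_on_add[of S n f "\<lambda>x. (-1) * g x"] Cn_on_mult[of S n "\<lambda>_. -1" g] by auto

text \<open>The chain rule is applied within the image of S, so that g may take end points of T as
  values. This matters at y = 1, where only one-sided derivatives are at hand.\<close>

lemma Cn_on_compose:
  "Cn_on T n f \<Longrightarrow> Cn_on S n g \<Longrightarrow> g ` S \<subseteq> T \<Longrightarrow> Cn_on S n (\<lambda>x. f (g x))"
proof (induction n arbitrary: f g)
  case 0
  then show ?case using continuous_on_compose2[of T f S g] by simp
next
  case (Suc n)
  from Suc.prems obtain f' g' where
    d: "\<forall>x\<in>T. (f has_real_derivative f' x) (at x within T)" "Cn_on T n f'"
    "\<forall>x\<in>S. (g has_real_derivative g' x) (at x within S)" "Cn_on S n g'" by auto
  have "Cn_on S n g" using Suc.prems Cn_on_SucD by blast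
  then have c: "Cn_on S n (\<lambda>x. f' (g x) * g' x)"
    by (intro Cn_on_mult Suc.IH[OF d(2)] d(4) Suc.prems(3))
  have "((\<lambda>x. f (g x)) has_real_derivative f' (g x) * g' x) (at x within S)" if "x \<in> S" for x
  proof -
    have "(f has_real_derivative f' (g x)) (at (g x) within g ` S)"
      by (rule has_field_derivative_subset[OF _ Suc.prems(3)]) (use d(1) Suc.prems(3) that in blast)
    from DERIV_image_chain[OF this d(3)[rule_format, OF that]] show ?thesis unfolding o_def .
  qed
  with c show ?case by (intro Cn_on_SucI)
qed

lemma Cn_on_subset: "Cn_on T n f \<Longrightarrow> S \<subseteq> T \<Longrightarrow> Cn_on S n f"
  using Cn_on_compose[of T n f S "\<lambda>x. x"] by auto

lemma Cn_on_powr: "Cn_on {0<..} n (\<lambda>x. x powr p)"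
proof (induction n arbitrary: p)
  case 0
  then show ?case by (auto intro!: continuous_intros)
next
  case (Suc n)
  have "Cn_on {0<..} n (\<lambda>x. p * x powr (p - 1))" using Suc by auto
  moreover have "((\<lambda>x. x powr p) has_real_derivative p * x powr (p - 1)) (at x within {0<..})"
    if "x > 0" for x
    using that by (auto intro!: derivative_eq_intros DERIV_subset[OF has_real_derivative_powr])
  ultimately show ?case by (intro Cn_on_SucI[where f'="\<lambda>x. p * x powr (p - 1)"]) auto
qed

text \<open>Both amplitudes are general because differentiation swaps cosine and sine; the family is
  then closed under differentiation and the induction goes through.\<close>

lemma Cn_on_trig: "Cn_on UNIV n (\<lambda>x. a * cos (l * x) + b * sin (l * x))"
proof (induction n arbitrary: a b)
  case 0 then show ?case by (auto intro!: continuous_intros)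
next
  case (Suc n)
  have "Cn_on UNIV n (\<lambda>x. (b * l) * cos (l * x) + (- a * l) * sin (l * x))" by (rule Suc)
  moreover have "((\<lambda>x. a * cos (l * x) + b * sin (l * x)) has_real_derivative
      (b * l) * cos (l * x) + (- a * l) * sin (l * x)) (at x)" for x
    by (auto intro!: derivative_eq_intros)
  ultimately show ?case by (intro Cn_on_SucI)
qed

text \<open>The coefficients are general because the derivative is again an everywhere convergent
  series, with coefficients \<open>diffs c\<close>.\<close>

lemma Cn_on_power_series:
  fixes c :: "nat \<Rightarrow> real"
  assumes "\<And>x. summable (\<lambda>m. c m * x ^ m)"
  shows "Cn_on UNIV n (\<lambda>x. \<Sum>m. c m * x ^ m)"
  using assms
proof (induction n arbitrary: c)
  case 0
  have "((\<lambda>x. \<Sum>m. c m * x ^ m) has_real_derivative (\<Sum>m. diffs c m * x ^ m)) (at x)" for x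
    by (rule termdiffs_strong_converges_everywhere) (use 0 in auto)
  then show ?case by (auto intro!: DERIV_continuous_on)
next
  case (Suc n)
  have "((\<lambda>x. \<Sum>m. c m * x ^ m) has_real_derivative (\<Sum>m. diffs c m * x ^ m)) (at x)" for x
    by (rule termdiffs_strong_converges_everywhere) (use Suc in auto)
  moreover have "Cn_on UNIV n (\<lambda>x. \<Sum>m. diffs c m * x ^ m)"
    by (rule Suc.IH, rule termdiff_converges_all) (use Suc.prems in auto)
  ultimately show ?case by (intro Cn_on_SucI)
qed

text \<open>The classical flat function exp(-1/x) multiplied by powers of 1/x. The powers are
  included because every derivative of exp(-1/x) is a combination of such terms, and all of them
  extend by 0 to the negative half-line.\<close>

definition bump :: "nat \<Rightarrow> real \<Rightarrow> real" where
  "bump k x = (if x > 0 then (1 / x) ^ k * exp (- (1 / x)) else 0)"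

lemma power_exp_le: "0 \<le> u \<Longrightarrow> u ^ k * exp (- u) \<le> (fact k :: real)"
proof -
  assume "0 \<le> (u::real)"
  then have "u ^ k / fact k \<le> (\<Sum>n. u ^ n / fact n)"
    using sum_le_suminf[OF summable_exp[of u], of "{k}"] by (simp add: divide_inverse mult.commute)
  also have "\<dots> = exp u" by (simp add: exp_def divide_inverse scaleR_conv_of_real mult.commute)
  finally have "u ^ k / fact k \<le> exp u" .
  then show ?thesis by (simp add: exp_minus field_simps)
qed

lemma bump_bounds: "0 \<le> bump k x" "bump k x \<le> fact k"
  using power_exp_le[of "1/x" k] by (auto simp: bump_def)

text \<open>Away from 0 this is calculus on an open half-line. At 0 the difference quotient for h >
  0 is \<open>bump k h / h = bump (k + 2) h * h\<close>, of size at most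
  \<open>fact (k + 2) * h\<close>, so the two branches meet with slope 0.\<close>

lemma bump_has_derivative:
  "(bump k has_real_derivative bump (k + 2) x - real k * bump (k + 1) x) (at x)"
proof (cases "x = 0")
  case False
  show ?thesis
  proof (cases "x > 0")
    case True
    have "((\<lambda>x. (1 / x) ^ k * exp (- (1 / x))) has_real_derivative
       (1/x)^(k+2) * exp (- (1 / x)) - real k * ((1/x)^(k+1) * exp (- (1 / x)))) (at x)"
    proof (cases k)
      case (Suc m)
      have *: "((\<lambda>x. (1 / x) ^ Suc m) has_real_derivative - real (Suc m) * (1/x)^(Suc m + 1)) (at x)"
      proof -
        have "((\<lambda>x. inverse x ^ Suc m) has_real_derivative
            real (Suc m) * (- (inverse x ^ Suc (Suc 0)) * inverse x ^ (Suc m - Suc 0))) (at x)"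
          using DERIV_power[OF DERIV_inverse[of x UNIV], of "Suc m"] True by simp
        then show ?thesis unfolding inverse_eq_divide
          by (rule DERIV_cong) (simp add: power_add power2_eq_square algebra_simps add_divide_distrib diff_divide_distrib)
      qed
      have **: "((\<lambda>x. exp (- (1 / x))) has_real_derivative (1/x)^2 * exp (- (1 / x))) (at x)"
        using True by (auto intro!: derivative_eq_intros simp: field_simps power2_eq_square)
      have eq: "- a * u ^ (Suc m + 1) * e + u\<^sup>2 * e * u ^ Suc m =
          u ^ (Suc m + 2) * e - a * (u ^ (Suc m + 1) * e)" for u e a :: real
        by (simp add: algebra_simps power2_eq_square)
      show ?thesis unfolding Suc using DERIV_mult[OF * **] by (rule DERIV_cong) (rule eq)
    qed (use True in \<open>auto intro!: derivative_eq_intros simp: field_simps power2_eq_square\<close>)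
    moreover have "\<forall>\<^sub>F y in nhds x. (1 / y) ^ k * exp (- (1 / y)) = bump k y"
      using eventually_nhds_in_open[of "{0<..}" x] True by (auto elim!: eventually_mono simp: bump_def)
    ultimately show ?thesis using True
      by (subst (asm) DERIV_cong_ev[OF refl _ refl]) (auto simp: bump_def)
  next
    case F: False
    have "((\<lambda>x. 0) has_real_derivative 0) (at x)" by simp
    moreover have "\<forall>\<^sub>F y in nhds x. 0 = bump k y"
      using eventually_nhds_in_open[of "{..<0}" x] False F
      by (auto elim!: eventually_mono simp: bump_def)
    ultimately show ?thesis using F
      by (subst (asm) DERIV_cong_ev[OF refl _ refl]) (auto simp: bump_def)
  qed
next
  case True
  have "((\<lambda>h. (bump k (0 + h) - bump k 0) / h) \<longlongrightarrow> 0) (at 0)"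
  proof (rule Lim_null_comparison)
    have "norm ((bump k (0 + h) - bump k 0) / h) \<le> fact (k + 2) * \<bar>h\<bar>" for h
    proof (cases "h > 0")
      case True
      have "bump k h / h = bump (k + 2) h * h" using True by (simp add: bump_def field_simps)
      also have "\<dots> \<le> fact (k + 2) * h" using bump_bounds[of "k+2" h] True by (intro mult_right_mono) auto
      finally show ?thesis using True bump_bounds(1)[of k h] by (simp add: bump_def[of k 0])
    next
      case False
      then have "(bump k (0 + h) - bump k 0) / h = 0" by (simp add: bump_def)
      then show ?thesis by (simp only: norm_zero) simp
    qed
    then show "\<forall>\<^sub>F h in at 0. norm ((bump k (0 + h) - bump k 0) / h) \<le> fact (k + 2) * \<bar>h\<bar>" by simp
    show "((\<lambda>h::real. fact (k + 2) * \<bar>h\<bar>) \<longlongrightarrow> 0) (at 0)"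
      by (auto intro!: tendsto_eq_intros)
  qed
  then show ?thesis using True by (simp add: DERIV_def bump_def[of _ 0])
qed

lemma Cn_on_bump: "Cn_on UNIV n (bump k)"
proof (induction n arbitrary: k)
  case 0
  then show ?case using bump_has_derivative by (auto intro!: DERIV_continuous_on)
next
  case (Suc n)
  have "Cn_on UNIV n (\<lambda>x. bump (k + 2) x - real k * bump (k + 1) x)"
    by (intro Cn_on_diff Cn_on_mult Suc Cn_on_const)
  then show ?case using bump_has_derivative[of k] by (intro Cn_on_SucI)
qed

section \<open>Smooth functions of three variables\<close>

primrec Cn3 :: "nat \<Rightarrow> (real \<Rightarrow> real \<Rightarrow> real \<Rightarrow> real) \<Rightarrow> bool" where
  "Cn3 0 f \<longleftrightarrow> continuous_on UNIV (\<lambda>(p::real \<times> real \<times> real). f (fst p) (fst (snd p)) (snd (snd p)))"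
| "Cn3 (Suc n) f \<longleftrightarrow> continuous_on UNIV (\<lambda>(p::real \<times> real \<times> real). f (fst p) (fst (snd p)) (snd (snd p))) \<and>
     (\<forall>x y z. (\<lambda>s. f s y z) differentiable (at x)
               \<and> (\<lambda>s. f x s z) differentiable (at y)
               \<and> (\<lambda>s. f x y s) differentiable (at z)) \<and> Cn3 n (D1 f) \<and> Cn3 n (D2 f) \<and> Cn3 n (D3 f)"

text \<open>\<open>Cn3 n\<close> unfolds the coinductive rule n times, so it can be proved by
  induction. The functions that satisfy it for every n are closed under \<open>D1\<close>,
  \<open>D2\<close> and \<open>D3\<close> and thus form an invariant for the coinduction.\<close>

lemma smooth3I:
  assumes "\<And>n. Cn3 n f" shows "smooth3 f"
proof -
  have "\<forall>n. Cn3 n f" using assms by auto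
  then show ?thesis
  proof (coinduction arbitrary: f)
    case smooth3
    then have "\<And>n. Cn3 (Suc n) f" by blast
    then show ?case by auto
  qed
qed

lemma Cn3_SucD: "Cn3 (Suc n) f \<Longrightarrow> Cn3 n f"
proof (induction n arbitrary: f)
  case 0
  then show ?case by simp
next
  case (Suc n)
  have "Cn3 n (D1 f)" "Cn3 n (D2 f)" "Cn3 n (D3 f)"
    using Suc.prems Suc.IH[of "D1 f"] Suc.IH[of "D2 f"] Suc.IH[of "D3 f"] by auto
  with Suc.prems show ?case by auto
qed

text \<open>The candidates \<open>f1\<close>, \<open>f2\<close>, \<open>f3\<close> equal the partial
  derivatives as functions, so smoothness can be checked on explicit formulas instead of on
  \<open>deriv\<close>.\<close>

lemma Cn3_SucI:
  assumes "continuous_on UNIV (\<lambda>(p::real \<times> real \<times> real). f (fst p) (fst (snd p)) (snd (snd p)))"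
    "\<And>x y z. ((\<lambda>s. f s y z) has_real_derivative f1 x y z) (at x)"
    "\<And>x y z. ((\<lambda>s. f x s z) has_real_derivative f2 x y z) (at y)"
    "\<And>x y z. ((\<lambda>s. f x y s) has_real_derivative f3 x y z) (at z)"
    "Cn3 n f1" "Cn3 n f2" "Cn3 n f3"
  shows "Cn3 (Suc n) f"
proof -
  have *: "D1 f = f1" "D2 f = f2" "D3 f = f3"
    using assms(2-4) by (auto simp: D1_def D2_def D3_def fun_eq_iff intro!: DERIV_imp_deriv)
  show ?thesis unfolding Cn3.simps *
    using assms by (intro conjI allI) (simp_all only: real_differentiable_def, blast+)
qed

lemma Cn3_SucE:
  assumes "Cn3 (Suc n) f"
  shows "continuous_on UNIV (\<lambda>(p::real \<times> real \<times> real). f (fst p) (fst (snd p)) (snd (snd p)))"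
    "((\<lambda>s. f s y z) has_real_derivative D1 f x y z) (at x)"
    "((\<lambda>s. f x s z) has_real_derivative D2 f x y z) (at y)"
    "((\<lambda>s. f x y s) has_real_derivative D3 f x y z) (at z)"
    "Cn3 n (D1 f)" "Cn3 n (D2 f)" "Cn3 n (D3 f)"
proof -
  note a = assms[unfolded Cn3.simps]
  show "continuous_on UNIV (\<lambda>(p::real \<times> real \<times> real). f (fst p) (fst (snd p)) (snd (snd p)))"
    "Cn3 n (D1 f)" "Cn3 n (D2 f)" "Cn3 n (D3 f)" using a by blast+
  show "((\<lambda>s. f s y z) has_real_derivative D1 f x y z) (at x)"
    unfolding D1_def DERIV_deriv_iff_real_differentiable using a by blast
  show "((\<lambda>s. f x s z) has_real_derivative D2 f x y z) (at y)"
    unfolding D2_def DERIV_deriv_iff_real_differentiable using a by blast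
  show "((\<lambda>s. f x y s) has_real_derivative D3 f x y z) (at z)"
    unfolding D3_def DERIV_deriv_iff_real_differentiable using a by blast
qed

lemma Cn3_const: "Cn3 n (\<lambda>x y z. c)"
  by (induction n arbitrary: c)
    (auto simp del: Cn3.simps(2) intro!: Cn3_SucI[where ?f1.0="\<lambda>x y z. 0" and ?f2.0="\<lambda>x y z. 0" and ?f3.0="\<lambda>x y z. 0"])

lemma Cn3_add: "Cn3 n f \<Longrightarrow> Cn3 n g \<Longrightarrow> Cn3 n (\<lambda>x y z. f x y z + g x y z)"
proof (induction n arbitrary: f g)
  case 0 then show ?case by (auto intro: continuous_intros)
next
  case (Suc n)
  note F = Cn3_SucE[OF Suc.prems(1)] and G = Cn3_SucE[OF Suc.prems(2)]
  show ?case
    by (rule Cn3_SucI[OF _ DERIV_add[OF F(2) G(2)] DERIV_add[OF F(3) G(3)] DERIV_add[OF F(4) G(4)]])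
      (auto intro!: Suc.IH F G continuous_on_add)
qed

lemma Cn3_mult: "Cn3 n f \<Longrightarrow> Cn3 n g \<Longrightarrow> Cn3 n (\<lambda>x y z. f x y z * g x y z)"
proof (induction n arbitrary: f g)
  case 0 then show ?case by (auto intro: continuous_intros)
next
  case (Suc n)
  note F = Cn3_SucE[OF Suc.prems(1)] and G = Cn3_SucE[OF Suc.prems(2)]
  show ?case
    by (rule Cn3_SucI[OF _ DERIV_mult[OF F(2) G(2)] DERIV_mult[OF F(3) G(3)] DERIV_mult[OF F(4) G(4)]])
      (auto intro!: Suc.IH F G continuous_on_mult Cn3_add Cn3_SucD[OF Suc.prems(1)] Cn3_SucD[OF Suc.prems(2)])
qed

lemma Cn3_x: "Cn3 n (\<lambda>x y z. x)"
  by (cases n) (auto simp del: Cn3.simps(2) intro!: Cn3_SucI continuous_intros Cn3_const DERIV_const DERIV_ident)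

lemma Cn3_y: "Cn3 n (\<lambda>x y z. y)"
  by (cases n) (auto simp del: Cn3.simps(2) intro!: Cn3_SucI continuous_intros Cn3_const DERIV_const DERIV_ident)

lemma Cn3_vertical: "Cn_on UNIV n h \<Longrightarrow> Cn3 n (\<lambda>x y z. h z)"
proof (induction n arbitrary: h)
  case 0
  then have "continuous_on UNIV h" by simp
  then have "continuous_on UNIV (\<lambda>(p::real \<times> real \<times> real). h (snd (snd p)))"
    by (rule continuous_on_compose2) (auto intro!: continuous_on_snd continuous_on_id)
  then show ?case by simp
next
  case (Suc n)
  then obtain h' where h': "\<And>x. (h has_real_derivative h' x) (at x)" "Cn_on UNIV n h'" by auto
  have "continuous_on UNIV h" using Cn_on_cont Suc.prems by blast
  then have c: "continuous_on UNIV (\<lambda>(p::real \<times> real \<times> real). h (snd (snd p)))"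
    by (rule continuous_on_compose2) (auto intro!: continuous_on_snd continuous_on_id)
  show ?case
    by (rule Cn3_SucI[OF c DERIV_const DERIV_const h'(1) Cn3_const Cn3_const Suc.IH[OF h'(2)]])
qed

text \<open>Since x^2 + y^2 stays in the closed half-line, the one-sided derivative of g at 0
  suffices on the axis. Each partial derivative is again a radial function times a coordinate, which
  keeps the induction going.\<close>

lemma Cn3_radial: "Cn_on {0..} n g \<Longrightarrow> Cn3 n (\<lambda>x y z. g (x\<^sup>2 + y\<^sup>2))"
proof (induction n arbitrary: g)
  case 0
  then have "continuous_on {0..} g" by simp
  then have "continuous_on UNIV (\<lambda>(p::real \<times> real \<times> real). g ((fst p)\<^sup>2 + (fst (snd p))\<^sup>2))"
    by (rule continuous_on_compose2)
      (auto intro!: continuous_on_add continuous_on_power continuous_on_fst continuous_on_snd continuous_on_id)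
  then show ?case by simp
next
  case (Suc n)
  then obtain g' where g': "\<And>x. x \<ge> 0 \<Longrightarrow> (g has_real_derivative g' x) (at x within {0..})" "Cn_on {0..} n g'" by auto
  have "continuous_on {0..} g" using Cn_on_cont Suc.prems by blast
  then have c: "continuous_on UNIV (\<lambda>(p::real \<times> real \<times> real). g ((fst p)\<^sup>2 + (fst (snd p))\<^sup>2))"
    by (rule continuous_on_compose2)
      (auto intro!: continuous_on_add continuous_on_power continuous_on_fst continuous_on_snd continuous_on_id)
  have *: "((\<lambda>s. g (u s)) has_real_derivative g' (u x) * u') (at x)"
    if "(u has_real_derivative u') (at x)" "\<And>s. u s \<ge> 0" for u u' x
  proof -
    have "(g has_real_derivative g' (u x)) (at (u x) within range u)"
      using that by (intro has_field_derivative_subset[OF g'(1)]) auto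
    from DERIV_image_chain[OF this that(1)] show ?thesis by (simp add: o_def)
  qed
  have d1: "((\<lambda>s. g (s\<^sup>2 + y\<^sup>2)) has_real_derivative g' (x\<^sup>2 + y\<^sup>2) * (2 * x)) (at x)" for x y
    by (rule *) (auto intro!: derivative_eq_intros)
  have d2: "((\<lambda>s. g (x\<^sup>2 + s\<^sup>2)) has_real_derivative g' (x\<^sup>2 + y\<^sup>2) * (2 * y)) (at y)" for x y
    by (rule *) (auto intro!: derivative_eq_intros)
  show ?case
    by (rule Cn3_SucI[OF c d1 d2 DERIV_const]) (intro Cn3_mult Cn3_const Cn3_x Cn3_y Suc.IH g')+
qed

section \<open>Radial test functions\<close>

text \<open>A power series in the square of the radius, so that radial functions are smooth across the
  axis r = 0. For negative arguments it is a cosine.\<close>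
definition cosh_sqrt :: "real \<Rightarrow> real" where "cosh_sqrt s = (\<Sum>m. (1 / fact (2 * m)) * s ^ m)"

lemma cosh_sqrt_sums: "(\<lambda>m. (1 / fact (2 * m)) * (r\<^sup>2) ^ m) sums cosh (r :: real)"
proof -
  have "(\<lambda>m. (\<lambda>n. if even n then r ^ n /\<^sub>R fact n else 0) (2 * m)) sums cosh r"
    using cosh_converges[of r]
    by (subst sums_mono_reindex) (auto simp: strict_mono_def elim!: evenE)
  then show ?thesis unfolding power_mult[symmetric] by (simp add: inverse_eq_divide)
qed

lemma cosh_sqrt_power2: "cosh_sqrt (r\<^sup>2) = cosh r"
  using cosh_sqrt_sums[of r] by (simp add: cosh_sqrt_def sums_iff)

text \<open>For s < 0 the terms are, up to sign, those of cosh at sqrt |s|, so the series converges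
  absolutely.\<close>

lemma summable_cosh_sqrt: "summable (\<lambda>m. (1 / fact (2 * m)) * (s :: real) ^ m)"
proof (rule summable_norm_cancel)
  show "summable (\<lambda>m. norm ((1 / fact (2 * m)) * s ^ m))"
    using cosh_sqrt_sums[of "sqrt \<bar>s\<bar>"] by (simp add: sums_iff power_abs abs_mult)
qed

lemma Cn_on_cosh_sqrt: "Cn_on UNIV n cosh_sqrt"
  unfolding cosh_sqrt_def[abs_def] by (rule Cn_on_power_series) (rule summable_cosh_sqrt)

text \<open>The function \<open>sech2\<close> below is sech^2(r/2), because 1 + cosh r = 2
  cosh^2(r/2); here it is written in terms of the squared radius. The power -1 in place of a
  quotient makes \<open>Cn_on_powr\<close> applicable.\<close>

definition sech2_sqrt :: "real \<Rightarrow> real" where "sech2_sqrt s = 2 * (1 + cosh_sqrt s) powr (- 1)"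

definition sech2 :: "real \<Rightarrow> real" where "sech2 r = 2 / (1 + cosh r)"

lemma cosh_sqrt_ge_1: "s \<ge> 0 \<Longrightarrow> cosh_sqrt s \<ge> 1"
  using cosh_sqrt_power2[of "sqrt s"] cosh_real_ge_1[of "sqrt s"] by simp

lemma sech2_sqrt_power2: "sech2_sqrt (r\<^sup>2) = sech2 r"
  using cosh_real_ge_1[of r] by (simp add: sech2_sqrt_def sech2_def cosh_sqrt_power2 powr_minus divide_inverse)

lemma sech2_sqrt_polar: "sech2_sqrt ((r * cos \<theta>)\<^sup>2 + (r * sin \<theta>)\<^sup>2) = sech2 r"
proof -
  have "(r * cos \<theta>)\<^sup>2 + (r * sin \<theta>)\<^sup>2 = r\<^sup>2 * ((cos \<theta>)\<^sup>2 + (sin \<theta>)\<^sup>2)"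
    by (simp only: power_mult_distrib distrib_left)
  then show ?thesis by (simp add: sech2_sqrt_power2)
qed

text \<open>The restriction to the half-line is essential: for negative s the function
  \<open>cosh_sqrt\<close> is a cosine and the denominator has zeros.\<close>

lemma Cn_on_sech2_sqrt: "Cn_on {0..} n sech2_sqrt"
  unfolding sech2_sqrt_def[abs_def]
  by (intro Cn_on_mult Cn_on_const Cn_on_compose[OF Cn_on_powr] Cn_on_add Cn_on_subset[OF Cn_on_cosh_sqrt])
    (use cosh_sqrt_ge_1 in \<open>fastforce\<close>)+

lemma sech2_bounds: "0 < sech2 r" "sech2 r \<le> 1"
  using cosh_real_ge_1[of r] by (simp_all add: sech2_def)

lemma sech2_zero [simp]: "sech2 0 = 1" by (simp add: sech2_def)

lemma sech2_sqrt_bounds: "s \<ge> 0 \<Longrightarrow> sech2_sqrt s \<in> {0<..1}"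
  using sech2_sqrt_power2[of "sqrt s"] sech2_bounds[of "sqrt s"] by simp

definition sech2_d1 :: "real \<Rightarrow> real" where "sech2_d1 r = - 2 * sinh r / (1 + cosh r)\<^sup>2"
definition sech2_d2 :: "real \<Rightarrow> real" where
  "sech2_d2 r = - 2 * cosh r / (1 + cosh r)\<^sup>2 + 4 * (sinh r)\<^sup>2 / (1 + cosh r) ^ 3"

lemma one_plus_cosh: "1 + cosh (r :: real) \<noteq> 0" using cosh_real_ge_1[of r] by linarith

lemma sech2_has_derivative: "(sech2 has_real_derivative sech2_d1 r) (at r)"
  unfolding sech2_def[abs_def] sech2_d1_def using one_plus_cosh[of r]
  by (auto intro!: derivative_eq_intros simp: power2_eq_square)

lemma sech2_d1_has_derivative: "(sech2_d1 has_real_derivative sech2_d2 r) (at r)"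
proof -
  have eq: "(- (2 * k) * c\<^sup>2 - - (2 * s) * (2 * c * s)) / (c\<^sup>2 * c\<^sup>2) = - 2 * k / c\<^sup>2 + 4 * s\<^sup>2 / c ^ 3"
    if "c \<noteq> 0" for k c s :: real
    using that by (simp add: divide_simps) (simp add: algebra_simps eval_nat_numeral)
  have "((\<lambda>r. - (2 * sinh r) / (1 + cosh r)\<^sup>2) has_real_derivative
     (- (2 * cosh r) * (1 + cosh r)\<^sup>2 - - (2 * sinh r) * (2 * (1 + cosh r) * sinh r)) /
     ((1 + cosh r)\<^sup>2 * (1 + cosh r)\<^sup>2)) (at r)"
    using one_plus_cosh[of r] by (auto intro!: derivative_eq_intros)
      (simp add: minus_divide_left algebra_simps power2_eq_square del: minus_divide_left[symmetric])
  then show ?thesis unfolding eq[OF one_plus_cosh] by (simp add: sech2_d1_def[abs_def] sech2_d2_def)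
qed

text \<open>By the chain rule the radial Laplacian of G(y) is y'^2 G'' + (y'' + coth r y') G'. This
  identity and the next one show that both coefficients are polynomials in y.\<close>

lemma sech2_d1_power2: "(sech2_d1 r)\<^sup>2 = (sech2 r)\<^sup>2 * (1 - sech2 r)"
proof -
  define c where "c = 1 + cosh r"
  have "(sinh r)\<^sup>2 = c * (c - 2)"
    using cosh_square_eq[of r] by (simp add: c_def power2_eq_square algebra_simps)
  moreover have "c \<noteq> 0" using one_plus_cosh[of r] by (simp add: c_def)
  ultimately show ?thesis
    unfolding sech2_d1_def sech2_def c_def[symmetric] power_divide power_mult_distrib
    by (simp add: divide_simps) (simp add: algebra_simps eval_nat_numeral)
qed

lemma sech2_radial_laplacian: "r \<noteq> 0 \<Longrightarrow> sech2_d2 r + cosh r / sinh r * sech2_d1 r = - (sech2 r)\<^sup>2"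
proof -
  assume r: "r \<noteq> 0"
  define c where "c = 1 + cosh r"
  have s: "(sinh r)\<^sup>2 = c * (c - 2)"
    using cosh_square_eq[of r] by (simp add: c_def power2_eq_square algebra_simps)
  have c: "c \<noteq> 0" using one_plus_cosh[of r] by (simp add: c_def)
  have ch: "cosh r = c - 1" by (simp add: c_def)
  have "cosh r / sinh r * sech2_d1 r = - 2 * cosh r / c\<^sup>2"
    using r by (simp add: sech2_d1_def c_def)
  then have "sech2_d2 r + cosh r / sinh r * sech2_d1 r = - 4 * (c - 1) / c\<^sup>2 + 4 * (c * (c - 2)) / c ^ 3"
    unfolding sech2_d2_def c_def[symmetric] s ch by simp
  also have "\<dots> = - (2 / c)\<^sup>2" using c
    by (simp add: divide_simps) (simp add: algebra_simps eval_nat_numeral)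
  finally show ?thesis by (simp add: sech2_def c_def)
qed

text \<open>On the axis each of the two horizontal second derivatives of y contributes -1/2. Their
  sum -1 is -y^2 at y = 1, the limit of the preceding formula.\<close>

lemma sech2_derivs_zero: "sech2_d2 0 = - 1 / 2" "sech2_d1 0 = 0" by (simp_all add: sech2_d2_def sech2_d1_def)

section \<open>The sub-Laplacian of products G(y) h(z)\<close>

lemma tanh_half_sq: "(tanh (r / 2))\<^sup>2 = 1 - sech2 r"
proof -
  define a where "a = cosh (r / 2)"
  have c: "cosh r = 2 * a\<^sup>2 - 1" using cosh_double_cosh[of "r/2"] by (simp add: a_def)
  have "(sinh (r/2))\<^sup>2 = a\<^sup>2 - 1" using cosh_square_eq[of "r/2"] by (simp add: a_def)
  moreover have "a \<noteq> 0" by (simp add: a_def)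
  ultimately show ?thesis unfolding tanh_def power_divide sech2_def c a_def[symmetric]
    by (simp add: field_simps)
qed

text \<open>The outer derivative is one-sided at y = 1, the value of y at radius 0. It suffices
  because u never exceeds 1.\<close>

lemma radial_deriv:
  assumes "\<And>y. y \<in> {0<..1} \<Longrightarrow> (G has_real_derivative G1 y) (at y within {0<..1})"
    and "(u has_real_derivative u1) (at x)" "\<And>s. u s \<in> {0<..1}"
  shows "((\<lambda>x. G (u x)) has_real_derivative G1 (u x) * u1) (at x)"
proof -
  have "(G has_real_derivative G1 (u x)) (at (u x) within range u)"
    by (rule has_field_derivative_subset[OF assms(1)]) (use assms(3) in auto)
  from DERIV_image_chain[OF this assms(2)] show ?thesis unfolding o_def .
qed

text \<open>The radial part of the full sub-Laplacian in the variable y; the factor 1/2 is added in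
  \<open>drift\<close>. Derivatives are passed as separate functions so that explicit formulas can
  be inserted for them.\<close>

definition radial_gen :: "(real \<Rightarrow> real) \<Rightarrow> (real \<Rightarrow> real) \<Rightarrow> real \<Rightarrow> real" where
  "radial_gen G1 G2 y = y\<^sup>2 * (1 - y) * G2 y - y\<^sup>2 * G1 y"

text \<open>Since y = sech^2(r/2) decreases to 0, vanishing for y \<le> \<eta> means vanishing for
  large r; together \<eta> and R give f bounded support.\<close>

context
  fixes G G1 G2 h h1 h2 :: "real \<Rightarrow> real" and \<eta> R :: real and f :: "real \<Rightarrow> real \<Rightarrow> real \<Rightarrow> real"
  assumes G: "\<And>n. Cn_on {0<..1} n G"
    and G1: "\<And>y. y \<in> {0<..1} \<Longrightarrow> (G has_real_derivative G1 y) (at y within {0<..1})"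
    and G2: "\<And>y. y \<in> {0<..1} \<Longrightarrow> (G1 has_real_derivative G2 y) (at y within {0<..1})"
    and h: "\<And>n. Cn_on UNIV n h"
    and h1: "\<And>z. (h has_real_derivative h1 z) (at z)"
    and h2: "\<And>z. (h1 has_real_derivative h2 z) (at z)"
    and \<eta>: "\<eta> > 0" "\<And>y. y \<le> \<eta> \<Longrightarrow> G y = 0"
    and R: "\<And>z. \<bar>z\<bar> > R \<Longrightarrow> h z = 0"
    and f: "f = (\<lambda>x y z. G (sech2_sqrt (x\<^sup>2 + y\<^sup>2)) * h z)"
begin

lemma cyl_radial: "cyl f r \<theta> z = G (sech2 r) * h z"
  by (simp add: cyl_def f sech2_sqrt_polar)

lemma test_fun_radial: "test_fun f"
  unfolding test_fun_def
proof
  have "Cn3 n f" for n unfolding f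
  proof (intro Cn3_mult Cn3_vertical h)
    have "Cn_on {0..} n (\<lambda>s. G (sech2_sqrt s))"
      by (rule Cn_on_compose[OF G Cn_on_sech2_sqrt]) (use sech2_sqrt_bounds in auto)
    from Cn3_radial[OF this] show "Cn3 n (\<lambda>x y z. G (sech2_sqrt (x\<^sup>2 + y\<^sup>2)))" .
  qed
  then show "smooth3 f" by (rule smooth3I)
  have "{(x, y, z). f x y z \<noteq> 0} \<subseteq> {-4/\<eta>..4/\<eta>} \<times> {-4/\<eta>..4/\<eta>} \<times> {-R..R}"
  proof clarify
    fix x y z assume "f x y z \<noteq> 0"
    then have *: "h z \<noteq> 0" "G (sech2_sqrt (x\<^sup>2 + y\<^sup>2)) \<noteq> 0" by (auto simp: f)
    define r where "r = sqrt (x\<^sup>2 + y\<^sup>2)"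
    have r2: "r\<^sup>2 = x\<^sup>2 + y\<^sup>2" "r \<ge> 0" by (simp_all add: r_def)
    have "\<not> sech2_sqrt (x\<^sup>2 + y\<^sup>2) \<le> \<eta>" using * \<eta>(2) by auto
    then have "\<eta> < 2 / (1 + cosh r)" unfolding r2(1)[symmetric] sech2_sqrt_power2 sech2_def by simp
    moreover have "1 + cosh r > 0" using cosh_real_ge_1[of r] by linarith
    ultimately have "1 + cosh r < 2 / \<eta>" using \<eta> by (simp add: field_simps)
    \<comment> \<open>Yields r < exp r \<le> 2 cosh r < 4 / \<eta>.\<close>
    moreover have "cosh r \<ge> exp r / 2" by (simp add: cosh_def)
    moreover have "4 / \<eta> = 2 * (2 / \<eta>)" by simp
    ultimately have "r \<le> 4 / \<eta>" using exp_ge_add_one_self[of r] by linarith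
    moreover have "\<bar>x\<bar> \<le> r" "\<bar>y\<bar> \<le> r" unfolding r_def by (auto intro!: real_le_rsqrt)
    moreover have "\<bar>z\<bar> \<le> R" using * R by force
    ultimately show "x \<in> {-4/\<eta>..4/\<eta>} \<and> (y, z) \<in> {-4/\<eta>..4/\<eta>} \<times> {-R..R}" by auto
  qed
  moreover have "bounded ({-4/\<eta>..4/\<eta>} \<times> {-4/\<eta>..4/\<eta>} \<times> {-R..R})"
    by (intro bounded_Times bounded_closed_interval)
  ultimately show "bounded {(x, y, z). f x y z \<noteq> 0}" by (rule bounded_subset[rotated])
qed

text \<open>The product does not depend on the angle, so both terms with a d_theta disappear. On the
  axis the value comes from the two Cartesian second derivatives; there y = 1, which makes the d_z^2
  term on the right vanish as well.\<close>

lemma subLap_radial: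
  assumes "r \<ge> 0"
  shows "(1/2) * subLap f r \<theta> z =
    (1/2) * (radial_gen G1 G2 (sech2 r) * h z + (1 - sech2 r) * G (sech2 r) * h2 z)"
proof -
  have d1: "((\<lambda>x. G (sech2 x)) has_real_derivative G1 (sech2 x) * sech2_d1 x) (at x)" for x
    by (rule radial_deriv[OF G1 sech2_has_derivative]) (use sech2_bounds in auto)
  have d1': "((\<lambda>x. G1 (sech2 x)) has_real_derivative G2 (sech2 x) * sech2_d1 x) (at x)" for x
    by (rule radial_deriv[OF G2 sech2_has_derivative]) (use sech2_bounds in auto)
  have d2: "((\<lambda>x. G1 (sech2 x) * sech2_d1 x) has_real_derivative
      G2 (sech2 x) * (sech2_d1 x)\<^sup>2 + G1 (sech2 x) * sech2_d2 x) (at x)" for x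
    using DERIV_mult[OF d1' sech2_d1_has_derivative] by (rule DERIV_cong) (simp add: power2_eq_square)
  \<comment> \<open>Stated for all real x, negative ones included, because second derivatives at x =
    0 need the first ones on both sides.\<close>
  have e1: "((\<lambda>x. G (sech2 x) * c) has_real_derivative G1 (sech2 x) * sech2_d1 x * c) (at x)" for x c
    using d1 by (rule DERIV_cmult_right)
  have e2: "((\<lambda>x. G1 (sech2 x) * sech2_d1 x * c) has_real_derivative
      (G2 (sech2 x) * (sech2_d1 x)\<^sup>2 + G1 (sech2 x) * sech2_d2 x) * c) (at x)" for x c
    using d2 by (rule DERIV_cmult_right)
  show ?thesis
  proof (cases "r = 0")
    case True
    have "D1 f x 0 z = G1 (sech2 x) * sech2_d1 x * h z" for x
      unfolding D1_def f using DERIV_imp_deriv[OF e1] by (simp add: sech2_sqrt_power2)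
    then have "D1 (D1 f) 0 0 z = - 1 / 2 * G1 1 * h z"
      unfolding D1_def[of "D1 f"] using DERIV_imp_deriv[OF e2[of "h z" 0]] by (simp add: sech2_derivs_zero)
    moreover have "D2 f 0 x z = G1 (sech2 x) * sech2_d1 x * h z" for x
      unfolding D2_def f using DERIV_imp_deriv[OF e1] by (simp add: sech2_sqrt_power2)
    then have "D2 (D2 f) 0 0 z = - 1 / 2 * G1 1 * h z"
      unfolding D2_def[of "D2 f"] using DERIV_imp_deriv[OF e2[of "h z" 0]] by (simp add: sech2_derivs_zero)
    ultimately show ?thesis using True by (simp add: subLap_def radial_gen_def)
  next
    case False
    define g where "g = cyl f"
    have g: "g = (\<lambda>r \<theta> z. G (sech2 r) * h z)" by (simp add: g_def cyl_radial fun_eq_iff)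
    have g1: "D1 g = (\<lambda>r \<theta> z. G1 (sech2 r) * sech2_d1 r * h z)"
      unfolding g by (intro ext, unfold D1_def, rule DERIV_imp_deriv[OF e1])
    have g11: "D1 (D1 g) = (\<lambda>r \<theta> z. (G2 (sech2 r) * (sech2_d1 r)\<^sup>2 + G1 (sech2 r) * sech2_d2 r) * h z)"
      unfolding g1 by (intro ext, unfold D1_def, rule DERIV_imp_deriv[OF e2])
    have g2: "D2 g = (\<lambda>r \<theta> z. 0)" unfolding D2_def g by simp
    have g22: "D2 (D2 g) = (\<lambda>r \<theta> z. 0)" "D3 (D2 g) = (\<lambda>r \<theta> z. 0)"
      unfolding g2 unfolding D2_def D3_def by simp_all
    have g3: "D3 g = (\<lambda>r \<theta> z. G (sech2 r) * h1 z)"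
      unfolding D3_def g using DERIV_imp_deriv[OF DERIV_cmult[OF h1]] by (simp add: fun_eq_iff)
    have g33: "D3 (D3 g) = (\<lambda>r \<theta> z. G (sech2 r) * h2 z)"
      unfolding g3 unfolding D3_def using DERIV_imp_deriv[OF DERIV_cmult[OF h2]] by (simp add: fun_eq_iff)
    have "subLap f r \<theta> z = (G2 (sech2 r) * (sech2_d1 r)\<^sup>2 + G1 (sech2 r) * (sech2_d2 r + cosh r / sinh r * sech2_d1 r)) * h z
       + (1 - sech2 r) * G (sech2 r) * h2 z"
      using False by (simp add: subLap_def g_def[symmetric] Let_def g11 g22 g33 tanh_half_sq)
        (simp add: g1 algebra_simps)
    then show ?thesis unfolding sech2_d1_power2 sech2_radial_laplacian[OF False] radial_gen_def by (simp add: algebra_simps)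
  qed
qed

end

section \<open>The martingale problem for functions of the radius and the height\<close>

text \<open>By path continuity the process is a limit of processes frozen at the last grid point of
  mesh 1/(n+1), and these are jointly measurable as countable gluings. Clamping with
  \<open>c\<close> keeps the grid points inside {a..b}.\<close>

lemma joint_measurable:
  fixes X :: "real \<Rightarrow> 'b \<Rightarrow> real"
  assumes "a \<le> b" "\<And>u. u \<in> {a..b} \<Longrightarrow> X u \<in> borel_measurable N"
    and cont: "\<And>\<omega>. \<omega> \<in> space N \<Longrightarrow> continuous_on {a..b} (\<lambda>u. X u \<omega>)"
  shows "(\<lambda>(u, \<omega>). indicator {a..b} u * X u \<omega>) \<in> borel_measurable (lborel \<Otimes>\<^sub>M N)"
proof -
  define c where "c u = max a (min u b)" for u
  define g where "g n u = c (real_of_int \<lfloor>real (Suc n) * c u\<rfloor> / real (Suc n))" for n u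
  have c: "c u \<in> {a..b}" for u using assms(1) by (auto simp: c_def)
  have c_id: "c u = u" if "u \<in> {a..b}" for u using that by (auto simp: c_def)
  have cc: "continuous_on UNIV c" unfolding c_def[abs_def] by (intro continuous_intros)
  have [measurable]: "c \<in> borel_measurable borel" using cc by (rule borel_measurable_continuous_onI)
  have process_measurable: "(\<lambda>(u, \<omega>). X (g n u) \<omega>) \<in> borel_measurable (lborel \<Otimes>\<^sub>M N)" for n
  proof -
    have "(\<lambda>p. X (c (real_of_int i / real (Suc n))) (snd p)) \<in> borel_measurable (lborel \<Otimes>\<^sub>M N)" for i
      by (rule measurable_compose[OF measurable_snd assms(2)[OF c]])
    moreover have "(\<lambda>p. \<lfloor>real (Suc n) * c (fst p)\<rfloor>) \<in> measurable (lborel \<Otimes>\<^sub>M N) (count_space UNIV)"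
      by measurable
    ultimately have "(\<lambda>p. X (c (real_of_int \<lfloor>real (Suc n) * c (fst p)\<rfloor> / real (Suc n))) (snd p))
        \<in> borel_measurable (lborel \<Otimes>\<^sub>M N)"
      by (rule measurable_compose_countable)
    then show ?thesis by (simp add: g_def split_beta')
  qed
  have lim: "(\<lambda>n. g n u) \<longlonglongrightarrow> c u" for u
  proof -
    have "(\<lambda>n. real_of_int \<lfloor>real (Suc n) * c u\<rfloor> / real (Suc n)) \<longlonglongrightarrow> c u"
    proof (rule Lim_transform2[OF tendsto_const])
      have "norm (c u - real_of_int \<lfloor>real (Suc n) * c u\<rfloor> / real (Suc n)) \<le> inverse (real (Suc n))" for n
      proof -
        have "c u - real_of_int \<lfloor>real (Suc n) * c u\<rfloor> / real (Suc n) =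
            (real (Suc n) * c u - real_of_int \<lfloor>real (Suc n) * c u\<rfloor>) / real (Suc n)"
          by (simp add: field_simps del: of_nat_Suc)
        also have "norm \<dots> \<le> 1 / real (Suc n)"
          unfolding norm_divide by (intro frac_le) (linarith | simp)+
        finally show ?thesis by (simp add: inverse_eq_divide del: of_nat_Suc)
      qed
      then show "(\<lambda>n. c u - real_of_int \<lfloor>real (Suc n) * c u\<rfloor> / real (Suc n)) \<longlonglongrightarrow> 0"
        by (intro Lim_null_comparison[OF _ LIMSEQ_inverse_real_of_nat]) simp
    qed
    then have "(\<lambda>n. c (real_of_int \<lfloor>real (Suc n) * c u\<rfloor> / real (Suc n))) \<longlonglongrightarrow> c (c u)"
      by (intro isCont_tendsto_compose[where g=c]) (use cc in \<open>simp_all add: continuous_on_eq_continuous_at\<close>)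
    then show ?thesis using c_id[OF c] by (simp add: g_def)
  qed
  have "(\<lambda>(u, \<omega>). X (c u) \<omega>) \<in> borel_measurable (lborel \<Otimes>\<^sub>M N)"
  proof (rule borel_measurable_LIMSEQ_real[OF _ process_measurable])
    fix p :: "real \<times> 'b" assume "p \<in> space (lborel \<Otimes>\<^sub>M N)"
    then have p: "snd p \<in> space N" by (auto simp: space_pair_measure)
    have "(\<lambda>n. X (g n (fst p)) (snd p)) \<longlonglongrightarrow> X (c (fst p)) (snd p)"
      by (rule continuous_on_tendsto_compose[OF cont[OF p] lim c])
        (unfold g_def, intro always_eventually allI c)
    then show "(\<lambda>n. case p of (u, \<omega>) \<Rightarrow> X (g n u) \<omega>) \<longlonglongrightarrow> (case p of (u, \<omega>) \<Rightarrow> X (c u) \<omega>)"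
      by (simp add: split_beta')
  qed
  then have "(\<lambda>(u, \<omega>). indicator {a..b} u * X (c u) \<omega>) \<in> borel_measurable (lborel \<Otimes>\<^sub>M N)"
    by (simp add: split_beta')
  also have "(\<lambda>(u, \<omega>). indicator {a..b} u * X (c u) \<omega>) = (\<lambda>(u, \<omega>). indicator {a..b} u * X u \<omega>)"
    by (auto simp: fun_eq_iff c_id split: split_indicator)
  finally show ?thesis .
qed

lemma (in prob_space) fubini_bounded:
  fixes X :: "real \<Rightarrow> 'a \<Rightarrow> real"
  assumes process_measurable: "(\<lambda>(u, \<omega>). indicator {a..b} u * X u \<omega>) \<in> borel_measurable (lborel \<Otimes>\<^sub>M M)"
    and bound: "\<And>u \<omega>. u \<in> {a..b} \<Longrightarrow> \<omega> \<in> space M \<Longrightarrow> \<bar>X u \<omega>\<bar> \<le> B"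
  shows "integrable M (\<lambda>\<omega>. LBINT u:{a..b}. X u \<omega>)"
    and "(\<integral>\<omega>. (LBINT u:{a..b}. X u \<omega>) \<partial>M) = (LBINT u:{a..b}. (\<integral>\<omega>. X u \<omega> \<partial>M))"
    and "set_integrable lborel {a..b} (\<lambda>u. \<integral>\<omega>. X u \<omega> \<partial>M)"
    and "\<And>\<omega>. \<omega> \<in> space M \<Longrightarrow> set_integrable lborel {a..b} (\<lambda>u. X u \<omega>)"
    and "\<And>\<omega>. \<omega> \<in> space M \<Longrightarrow> \<bar>LBINT u:{a..b}. X u \<omega>\<bar> \<le> \<bar>B\<bar> * \<bar>b - a\<bar>"
proof -
  interpret P: pair_sigma_finite lborel M ..
  have int: "integrable (lborel \<Otimes>\<^sub>M M) (\<lambda>(u, \<omega>). indicator {a..b} u * X u \<omega>)"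
  proof (rule Bochner_Integration.integrable_bound[OF _ process_measurable])
    show "integrable (lborel \<Otimes>\<^sub>M M) (\<lambda>p. indicator ({a..b} \<times> space M) p * \<bar>B\<bar>)"
      by (intro integrable_mult_left integrable_real_indicator)
        (auto simp: emeasure_pair_measure_Times emeasure_space_1 emeasure_lborel_Icc_eq)
    show "AE p in lborel \<Otimes>\<^sub>M M. norm (case p of (u, \<omega>) \<Rightarrow> indicator {a..b} u * X u \<omega>)
        \<le> norm (indicator ({a..b} \<times> space M) p * \<bar>B\<bar>)"
      using bound by (intro AE_I2) (force simp: space_pair_measure split: split_indicator)
  qed
  have sw: "(LBINT u. (indicator {a..b} u * X u \<omega>)) = (LBINT u:{a..b}. X u \<omega>)" for \<omega>
    by (simp add: set_lebesgue_integral_def)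
  have sw': "(\<integral>\<omega>. indicator {a..b} u * X u \<omega> \<partial>M) = indicator {a..b} u *\<^sub>R (\<integral>\<omega>. X u \<omega> \<partial>M)" for u
    by (simp split: split_indicator)
  show "integrable M (\<lambda>\<omega>. LBINT u:{a..b}. X u \<omega>)"
    using P.integrable_snd[OF int] unfolding sw .
  show "set_integrable lborel {a..b} (\<lambda>u. \<integral>\<omega>. X u \<omega> \<partial>M)"
    using P.integrable_fst[OF int] unfolding sw' set_integrable_def .
  show "(\<integral>\<omega>. (LBINT u:{a..b}. X u \<omega>) \<partial>M) = (LBINT u:{a..b}. (\<integral>\<omega>. X u \<omega> \<partial>M))"
    using P.Fubini_integral[OF int] unfolding sw sw' set_lebesgue_integral_def .
  fix \<omega> assume w: "\<omega> \<in> space M"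
  have "(\<lambda>u. indicator {a..b} u * X u \<omega>) \<in> borel_measurable lborel"
    using measurable_compose[OF measurable_Pair2'[OF w] process_measurable] by simp
  moreover have ib: "integrable lborel (\<lambda>u. indicator {a..b} u * \<bar>B\<bar>)"
    by (intro integrable_mult_left integrable_real_indicator)
      (auto simp: emeasure_lborel_Icc_eq)
  moreover have le: "\<bar>indicator {a..b} u * X u \<omega>\<bar> \<le> indicator {a..b} u * \<bar>B\<bar>" for u
    using bound[OF _ w, of u] by (cases "u \<in> {a..b}") auto
  ultimately have si: "integrable lborel (\<lambda>u. indicator {a..b} u * X u \<omega>)"
    using order_trans[OF le abs_ge_self]
    by (intro Bochner_Integration.integrable_bound[OF ib]) auto
  then show "set_integrable lborel {a..b} (\<lambda>u. X u \<omega>)" by (simp add: set_integrable_def)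
  have "\<bar>LBINT u. indicator {a..b} u * X u \<omega>\<bar> \<le> (LBINT u. indicator {a..b} u * \<bar>B\<bar>)"
    using le by (intro integral_abs_bound_integral si ib) auto
  then show "\<bar>LBINT u:{a..b}. X u \<omega>\<bar> \<le> \<bar>B\<bar> * \<bar>b - a\<bar>"
    unfolding sw by (cases "a \<le> b") (auto simp: mult.commute)
qed

text \<open>The class of observables of (Y, z). The domain stops short of y = 0, which corresponds
  to infinite radius and is never reached.\<close>

definition bcont :: "(real \<Rightarrow> real \<Rightarrow> real) \<Rightarrow> bool" where
  "bcont \<phi> \<longleftrightarrow> continuous_on ({0<..1} \<times> UNIV) (\<lambda>p. \<phi> (fst p) (snd p)) \<and>
     (\<exists>B. \<forall>y\<in>{0<..1}. \<forall>z. \<bar>\<phi> y z\<bar> \<le> B)"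

lemma bcont_prodI:
  assumes "continuous_on {0<..1} g" "continuous_on UNIV h"
    "\<And>y. y \<in> {0<..1} \<Longrightarrow> \<bar>g y\<bar> \<le> B" "\<And>z. \<bar>h z\<bar> \<le> C"
  shows "bcont (\<lambda>y z. g y * h z)"
  unfolding bcont_def
proof (intro conjI exI ballI allI)
  show "continuous_on ({0<..1} \<times> UNIV) (\<lambda>p. g (fst p) * h (snd p))"
    by (intro continuous_on_mult continuous_on_compose2[OF assms(1)] continuous_on_compose2[OF assms(2)]
        continuous_on_fst continuous_on_snd continuous_on_id) auto
  fix y z :: real assume y: "y \<in> {0<..1}"
  show "\<bar>g y * h z\<bar> \<le> B * C" unfolding abs_mult
    using assms(3)[OF y] assms(4)[of z] by (intro mult_mono) auto
qed

lemma bcont_add: "bcont f \<Longrightarrow> bcont g \<Longrightarrow> bcont (\<lambda>y z. f y z + g y z)"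
  unfolding bcont_def
proof (elim conjE exE, intro conjI continuous_on_add)
  fix B C assume "\<forall>y\<in>{0<..1}. \<forall>z. \<bar>f y z\<bar> \<le> B" "\<forall>y\<in>{0<..1}. \<forall>z. \<bar>g y z\<bar> \<le> C"
  then have "\<forall>y\<in>{0<..1}. \<forall>z. \<bar>f y z + g y z\<bar> \<le> B + C"
    by (meson abs_triangle_ineq add_mono order_trans)
  then show "\<exists>B. \<forall>y\<in>{0<..1}. \<forall>z. \<bar>f y z + g y z\<bar> \<le> B" by blast
qed

section \<open>Elementary consequences of the definition of the process\<close>

locale sl2bm =
  fixes M :: "'a measure" and r \<theta> z :: "real \<Rightarrow> 'a \<Rightarrow> real"
  assumes bm: "SL2_brownian_motion_from_origin M r \<theta> z"
begin

sublocale prob_space M using bm by (simp add: SL2_brownian_motion_from_origin_def)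

abbreviation "F \<equiv> nat_filtration M r \<theta> z"

definition Y :: "real \<Rightarrow> 'a \<Rightarrow> real" where "Y t \<omega> = sech2 (r t \<omega>)"

lemma process_measurable: "t \<ge> 0 \<Longrightarrow> r t \<in> borel_measurable M" "t \<ge> 0 \<Longrightarrow> \<theta> t \<in> borel_measurable M"
  "t \<ge> 0 \<Longrightarrow> z t \<in> borel_measurable M"
  and r_nonneg: "t \<ge> 0 \<Longrightarrow> \<omega> \<in> space M \<Longrightarrow> r t \<omega> \<ge> 0"
  and start_at_origin: "\<omega> \<in> space M \<Longrightarrow> r 0 \<omega> = 0" "\<omega> \<in> space M \<Longrightarrow> z 0 \<omega> = 0"
  and paths: "\<omega> \<in> space M \<Longrightarrow> continuous_on {0..}
          (\<lambda>t. (r t \<omega> * cos (\<theta> t \<omega>), r t \<omega> * sin (\<theta> t \<omega>), z t \<omega>))"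
  and martingale_problem: "test_fun f \<Longrightarrow> 0 \<le> s \<Longrightarrow> s \<le> t \<Longrightarrow> integrable M (mp_process f r \<theta> z t)"
    "test_fun f \<Longrightarrow> 0 \<le> s \<Longrightarrow> s \<le> t \<Longrightarrow> A \<in> sets (F s) \<Longrightarrow>
       (\<integral>\<omega>. mp_process f r \<theta> z t \<omega> * indicator A \<omega> \<partial>M)
             = (\<integral>\<omega>. mp_process f r \<theta> z s \<omega> * indicator A \<omega> \<partial>M)"
proof -
  note b = bm[unfolded SL2_brownian_motion_from_origin_def]
  note b2 = b[THEN conjunct2] note b3 = b2[THEN conjunct2] note b4 = b3[THEN conjunct2]
  note b5 = b4[THEN conjunct2] note b6 = b5[THEN conjunct2, THEN spec, THEN HOL.mp]
  show "t \<ge> 0 \<Longrightarrow> r t \<in> borel_measurable M" "t \<ge> 0 \<Longrightarrow> \<theta> t \<in> borel_measurable M"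
    "t \<ge> 0 \<Longrightarrow> z t \<in> borel_measurable M"
    using b2[THEN conjunct1] by blast+
  show "t \<ge> 0 \<Longrightarrow> \<omega> \<in> space M \<Longrightarrow> r t \<omega> \<ge> 0" using b3[THEN conjunct1] by blast
  show "\<omega> \<in> space M \<Longrightarrow> r 0 \<omega> = 0" "\<omega> \<in> space M \<Longrightarrow> z 0 \<omega> = 0" using b4[THEN conjunct1] by blast+
  show "\<omega> \<in> space M \<Longrightarrow> continuous_on {0..}
          (\<lambda>t. (r t \<omega> * cos (\<theta> t \<omega>), r t \<omega> * sin (\<theta> t \<omega>), z t \<omega>))" using b5[THEN conjunct1] by blast
  assume tf: "test_fun f" and s: "0 \<le> s" and st: "s \<le> t"
  note b7 = b6[OF tf, THEN spec, THEN spec, THEN HOL.mp, OF s, THEN HOL.mp, OF st]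
  show "integrable M (mp_process f r \<theta> z t)" by (rule b7[THEN conjunct1])
  show "A \<in> sets (F s) \<Longrightarrow>
       (\<integral>\<omega>. mp_process f r \<theta> z t \<omega> * indicator A \<omega> \<partial>M)
             = (\<integral>\<omega>. mp_process f r \<theta> z s \<omega> * indicator A \<omega> \<partial>M)" by (rule b7[THEN conjunct2, THEN bspec])
qed

lemma space_F [simp]: "space (F s) = space M"
  by (simp add: nat_filtration_def space_measure_of_conv)

lemma triple_in_F:
  assumes "0 \<le> u" "u \<le> s"
  shows "(\<lambda>\<omega>. (r u \<omega>, \<theta> u \<omega>, z u \<omega>)) \<in> measurable (F s) borel"
proof (rule measurableI)
  fix A :: "(real \<times> real \<times> real) set" assume "A \<in> sets borel"
  then show "(\<lambda>\<omega>. (r u \<omega>, \<theta> u \<omega>, z u \<omega>)) -` A \<inter> space (F s) \<in> sets (F s)"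
    using assms unfolding space_F unfolding nat_filtration_def
    by (intro in_measure_of) (auto intro!: bexI[of _ u] bexI[of _ A])
qed simp

lemma r_in_F: "0 \<le> u \<Longrightarrow> u \<le> s \<Longrightarrow> r u \<in> borel_measurable (F s)"
  and z_in_F: "0 \<le> u \<Longrightarrow> u \<le> s \<Longrightarrow> z u \<in> borel_measurable (F s)"
proof -
  assume "0 \<le> u" "u \<le> s"
  note m = triple_in_F[OF this]
  have "(\<lambda>p :: real \<times> real \<times> real. fst p) \<in> borel_measurable borel"
    "(\<lambda>p :: real \<times> real \<times> real. snd (snd p)) \<in> borel_measurable borel"
    by (intro borel_measurable_continuous_onI continuous_intros)+
  from this[THEN measurable_compose[OF m]]
  show "r u \<in> borel_measurable (F s)" "z u \<in> borel_measurable (F s)" by simp_all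
qed

lemma subalgebra_F:
  assumes "0 \<le> s" shows "subalgebra M (F s)"
proof -
  have "(\<lambda>\<omega>. (r u \<omega>, \<theta> u \<omega>, z u \<omega>)) -` A \<inter> space M \<in> sets M"
    if "u \<in> {0..s}" "A \<in> sets borel" for u and A :: "(real \<times> real \<times> real) set"
  proof -
    have "(\<lambda>\<omega>. (r u \<omega>, \<theta> u \<omega>, z u \<omega>)) \<in> measurable M (borel \<Otimes>\<^sub>M borel \<Otimes>\<^sub>M borel)"
      using process_measurable[of u] that by simp
    then show ?thesis using that(2) by (intro measurable_sets) (simp_all add: borel_prod)
  qed
  then have "sets (F s) \<subseteq> sets M"
    unfolding nat_filtration_def by (subst sets_measure_of) (auto intro!: sets.sigma_sets_subset)
  then show ?thesis by (simp add: subalgebra_def)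
qed

text \<open>Continuity is assumed in the Cartesian chart, since the angle is singular on the axis.
  The radius is recovered as the Euclidean norm of the first two coordinates, using that it is
  nonnegative.\<close>

lemma r_cont: "\<omega> \<in> space M \<Longrightarrow> continuous_on {0..} (\<lambda>t. r t \<omega>)"
  and z_cont: "\<omega> \<in> space M \<Longrightarrow> continuous_on {0..} (\<lambda>t. z t \<omega>)"
proof -
  assume w: "\<omega> \<in> space M"
  show "continuous_on {0..} (\<lambda>t. z t \<omega>)" using continuous_on_snd[OF continuous_on_snd[OF paths[OF w]]] by simp
  have "continuous_on {0..} (\<lambda>t. sqrt ((r t \<omega> * cos (\<theta> t \<omega>))\<^sup>2 + (r t \<omega> * sin (\<theta> t \<omega>))\<^sup>2))"
    using continuous_on_fst[OF paths[OF w]] continuous_on_fst[OF continuous_on_snd[OF paths[OF w]]]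
    by (intro continuous_on_real_sqrt continuous_on_add continuous_on_power) simp_all
  moreover have "sqrt ((a * cos b)\<^sup>2 + (a * sin b)\<^sup>2) = \<bar>a\<bar>" for a b :: real
  proof -
    have "(a * cos b)\<^sup>2 + (a * sin b)\<^sup>2 = a\<^sup>2 * ((cos b)\<^sup>2 + (sin b)\<^sup>2)"
      by (simp only: power_mult_distrib distrib_left)
    then show ?thesis by simp
  qed
  ultimately have "continuous_on {0..} (\<lambda>t. \<bar>r t \<omega>\<bar>)" by simp
  then show "continuous_on {0..} (\<lambda>t. r t \<omega>)"
    by (rule continuous_on_eq) (use r_nonneg w in auto)
qed

lemma sech2_continuous: "continuous_on UNIV sech2"
  by (rule DERIV_continuous_on[of _ _ sech2_d1]) (simp add: sech2_has_derivative)

lemma Y_cont: "\<omega> \<in> space M \<Longrightarrow> continuous_on {0..} (\<lambda>t. Y t \<omega>)"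
  unfolding Y_def by (rule continuous_on_compose2[OF sech2_continuous r_cont]) auto

lemma Y_in: "Y t \<omega> \<in> {0<..1}" unfolding Y_def using sech2_bounds by simp

lemma Y_start: "\<omega> \<in> space M \<Longrightarrow> Y 0 \<omega> = 1" by (simp add: Y_def start_at_origin)

lemma bcont_cont:
  assumes "bcont \<phi>" "\<omega> \<in> space M" shows "continuous_on {0..} (\<lambda>t. \<phi> (Y t \<omega>) (z t \<omega>))"
proof -
  have "continuous_on {0..} (\<lambda>t. (Y t \<omega>, z t \<omega>))"
    by (intro continuous_on_Pair Y_cont z_cont assms)
  from continuous_on_compose2[OF assms(1)[unfolded bcont_def, THEN conjunct1] this]
  show ?thesis using Y_in[of _ \<omega>] by (simp add: image_subset_iff)
qed

text \<open>N is arbitrary because the lemma serves both M and the past \<open>F s\<close>.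
  Continuity holds only on the strip, so the indicator of the strip is inserted; it equals 1 along
  the process.\<close>

lemma bcont_meas_gen:
  assumes "bcont \<phi>" "r t \<in> borel_measurable N" "z t \<in> borel_measurable N"
  shows "(\<lambda>\<omega>. \<phi> (Y t \<omega>) (z t \<omega>)) \<in> borel_measurable N"
proof -
  have yb: "sech2 \<in> borel_measurable borel" using sech2_continuous by (rule borel_measurable_continuous_onI)
  have Ym: "Y t \<in> borel_measurable N"
    unfolding Y_def[abs_def] by (rule measurable_compose[OF assms(2) yb])
  have "{0<..1::real} \<times> (UNIV :: real set) \<in> sets (borel \<Otimes>\<^sub>M borel)" by (intro pair_measureI) auto
  then have "{0<..1::real} \<times> (UNIV :: real set) \<in> sets borel" by (simp only: borel_prod)
  from borel_measurable_continuous_on_indicator[OF this assms(1)[unfolded bcont_def, THEN conjunct1]]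
  have m: "(\<lambda>p. indicator ({0<..1} \<times> UNIV) p *\<^sub>R \<phi> (fst p) (snd p)) \<in> borel_measurable (borel \<Otimes>\<^sub>M borel)"
    by (simp only: borel_prod)
  have "indicator ({0<..1} \<times> UNIV) (Y t \<omega>, z t \<omega>) = (1 :: real)" for \<omega>
    using Y_in[of t \<omega>] by (simp add: indicator_def)
  with measurable_compose[OF measurable_Pair[OF Ym assms(3)] m] show ?thesis by simp
qed

lemma bcont_meas: "bcont \<phi> \<Longrightarrow> 0 \<le> t \<Longrightarrow> (\<lambda>\<omega>. \<phi> (Y t \<omega>) (z t \<omega>)) \<in> borel_measurable M"
  by (rule bcont_meas_gen[OF _ process_measurable(1) process_measurable(3)])

lemma bcont_meas_F: "bcont \<phi> \<Longrightarrow> 0 \<le> u \<Longrightarrow> u \<le> s \<Longrightarrow> (\<lambda>\<omega>. \<phi> (Y u \<omega>) (z u \<omega>)) \<in> borel_measurable (F s)"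
  by (rule bcont_meas_gen[OF _ r_in_F z_in_F])

lemma bcont_bound: "bcont \<phi> \<Longrightarrow> \<exists>B. \<forall>t \<omega>. \<bar>\<phi> (Y t \<omega>) (z t \<omega>)\<bar> \<le> B"
proof -
  assume "bcont \<phi>"
  then obtain B where "\<forall>y\<in>{0<..1}. \<forall>z. \<bar>\<phi> y z\<bar> \<le> B" unfolding bcont_def by (elim conjE exE)
  then show ?thesis by (intro exI[of _ B] allI) (elim ballE allE, assumption, use Y_in in blast)
qed

lemma bcont_joint:
  assumes "bcont \<phi>" "0 \<le> s" "s \<le> t"
  shows "(\<lambda>(u, \<omega>). indicator {s..t} u * \<phi> (Y u \<omega>) (z u \<omega>)) \<in> borel_measurable (lborel \<Otimes>\<^sub>M M)"
proof (rule joint_measurable[OF assms(3)])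
  fix u assume "u \<in> {s..t}"
  then show "(\<lambda>\<omega>. \<phi> (Y u \<omega>) (z u \<omega>)) \<in> borel_measurable M"
    using assms by (intro bcont_meas[OF assms(1)]) auto
next
  fix \<omega> assume "\<omega> \<in> space M"
  from continuous_on_subset[OF bcont_cont[OF assms(1) this], of "{s..t}"] assms(2)
  show "continuous_on {s..t} (\<lambda>u. \<phi> (Y u \<omega>) (z u \<omega>))" by auto
qed

text \<open>Half the generator maps phi to psi, in integrated form: the increments of
  phi - int psi are orthogonal to the past.\<close>
definition dynkin_pair :: "(real \<Rightarrow> real \<Rightarrow> real) \<Rightarrow> (real \<Rightarrow> real \<Rightarrow> real) \<Rightarrow> bool" where
  "dynkin_pair \<phi> \<psi> \<longleftrightarrow> (\<forall>s t H K. 0 \<le> s \<longrightarrow> s \<le> t \<longrightarrow> H \<in> borel_measurable (F s) \<longrightarrow> (\<forall>\<omega>\<in>space M. \<bar>H \<omega>\<bar> \<le> K) \<longrightarrow>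
     (\<integral>\<omega>. H \<omega> * \<phi> (Y t \<omega>) (z t \<omega>) \<partial>M) - (\<integral>\<omega>. H \<omega> * \<phi> (Y s \<omega>) (z s \<omega>) \<partial>M)
     = (LBINT u:{s..t}. (\<integral>\<omega>. H \<omega> * \<psi> (Y u \<omega>) (z u \<omega>) \<partial>M)))"

text \<open>The martingale property on events of the past says that the increment D has conditional
  expectation 0 given \<open>F s\<close>. Hence D is orthogonal to every bounded H measurable there,
  and Fubini pulls H inside the time integral.\<close>

lemma dynkin_test_fun:
  assumes tf: "test_fun f" and bcont: "bcont \<phi>" "bcont \<psi>"
    and c: "\<And>\<rho> \<theta> z. \<rho> \<ge> 0 \<Longrightarrow> cyl f \<rho> \<theta> z = \<phi> (sech2 \<rho>) z"
    and L: "\<And>\<rho> \<theta> z. \<rho> \<ge> 0 \<Longrightarrow> (1/2) * subLap f \<rho> \<theta> z = \<psi> (sech2 \<rho>) z"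
  shows "dynkin_pair \<phi> \<psi>"
  unfolding dynkin_pair_def
proof (intro allI impI)
  fix s t H K
  assume st: "0 \<le> s" "s \<le> t" and H: "H \<in> borel_measurable (F s)" and K: "\<forall>\<omega>\<in>space M. \<bar>H \<omega>\<bar> \<le> (K :: real)"
  let ?p = "\<lambda>u \<omega>. \<phi> (Y u \<omega>) (z u \<omega>)" and ?q = "\<lambda>u \<omega>. \<psi> (Y u \<omega>) (z u \<omega>)"
  have sub: "subalgebra M (F s)" using st by (intro subalgebra_F)
  have [measurable]: "H \<in> borel_measurable M" using measurable_from_subalg[OF sub H] .
  interpret S: finite_measure_subalgebra M "F s" by unfold_locales (rule sub)
  define D where "D \<omega> = mp_process f r \<theta> z t \<omega> - mp_process f r \<theta> z s \<omega>" for \<omega>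
  have it: "integrable M (mp_process f r \<theta> z t)" and iis: "integrable M (mp_process f r \<theta> z s)"
    using martingale_problem(1)[OF tf, of t t] martingale_problem(1)[OF tf, of s s] st by auto
  then have D: "integrable M D" unfolding D_def[abs_def] by simp
  have ce0: "AE \<omega> in M. real_cond_exp M (F s) D \<omega> = 0"
  proof (rule S.real_cond_exp_charact)
    fix A assume A: "A \<in> sets (F s)"
    then have AM: "A \<in> sets M" using sub by (auto simp: subalgebra_def)
    have "(\<integral>\<omega>\<in>A. D \<omega> \<partial>M) = (\<integral>\<omega>. mp_process f r \<theta> z t \<omega> * indicator A \<omega> \<partial>M)
             - (\<integral>\<omega>. mp_process f r \<theta> z s \<omega> * indicator A \<omega> \<partial>M)"
      using integrable_mult_indicator[OF AM it] integrable_mult_indicator[OF AM iis]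
      unfolding set_lebesgue_integral_def D_def by (simp add: algebra_simps)
    then show "(\<integral>\<omega>\<in>A. D \<omega> \<partial>M) = (\<integral>\<omega>\<in>A. 0 \<partial>M)"
      using martingale_problem(2)[OF tf st A] by (simp add: set_lebesgue_integral_def)
  qed (use D in auto)
  moreover have HD: "integrable M (\<lambda>\<omega>. H \<omega> * D \<omega>)"
  proof (rule Bochner_Integration.integrable_bound)
    show "integrable M (\<lambda>\<omega>. K * \<bar>D \<omega>\<bar>)" using D by simp
    show "(\<lambda>\<omega>. H \<omega> * D \<omega>) \<in> borel_measurable M" using D by measurable
    show "AE \<omega> in M. norm (H \<omega> * D \<omega>) \<le> norm (K * \<bar>D \<omega>\<bar>)"
    proof (rule AE_I2)
      fix \<omega> assume "\<omega> \<in> space M"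
      then have "\<bar>H \<omega>\<bar> * \<bar>D \<omega>\<bar> \<le> \<bar>K\<bar> * \<bar>D \<omega>\<bar>" using K by (intro mult_right_mono) force+
      then show "norm (H \<omega> * D \<omega>) \<le> norm (K * \<bar>D \<omega>\<bar>)" by (simp add: abs_mult)
    qed
  qed
  moreover have "(\<integral>\<omega>. H \<omega> * real_cond_exp M (F s) D \<omega> \<partial>M) = (\<integral>\<omega>. H \<omega> * D \<omega> \<partial>M)"
    by (rule S.real_cond_exp_intg(2)[OF HD H borel_measurable_integrable[OF D]])
  moreover have "(\<integral>\<omega>. H \<omega> * real_cond_exp M (F s) D \<omega> \<partial>M) = 0"
    by (rule integral_eq_zero_AE) (use ce0 in \<open>eventually_elim, simp\<close>)
  ultimately have HD0: "(\<integral>\<omega>. H \<omega> * D \<omega> \<partial>M) = 0" by simp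
  obtain B where B0: "\<forall>u \<omega>. \<bar>?q u \<omega>\<bar> \<le> B" using bcont_bound[OF bcont(2)] by (rule exE)
  obtain B' where B0': "\<forall>u \<omega>. \<bar>?p u \<omega>\<bar> \<le> B'" using bcont_bound[OF bcont(1)] by (rule exE)
  have B: "\<bar>?q u \<omega>\<bar> \<le> B" and B': "\<bar>?p u \<omega>\<bar> \<le> B'" for u \<omega> by (rule B0[rule_format] B0'[rule_format])+
  have HM: "H \<in> borel_measurable M" by simp
  have jm: "(\<lambda>(u, \<omega>). indicator {s..t} u * (H \<omega> * ?q u \<omega>)) \<in> borel_measurable (lborel \<Otimes>\<^sub>M M)"
    using borel_measurable_times[OF measurable_compose[OF measurable_snd HM] bcont_joint[OF bcont(2) st]]
    by (simp add: split_beta' mult.left_commute)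
  have jb: "\<bar>H \<omega> * ?q u \<omega>\<bar> \<le> \<bar>K\<bar> * \<bar>B\<bar>" if "\<omega> \<in> space M" for u \<omega>
    unfolding abs_mult using order_trans[OF K[rule_format, OF that] abs_ge_self] order_trans[OF B abs_ge_self]
    by (rule mult_mono) simp_all
  have pb: "\<bar>H \<omega> * ?p u \<omega>\<bar> \<le> \<bar>K\<bar> * \<bar>B'\<bar>" if "\<omega> \<in> space M" for u \<omega>
    unfolding abs_mult using order_trans[OF K[rule_format, OF that] abs_ge_self] order_trans[OF B' abs_ge_self]
    by (rule mult_mono) simp_all
  \<comment> \<open>The martingale problem integrates in the Henstock-Kurzweil sense; for these
    bounded continuous paths this agrees with the Lebesgue integral over {s..t}.\<close>
  have D_eq: "D \<omega> = ?p t \<omega> - ?p s \<omega> - (LBINT u:{s..t}. ?q u \<omega>)" if w: "\<omega> \<in> space M" for \<omega>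
  proof -
    have mpeq: "mp_process f r \<theta> z v \<omega> = ?p v \<omega> - integral {0..v} (\<lambda>u. ?q u \<omega>)" if "v \<ge> 0" for v
    proof -
      have "integral {0..v} (\<lambda>u. (1/2) * subLap f (r u \<omega>) (\<theta> u \<omega>) (z u \<omega>)) = integral {0..v} (\<lambda>u. ?q u \<omega>)"
        unfolding Y_def by (rule Henstock_Kurzweil_Integration.integral_cong, rule L, rule r_nonneg[OF _ w]) simp
      then show ?thesis unfolding mp_process_def Y_def c[OF r_nonneg[OF that w]] by simp
    qed
    have "continuous_on {0..t} (\<lambda>u. ?q u \<omega>)" by (rule continuous_on_subset[OF bcont_cont[OF bcont(2) w]]) auto
    then have "(\<lambda>u. ?q u \<omega>) integrable_on {0..t}" by (rule integrable_continuous_real)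
    then have "integral {0..s} (\<lambda>u. ?q u \<omega>) + integral {s..t} (\<lambda>u. ?q u \<omega>) = integral {0..t} (\<lambda>u. ?q u \<omega>)"
      using st by (intro Henstock_Kurzweil_Integration.integral_combine)
    moreover have "(LBINT u:{s..t}. ?q u \<omega>) = integral {s..t} (\<lambda>u. ?q u \<omega>)"
      using fubini_bounded(4)[OF bcont_joint[OF bcont(2) st] B w] by (rule set_borel_integral_eq_integral)
    ultimately show ?thesis unfolding D_def using mpeq[of s] mpeq[of t] st by simp
  qed
  have ip: "integrable M (\<lambda>\<omega>. H \<omega> * ?p u \<omega>)" if "u \<ge> 0" for u
  proof (rule integrable_const_bound)
    show "AE \<omega> in M. norm (H \<omega> * ?p u \<omega>) \<le> \<bar>K\<bar> * \<bar>B'\<bar>" using pb by (intro AE_I2) simp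
    show "(\<lambda>\<omega>. H \<omega> * ?p u \<omega>) \<in> borel_measurable M"
      by (intro borel_measurable_times bcont_meas[OF bcont(1) that]) simp
  qed
  have pull: "(LBINT u:{s..t}. H \<omega> * ?q u \<omega>) = H \<omega> * (LBINT u:{s..t}. ?q u \<omega>)" for \<omega>
    by simp
  have fb1: "integrable M (\<lambda>\<omega>. LBINT u:{s..t}. H \<omega> * ?q u \<omega>)"
    by (rule fubini_bounded(1)[OF jm jb])
  have fb2: "(\<integral>\<omega>. (LBINT u:{s..t}. H \<omega> * ?q u \<omega>) \<partial>M) = (LBINT u:{s..t}. (\<integral>\<omega>. H \<omega> * ?q u \<omega> \<partial>M))"
    by (rule fubini_bounded(2)[OF jm jb])
  have "0 = (\<integral>\<omega>. H \<omega> * ?p t \<omega> - H \<omega> * ?p s \<omega> - (LBINT u:{s..t}. H \<omega> * ?q u \<omega>) \<partial>M)"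
    unfolding HD0[symmetric] pull by (rule Bochner_Integration.integral_cong) (simp_all add: D_eq algebra_simps)
  also have "\<dots> = (\<integral>\<omega>. H \<omega> * ?p t \<omega> \<partial>M) - (\<integral>\<omega>. H \<omega> * ?p s \<omega> \<partial>M) - (LBINT u:{s..t}. (\<integral>\<omega>. H \<omega> * ?q u \<omega> \<partial>M))"
    using fb1 fb2 ip[of t] ip[of s] st by (simp del: set_integral_mult_right)
  finally show "(\<integral>\<omega>. H \<omega> * ?p t \<omega> \<partial>M) - (\<integral>\<omega>. H \<omega> * ?p s \<omega> \<partial>M) = (LBINT u:{s..t}. (\<integral>\<omega>. H \<omega> * ?q u \<omega> \<partial>M))"
    by simp
qed

end

section \<open>Admissible functions and their cutoffs\<close>

lemma (in prob_space) abs_expectation_le: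
  fixes f :: "'a \<Rightarrow> real"
  assumes "integrable M f" "\<And>\<omega>. \<omega> \<in> space M \<Longrightarrow> \<bar>f \<omega>\<bar> \<le> B"
  shows "\<bar>\<integral>\<omega>. f \<omega> \<partial>M\<bar> \<le> B"
proof -
  have "\<bar>\<integral>\<omega>. f \<omega> \<partial>M\<bar> \<le> (\<integral>\<omega>. \<bar>f \<omega>\<bar> \<partial>M)" by (rule integral_abs_bound)
  also have "\<dots> \<le> (\<integral>\<omega>. B \<partial>M)" using assms by (intro integral_mono) auto
  finally show ?thesis by (simp add: prob_space)
qed

text \<open>Derivatives are bounded only in the combination \<open>radial_gen\<close>: for y^k with
  0 < k < 1 both G1 and G2 are unbounded near y = 0.\<close>

definition radial_adm :: "(real \<Rightarrow> real) \<Rightarrow> (real \<Rightarrow> real) \<Rightarrow> (real \<Rightarrow> real) \<Rightarrow> real \<Rightarrow> bool" where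
  "radial_adm G G1 G2 B \<longleftrightarrow> (\<forall>n. Cn_on {0<..1} n G) \<and> continuous_on {0<..1} G2 \<and>
    (\<forall>y\<in>{0<..1}. (G has_real_derivative G1 y) (at y within {0<..1}) \<and>
       (G1 has_real_derivative G2 y) (at y within {0<..1}) \<and> \<bar>G y\<bar> \<le> B \<and> \<bar>radial_gen G1 G2 y\<bar> \<le> B)"

definition vertical_adm :: "(real \<Rightarrow> real) \<Rightarrow> (real \<Rightarrow> real) \<Rightarrow> (real \<Rightarrow> real) \<Rightarrow> real \<Rightarrow> bool" where
  "vertical_adm h h1 h2 C \<longleftrightarrow> (\<forall>n. Cn_on UNIV n h) \<and> continuous_on UNIV h2 \<and>
    (\<forall>z. (h has_real_derivative h1 z) (at z) \<and> (h1 has_real_derivative h2 z) (at z) \<and>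
       \<bar>h z\<bar> \<le> C \<and> \<bar>h2 z\<bar> \<le> C)"

text \<open>Half the sub-Laplacian of G(y) h(z), where 1 - y is the coefficient tanh^2(r/2) of
  d_z^2.\<close>

definition drift where
  "drift G G1 G2 h h2 y z = (1/2) * (radial_gen G1 G2 y * h z + (1 - y) * G y * h2 z)"

lemma drift_bounds:
  assumes G: "radial_adm G G1 G2 B" and h: "vertical_adm h h1 h2 C"
  shows "bcont (\<lambda>y z. G y * h z)" "bcont (drift G G1 G2 h h2)"
    "y \<in> {0<..1} \<Longrightarrow> \<bar>G y * h z\<bar> \<le> B * C" "y \<in> {0<..1} \<Longrightarrow> \<bar>drift G G1 G2 h h2 y z\<bar> \<le> B * C"
proof -
  have bG: "\<bar>G y\<bar> \<le> B" "\<bar>radial_gen G1 G2 y\<bar> \<le> B" if "y \<in> {0<..1}" for y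
    using G that unfolding radial_adm_def by blast+
  have bh: "\<bar>h z\<bar> \<le> C" "\<bar>h2 z\<bar> \<le> C" for z
    using h unfolding vertical_adm_def by blast+
  have cG: "continuous_on {0<..1} G" "continuous_on {0<..1} G1" "continuous_on {0<..1} G2"
    using G unfolding radial_adm_def by (auto intro!: DERIV_continuous_on)
  have ch: "continuous_on UNIV h" "continuous_on UNIV h2"
    using h unfolding vertical_adm_def by (auto intro!: DERIV_continuous_on)
  have bG': "\<bar>(1 - y) * G y\<bar> \<le> B" if "y \<in> {0<..1}" for y
  proof -
    have "\<bar>1 - y\<bar> * \<bar>G y\<bar> \<le> 1 * B" using bG[OF that] that by (intro mult_mono) auto
    then show ?thesis by (simp add: abs_mult)
  qed
  show "bcont (\<lambda>y z. G y * h z)" by (rule bcont_prodI[OF cG(1) ch(1) bG(1) bh(1)])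
  show "bcont (drift G G1 G2 h h2)"
  proof -
    have eq: "drift G G1 G2 h h2 = (\<lambda>y z. ((1/2) * radial_gen G1 G2 y) * h z + ((1/2) * ((1 - y) * G y)) * h2 z)"
      by (simp add: drift_def fun_eq_iff algebra_simps)
    have "bcont (\<lambda>y z. ((1/2) * radial_gen G1 G2 y) * h z)"
    proof (rule bcont_prodI[OF _ ch(1) _ bh(1)])
      show "continuous_on {0<..1} (\<lambda>y. (1/2) * radial_gen G1 G2 y)"
        unfolding radial_gen_def by (intro continuous_intros cG)
      fix y :: real assume "y \<in> {0<..1}"
      then show "\<bar>(1/2) * radial_gen G1 G2 y\<bar> \<le> B" using bG(2)[of y] by simp
    qed
    moreover have "bcont (\<lambda>y z. ((1/2) * ((1 - y) * G y)) * h2 z)"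
    proof (rule bcont_prodI[OF _ ch(2) _ bh(2)])
      show "continuous_on {0<..1} (\<lambda>y. (1/2) * ((1 - y) * G y))" by (intro continuous_intros cG)
      fix y :: real assume "y \<in> {0<..1}"
      then show "\<bar>(1/2) * ((1 - y) * G y)\<bar> \<le> B" using bG'[of y] by simp
    qed
    ultimately show ?thesis unfolding eq by (rule bcont_add)
  qed
  assume y: "y \<in> {0<..1}"
  have B0: "0 \<le> B" using bG(1)[OF y] by linarith
  show "\<bar>G y * h z\<bar> \<le> B * C" unfolding abs_mult using bG(1)[OF y] bh(1)[of z] B0 by (intro mult_mono) auto
  have "\<bar>radial_gen G1 G2 y * h z\<bar> \<le> B * C" unfolding abs_mult using bG(2)[OF y] bh(1)[of z] B0 by (intro mult_mono) auto
  moreover have "\<bar>(1 - y) * G y * h2 z\<bar> \<le> B * C"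
    unfolding abs_mult[of "(1 - y) * G y"] using bG'[OF y] bh(2)[of z] B0 by (intro mult_mono) auto
  ultimately show "\<bar>drift G G1 G2 h h2 y z\<bar> \<le> B * C" unfolding drift_def by simp
qed

text \<open>One factor of the argument cancels one power of 1/v. This is how the factors n y in
  front of derivatives of the cutoff are absorbed.\<close>

lemma mult_bump: "v * bump (Suc k) v = bump k v"
  by (simp add: bump_def)

text \<open>The argument tends to infinity, where exp(-1/v) tends to 1 and every positive power of
  1/v to 0.\<close>

lemma bump_limits:
  assumes "y > 0"
  shows "(\<lambda>n. bump 0 (real (Suc n) * y - 1)) \<longlonglongrightarrow> 1"
    and "k \<ge> 1 \<Longrightarrow> (\<lambda>n. bump k (real (Suc n) * y - 1)) \<longlonglongrightarrow> 0"
proof -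
  have lim: "filterlim (\<lambda>n. real (Suc n) * y - 1) at_top sequentially"
    using assms by real_asymp
  have inv: "((\<lambda>v::real. 1 / v) \<longlongrightarrow> 0) at_top" by real_asymp
  have "((\<lambda>v::real. (1 / v) ^ k * exp (- (1 / v))) \<longlongrightarrow> 0 ^ k * exp (- 0)) at_top" for k
    by (rule tendsto_mult[OF tendsto_power[OF inv] tendsto_exp[OF tendsto_minus[OF inv]]])
  then have lim0: "((\<lambda>v::real. (1 / v) ^ k * exp (- (1 / v))) \<longlongrightarrow> 0 ^ k) at_top" for k by simp
  have *: "(bump k \<longlongrightarrow> 0 ^ k) at_top" for k
    by (rule Lim_transform_eventually[OF lim0], rule eventually_mono[OF eventually_gt_at_top[of 0]])
      (simp add: bump_def)
  show "(\<lambda>n. bump 0 (real (Suc n) * y - 1)) \<longlonglongrightarrow> 1"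
    using filterlim_compose[OF *[of 0] lim] by simp
  show "k \<ge> 1 \<Longrightarrow> (\<lambda>n. bump k (real (Suc n) * y - 1)) \<longlonglongrightarrow> 0"
    using filterlim_compose[OF *[of k] lim] by (simp add: power_0_left)
qed

text \<open>Every cutoff is a function of n y, so y^2 d^2/dy^2 and y d/dy of it stay bounded
  uniformly in n. This lets compactly supported test functions approximate bounded ones.\<close>
lemma radial_cutoff:
  assumes G: "radial_adm G G1 G2 B" and yG: "\<And>y. y \<in> {0<..1} \<Longrightarrow> \<bar>y * G1 y\<bar> \<le> B"
  shows "\<exists>Gn Gn1 Gn2. (\<forall>n. radial_adm (Gn n) (Gn1 n) (Gn2 n) (100 * B) \<and> (\<exists>\<eta>>0. \<forall>y\<le>\<eta>. Gn n y = 0)) \<and>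
    (\<forall>y\<in>{0<..1}. (\<lambda>n. Gn n y) \<longlonglongrightarrow> G y \<and> (\<lambda>n. radial_gen (Gn1 n) (Gn2 n) y) \<longlonglongrightarrow> radial_gen G1 G2 y)"
proof -
  define N :: "nat \<Rightarrow> real" where "N n = real (Suc n)" for n
  have N: "N n > 0" for n by (simp add: N_def)
  define v where "v n y = N n * y - 1" for n y
  define Gn where "Gn n y = G y * bump 0 (v n y)" for n y
  define Gn1 where "Gn1 n y = G1 y * bump 0 (v n y) + N n * bump 2 (v n y) * G y" for n y
  define Gn2 where "Gn2 n y = (G2 y * bump 0 (v n y) + N n * bump 2 (v n y) * G1 y) +
     (N n * (N n * (bump 4 (v n y) - 2 * bump 3 (v n y))) * G y + G1 y * (N n * bump 2 (v n y)))" for n y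
  have dG: "(G has_real_derivative G1 y) (at y within {0<..1})"
    "(G1 has_real_derivative G2 y) (at y within {0<..1})"
    and bG: "\<bar>G y\<bar> \<le> B" "\<bar>radial_gen G1 G2 y\<bar> \<le> B" if "y \<in> {0<..1}" for y
    using G that unfolding radial_adm_def by blast+
  have db: "((\<lambda>y. bump k (v n y)) has_real_derivative N n * (bump (k + 2) (v n y) - real k * bump (k + 1) (v n y)))
      (at y within S)" for k n y S
  proof -
    have "(v n has_real_derivative N n) (at y within S)"
      unfolding v_def[abs_def] by (auto intro!: derivative_eq_intros)
    from DERIV_chain2[OF bump_has_derivative this] show ?thesis by (simp add: mult.commute)
  qed
  have d0: "((\<lambda>y. bump 0 (v n y)) has_real_derivative N n * bump 2 (v n y)) (at y within S)" for n y S
    using db[of 0] by (simp add: numeral_2_eq_2)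
  have d2: "((\<lambda>y. N n * bump 2 (v n y)) has_real_derivative N n * (N n * (bump 4 (v n y) - 2 * bump 3 (v n y)))) (at y within S)" for n y S
    using DERIV_cmult[OF db[of 2 n y S], of "N n"] by simp
  \<comment> \<open>\<open>c1\<close> and \<open>c2\<close> are y d/dy and y^2 d^2/dy^2 of the
    cutoff \<open>bump 0 (v n y)\<close>, reduced by \<open>mult_bump\<close>. Outside the argument
    \<open>v n y\<close> no factor n is left, which is the source of the uniform bounds.\<close>
  define c1 where "c1 n y = bump 1 (v n y) + bump 2 (v n y)" for n y
  define c2 where "c2 n y = bump 4 (v n y) - 3 * bump 2 (v n y) - 2 * bump 1 (v n y)" for n y
  have vb: "w * bump 2 w = bump 1 w" "w * bump 3 w = bump 2 w" "w * bump 4 w = bump 3 w" for w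
    using mult_bump[of w 1] mult_bump[of w 2] mult_bump[of w 3] by (simp_all add: eval_nat_numeral)
  have Ny: "N n * y = v n y + 1" for n y by (simp add: v_def)
  have e1: "N n * y * bump 2 (v n y) = c1 n y" for n y
    unfolding Ny c1_def using vb(1)[of "v n y"] by (simp add: algebra_simps)
  have e2: "(N n * y) * ((N n * y) * (bump 4 (v n y) - 2 * bump 3 (v n y))) = c2 n y" for n y
  proof -
    have "(w + 1) * ((w + 1) * (bump 4 w - 2 * bump 3 w)) = bump 4 w - 3 * bump 2 w - 2 * bump 1 w" for w
    proof -
      have "(w + 1) * ((w + 1) * (bump 4 w - 2 * bump 3 w)) =
         w * (w * bump 4 w) + 2 * (w * bump 4 w) + bump 4 w - 2 * (w * (w * bump 3 w)) - 4 * (w * bump 3 w) - 2 * bump 3 w"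
        by (simp add: algebra_simps)
      then show ?thesis unfolding vb by simp
    qed
    then show ?thesis unfolding Ny c2_def .
  qed
  have gen_n: "radial_gen (Gn1 n) (Gn2 n) y = bump 0 (v n y) * radial_gen G1 G2 y +
      (1 - y) * (2 * (y * G1 y) * c1 n y + G y * c2 n y) - y * G y * c1 n y" for n y
    unfolding radial_gen_def Gn1_def Gn2_def e1[symmetric] e2[symmetric] by algebra
  have bb: "\<bar>bump k w\<bar> \<le> fact k" for k w using bump_bounds[of k w] by simp
  \<comment> \<open>Since \<open>bump k\<close> is at most k!, the bounds are 3 = 1! + 2! here and
    32 = 4! + 3 * 2! + 2 * 1! for \<open>c2\<close>.\<close>
  have c1b: "\<bar>c1 n y\<bar> \<le> 3" for n y
    using bb[of 1 "v n y"] bb[of 2 "v n y"] unfolding c1_def by simp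
  have c2b: "\<bar>c2 n y\<bar> \<le> 32" for n y
    using bb[of 1 "v n y"] bb[of 2 "v n y"] bb[of 4 "v n y"] unfolding c2_def
    by (simp add: fact_numeral)
  have b0: "\<bar>bump 0 w\<bar> \<le> 1" for w using bb[of 0 w] by simp
  have "radial_adm (Gn n) (Gn1 n) (Gn2 n) (100 * B)" for n
    unfolding radial_adm_def
  proof (intro conjI allI ballI)
    fix m
    have "Cn_on {0<..1} m (\<lambda>y. bump 0 (v n y))" unfolding v_def
      by (rule Cn_on_compose[OF Cn_on_bump]) (auto intro!: Cn_on_diff Cn_on_mult Cn_on_const Cn_on_id)
    moreover have "Cn_on {0<..1} m G" using G unfolding radial_adm_def by blast
    ultimately show "Cn_on {0<..1} m (Gn n)" unfolding Gn_def[abs_def] by (intro Cn_on_mult)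
  next
    have "continuous_on {0<..1} (\<lambda>y. bump k (v n y))" for k using db by (rule DERIV_continuous_on)
    moreover have "continuous_on {0<..1} G" "continuous_on {0<..1} G1" "continuous_on {0<..1} G2"
      using G unfolding radial_adm_def by (auto intro!: DERIV_continuous_on)
    ultimately show "continuous_on {0<..1} (Gn2 n)" unfolding Gn2_def[abs_def] by (intro continuous_intros)
  next
    fix y :: real assume y: "y \<in> {0<..1}"
    show "(Gn n has_real_derivative Gn1 n y) (at y within {0<..1})"
      unfolding Gn_def[abs_def] Gn1_def by (rule DERIV_mult[OF dG(1)[OF y] d0])
    show "(Gn1 n has_real_derivative Gn2 n y) (at y within {0<..1})"
      unfolding Gn1_def[abs_def] Gn2_def by (rule DERIV_add[OF DERIV_mult[OF dG(2)[OF y] d0] DERIV_mult[OF d2 dG(1)[OF y]]])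
    have B0: "0 \<le> B" using bG(1)[OF y] by linarith
    have "\<bar>G y\<bar> * \<bar>bump 0 (v n y)\<bar> \<le> B * 1" using bG(1)[OF y] b0 B0 by (intro mult_mono) auto
    then show "\<bar>Gn n y\<bar> \<le> 100 * B" using B0 by (simp add: Gn_def abs_mult)
    have m1: "\<bar>bump 0 (v n y) * radial_gen G1 G2 y\<bar> \<le> 1 * B"
      unfolding abs_mult using bG(2)[OF y] b0 by (intro mult_mono) auto
    have m2: "\<bar>(y * G1 y) * c1 n y\<bar> \<le> B * 3"
      unfolding abs_mult[of "y * G1 y"] using yG[OF y] c1b B0 by (intro mult_mono) auto
    have m3: "\<bar>G y * c2 n y\<bar> \<le> B * 32"
      unfolding abs_mult using bG(1)[OF y] c2b B0 by (intro mult_mono) auto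
    have m4: "\<bar>G y * c1 n y\<bar> \<le> B * 3"
      unfolding abs_mult using bG(1)[OF y] c1b B0 by (intro mult_mono) auto
    have m5: "\<bar>y * (G y * c1 n y)\<bar> \<le> 1 * (B * 3)"
      unfolding abs_mult[of y] using m4 y by (intro mult_mono) auto
    \<comment> \<open>38 = 2 * 3 + 32. With the two other terms the total is at most (1 + 38 + 3) B,
      below the rounded 100 B.\<close>
    have m6: "\<bar>(1 - y) * (2 * (y * G1 y) * c1 n y + G y * c2 n y)\<bar> \<le> 1 * (B * 38)"
      unfolding abs_mult[of "1 - y"]
    proof (intro mult_mono)
      show "\<bar>2 * (y * G1 y) * c1 n y + G y * c2 n y\<bar> \<le> B * 38" using m2 m3 by linarith
    qed (use y in auto)
    have "radial_gen (Gn1 n) (Gn2 n) y = bump 0 (v n y) * radial_gen G1 G2 y +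
      (1 - y) * (2 * (y * G1 y) * c1 n y + G y * c2 n y) - y * (G y * c1 n y)" unfolding gen_n by (simp add: mult.assoc)
    then show "\<bar>radial_gen (Gn1 n) (Gn2 n) y\<bar> \<le> 100 * B" using m1 m5 m6 B0 by linarith
  qed
  moreover have "\<exists>\<eta>>0. \<forall>y\<le>\<eta>. Gn n y = 0" for n
  proof (intro exI[of _ "1 / N n"] conjI allI impI)
    fix y assume "y \<le> 1 / N n"
    then have "v n y \<le> 0" using N[of n] by (simp add: v_def field_simps)
    then show "Gn n y = 0" by (simp add: Gn_def bump_def)
  qed (use N in simp)
  moreover have "(\<lambda>n. Gn n y) \<longlonglongrightarrow> G y" "(\<lambda>n. radial_gen (Gn1 n) (Gn2 n) y) \<longlonglongrightarrow> radial_gen G1 G2 y"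
    if "y \<in> {0<..1}" for y
  proof -
    have y: "y > 0" using that by simp
    have l0: "(\<lambda>n. bump 0 (v n y)) \<longlonglongrightarrow> 1" and l1: "k \<ge> 1 \<Longrightarrow> (\<lambda>n. bump k (v n y)) \<longlonglongrightarrow> 0" for k
      unfolding v_def N_def using bump_limits[OF y] by simp_all
    have lc1: "(\<lambda>n. c1 n y) \<longlonglongrightarrow> 0" unfolding c1_def by (rule tendsto_eq_intros l1 | simp)+
    have lc2: "(\<lambda>n. c2 n y) \<longlonglongrightarrow> 0" unfolding c2_def by (rule tendsto_eq_intros l1 | simp)+
    show "(\<lambda>n. Gn n y) \<longlonglongrightarrow> G y" unfolding Gn_def using tendsto_mult[OF tendsto_const[of "G y"] l0] by simp
    have "(\<lambda>n. radial_gen (Gn1 n) (Gn2 n) y) \<longlonglongrightarrow> 1 * radial_gen G1 G2 y +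
      (1 - y) * (2 * (y * G1 y) * 0 + G y * 0) - y * G y * 0"
      unfolding gen_n by (intro tendsto_intros l0 lc1 lc2)
    then show "(\<lambda>n. radial_gen (Gn1 n) (Gn2 n) y) \<longlonglongrightarrow> radial_gen G1 G2 y" by simp
  qed
  ultimately show ?thesis by blast
qed

text \<open>The normalisation concerns the value at 0, because the cutoff is p(e z) with e tending
  to 0. The bounds come from continuity on [-1, 1] and vanishing outside.\<close>

lemma plateau:
  "\<exists>p p1 p2 P. (\<forall>n. Cn_on UNIV n p) \<and> continuous_on UNIV p2 \<and>
     (\<forall>z. (p has_real_derivative p1 z) (at z) \<and> (p1 has_real_derivative p2 z) (at z) \<and>
       \<bar>p z\<bar> \<le> P \<and> \<bar>p1 z\<bar> \<le> P \<and> \<bar>p2 z\<bar> \<le> P \<and> (\<bar>z\<bar> > 1 \<longrightarrow> p z = 0)) \<and> p 0 = (1 :: real)"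
proof -
  define p :: "real \<Rightarrow> real" where "p z = exp 1 * bump 0 (1 - z\<^sup>2)" for z
  define p1 :: "real \<Rightarrow> real" where "p1 z = exp 1 * (bump 2 (1 - z\<^sup>2) * (- 2 * z))" for z
  define p2 :: "real \<Rightarrow> real" where
    "p2 z = exp 1 * (((bump 4 (1 - z\<^sup>2) - 2 * bump 3 (1 - z\<^sup>2)) * (- 2 * z)) * (- 2 * z) + - 2 * bump 2 (1 - z\<^sup>2))" for z
  have du: "((\<lambda>z. 1 - z\<^sup>2) has_real_derivative - 2 * z) (at z)" for z :: real
    by (auto intro!: derivative_eq_intros)
  have db: "((\<lambda>z. bump k (1 - z\<^sup>2)) has_real_derivative
      (bump (k + 2) (1 - z\<^sup>2) - real k * bump (k + 1) (1 - z\<^sup>2)) * (- 2 * z)) (at z)" for k z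
    by (rule DERIV_chain2[OF bump_has_derivative du])
  have cb: "continuous_on UNIV (\<lambda>z. bump k (1 - z\<^sup>2))" for k using db by (rule DERIV_continuous_on)
  have ub: "1 - z\<^sup>2 \<le> 0" if "\<bar>z\<bar> > 1" for z :: real
    using that power_strict_mono[of 1 "\<bar>z\<bar>" 2] by simp
  have bounded: "\<exists>P. \<forall>z. \<bar>f z\<bar> \<le> P" if "continuous_on UNIV f" "\<And>z. \<bar>z\<bar> > 1 \<Longrightarrow> f z = 0" for f :: "real \<Rightarrow> real"
  proof -
    have "bounded (f ` {-1..1})"
      by (intro compact_imp_bounded compact_continuous_image continuous_on_subset[OF that(1)]) auto
    then obtain P where P: "\<And>z. z \<in> {-1..1} \<Longrightarrow> \<bar>f z\<bar> \<le> P"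
      unfolding bounded_iff by (metis image_eqI real_norm_def)
    have "\<bar>f z\<bar> \<le> \<bar>P\<bar>" for z
    proof (cases "\<bar>z\<bar> > 1")
      case False
      then have "z \<in> {-1..1}" by auto
      from order_trans[OF P[OF this] abs_ge_self] show ?thesis .
    qed (simp add: that)
    then show ?thesis by blast
  qed
  have "Cn_on UNIV n p" for n
    unfolding p_def[abs_def] power2_eq_square by (intro Cn_on_mult Cn_on_const Cn_on_compose[OF Cn_on_bump] Cn_on_diff Cn_on_id) auto
  moreover have c2: "continuous_on UNIV p2" unfolding p2_def[abs_def] by (intro continuous_intros cb)
  moreover have d1: "(p has_real_derivative p1 z) (at z)" for z
    unfolding p_def[abs_def] p1_def using DERIV_cmult[OF db[of 0 z], of "exp 1"] by (simp add: numeral_2_eq_2)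
  moreover have "((\<lambda>z. - 2 * z) has_real_derivative - 2) (at z)" for z :: real
    by (auto intro!: derivative_eq_intros)
  from DERIV_cmult[OF DERIV_mult[OF db[of 2] this], of "exp 1"]
  have d2: "(p1 has_real_derivative p2 z) (at z)" for z
    unfolding p1_def[abs_def] p2_def by simp
  moreover have p0: "p 0 = 1" by (simp add: p_def bump_def exp_minus)
  moreover have v0: "p z = 0" "p1 z = 0" "p2 z = 0" if "\<bar>z\<bar> > 1" for z
    using ub[OF that] by (auto simp: p_def p1_def p2_def bump_def)
  moreover obtain P where "\<forall>z. \<bar>p z\<bar> \<le> P" using bounded[of p] d1 v0 by (meson DERIV_continuous_on)
  moreover obtain P1 where "\<forall>z. \<bar>p1 z\<bar> \<le> P1" using bounded[of p1] d2 v0 by (meson DERIV_continuous_on)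
  moreover obtain P2 where "\<forall>z. \<bar>p2 z\<bar> \<le> P2" using bounded[of p2] c2 v0 by blast
  ultimately show ?thesis
    by (intro exI[of _ p] exI[of _ p1] exI[of _ p2] exI[of _ "\<bar>P\<bar> + \<bar>P1\<bar> + \<bar>P2\<bar>"])
      (auto intro: order_trans)
qed

text \<open>Every derivative that falls on the cutoff brings a factor \<open>e n\<close>, so h2 is
  what survives of the second derivative in the limit. The mixed terms contain h1, hence the
  assumption on it; the factor 4 in the bound counts the four terms of the product rule.\<close>

lemma vertical_cutoff:
  assumes h: "vertical_adm h h1 h2 C" and h1C: "\<And>z. \<bar>h1 z\<bar> \<le> C"
  shows "\<exists>hn hn1 hn2 D. (\<forall>n. vertical_adm (hn n) (hn1 n) (hn2 n) D \<and> (\<exists>R. \<forall>z. \<bar>z\<bar> > R \<longrightarrow> hn n z = 0)) \<and>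
    (\<forall>z. (\<lambda>n. hn n z) \<longlonglongrightarrow> h z \<and> (\<lambda>n. hn2 n z) \<longlonglongrightarrow> h2 z)"
proof -
  obtain p p1 p2 P where p: "\<And>n. Cn_on UNIV n p" "continuous_on UNIV p2"
     and dp: "\<And>z. (p has_real_derivative p1 z) (at z)" "\<And>z. (p1 has_real_derivative p2 z) (at z)"
     and bp: "\<And>z. \<bar>p z\<bar> \<le> P" "\<And>z. \<bar>p1 z\<bar> \<le> P" "\<And>z. \<bar>p2 z\<bar> \<le> P"
     and p0: "\<And>z. \<bar>z\<bar> > 1 \<Longrightarrow> p z = 0" "p 0 = (1 :: real)"
    using plateau by metis
  have dh: "(h has_real_derivative h1 z) (at z)" "(h1 has_real_derivative h2 z) (at z)"
    and bh: "\<bar>h z\<bar> \<le> C" "\<bar>h2 z\<bar> \<le> C" for z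
    using h unfolding vertical_adm_def by blast+
  have P0: "0 \<le> P" and C0: "0 \<le> C" using bp(1)[of 0] bh(1)[of 0] by linarith+
  define e where "e n = inverse (real (Suc n))" for n
  have e: "e n > 0" "e n \<le> 1" for n by (simp_all add: e_def inverse_le_1_iff)
  have e0: "e \<longlonglongrightarrow> 0" unfolding e_def by (rule LIMSEQ_inverse_real_of_nat)
  define hn where "hn n z = h z * p (e n * z)" for n z
  define hn1 where "hn1 n z = h1 z * p (e n * z) + e n * p1 (e n * z) * h z" for n z
  define hn2 where "hn2 n z = (h2 z * p (e n * z) + e n * p1 (e n * z) * h1 z) +
    (e n * (e n * p2 (e n * z)) * h z + h1 z * (e n * p1 (e n * z)))" for n z
  have de: "((\<lambda>z. e n * z) has_real_derivative e n) (at z)" for n z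
    by (auto intro!: derivative_eq_intros)
  have d0: "((\<lambda>z. p (e n * z)) has_real_derivative e n * p1 (e n * z)) (at z)" for n z
    using DERIV_chain2[OF dp(1) de] by (simp add: mult.commute)
  have d1: "((\<lambda>z. e n * p1 (e n * z)) has_real_derivative e n * (e n * p2 (e n * z))) (at z)" for n z
    using DERIV_cmult[OF DERIV_chain2[OF dp(2) de], of "e n"] by (simp add: mult.commute mult.left_commute)
  have cp: "continuous_on UNIV p" "continuous_on UNIV p1" using dp by (auto intro: DERIV_continuous_on)
  have b1: "\<bar>a * b\<bar> \<le> C * P" if "\<bar>a\<bar> \<le> C" "\<bar>b\<bar> \<le> P" for a b
    unfolding abs_mult using that C0 by (intro mult_mono) auto
  have be: "\<bar>e n * x\<bar> \<le> P" if "\<bar>x\<bar> \<le> P" for n x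
  proof -
    have "\<bar>e n\<bar> * \<bar>x\<bar> \<le> 1 * P" using that e[of n] by (intro mult_mono) auto
    then show ?thesis by (simp add: abs_mult)
  qed
  have "vertical_adm (hn n) (hn1 n) (hn2 n) (4 * (C * P))" for n
    unfolding vertical_adm_def
  proof (intro conjI allI)
    fix m
    have "Cn_on UNIV m h" using h unfolding vertical_adm_def by blast
    then show "Cn_on UNIV m (hn n)" unfolding hn_def[abs_def]
      by (intro Cn_on_mult Cn_on_compose[OF p(1)] Cn_on_const Cn_on_id) auto
  next
    have ch: "continuous_on UNIV h" "continuous_on UNIV h1" "continuous_on UNIV h2"
      using h unfolding vertical_adm_def by (auto intro!: DERIV_continuous_on)
    have "continuous_on UNIV (\<lambda>z. f (e n * z))" if "continuous_on UNIV f" for f :: "real \<Rightarrow> real"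
      by (rule continuous_on_compose2[OF that]) (auto intro!: continuous_intros)
    note this[OF cp(1)] this[OF cp(2)] this[OF p(2)]
    then show "continuous_on UNIV (hn2 n)" unfolding hn2_def[abs_def]
      by (intro continuous_on_add continuous_on_mult ch continuous_on_const)
  next
    fix z
    show "(hn n has_real_derivative hn1 n z) (at z)"
      unfolding hn_def[abs_def] hn1_def by (rule DERIV_mult[OF dh(1) d0])
    show "(hn1 n has_real_derivative hn2 n z) (at z)"
      unfolding hn1_def[abs_def] hn2_def by (rule DERIV_add[OF DERIV_mult[OF dh(2) d0] DERIV_mult[OF d1 dh(1)]])
    have CP: "0 \<le> C * P" using C0 P0 by simp
    show "\<bar>hn n z\<bar> \<le> 4 * (C * P)" unfolding hn_def using b1[OF bh(1)[of z] bp(1)[of "e n * z"]] CP by linarith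
    have "\<bar>h2 z * p (e n * z)\<bar> \<le> C * P" "\<bar>h1 z * (e n * p1 (e n * z))\<bar> \<le> C * P"
      "\<bar>h z * (e n * (e n * p2 (e n * z)))\<bar> \<le> C * P"
      by (intro b1 bh bp h1C be)+
    moreover have "hn2 n z = h2 z * p (e n * z) + h1 z * (e n * p1 (e n * z)) +
      (h z * (e n * (e n * p2 (e n * z))) + h1 z * (e n * p1 (e n * z)))"
      unfolding hn2_def by (simp add: mult.commute[of "h z"] mult.commute[of "h1 z"])
    ultimately show "\<bar>hn2 n z\<bar> \<le> 4 * (C * P)" by linarith
  qed
  moreover have "\<exists>R. \<forall>z. \<bar>z\<bar> > R \<longrightarrow> hn n z = 0" for n
  proof (intro exI[of _ "real (Suc n)"] allI impI)
    fix z :: real assume "\<bar>z\<bar> > real (Suc n)"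
    then have "\<bar>e n * z\<bar> > 1" unfolding abs_mult e_def by (simp add: field_simps del: of_nat_Suc)
    then show "hn n z = 0" by (simp add: hn_def p0)
  qed
  moreover have "(\<lambda>n. hn n z) \<longlonglongrightarrow> h z" "(\<lambda>n. hn2 n z) \<longlonglongrightarrow> h2 z" for z
  proof -
    have ez: "(\<lambda>n. e n * z) \<longlonglongrightarrow> 0" using tendsto_mult[OF e0 tendsto_const[of z]] by simp
    have lim: "(\<lambda>n. f (e n * z)) \<longlonglongrightarrow> f 0" if "continuous_on UNIV f" for f :: "real \<Rightarrow> real"
      by (rule isCont_tendsto_compose[OF _ ez]) (use that in \<open>simp add: continuous_on_eq_continuous_at\<close>)
    show "(\<lambda>n. hn n z) \<longlonglongrightarrow> h z" unfolding hn_def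
      using tendsto_mult[OF tendsto_const[of "h z"] lim[OF cp(1)]] p0 by simp
    have "(\<lambda>n. hn2 n z) \<longlonglongrightarrow> (h2 z * p 0 + 0 * p1 0 * h1 z) + (0 * (0 * p2 0) * h z + h1 z * (0 * p1 0))"
      unfolding hn2_def by (intro tendsto_intros e0 lim cp p(2))
    then show "(\<lambda>n. hn2 n z) \<longlonglongrightarrow> h2 z" using p0 by simp
  qed
  ultimately show ?thesis by blast
qed

section \<open>From compactly supported to bounded functions\<close>

context sl2bm begin

lemma weighted_dynkin:
  assumes bcont: "bcont \<phi>" and B: "\<And>y z. y \<in> {0<..1} \<Longrightarrow> \<bar>\<phi> y z\<bar> \<le> B"
    and H: "H \<in> borel_measurable M" and K: "\<forall>\<omega>\<in>space M. \<bar>H \<omega>\<bar> \<le> (K :: real)"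
  shows "\<omega> \<in> space M \<Longrightarrow> \<bar>H \<omega> * \<phi> (Y u \<omega>) (z u \<omega>)\<bar> \<le> \<bar>K\<bar> * \<bar>B\<bar>"
    "0 \<le> u \<Longrightarrow> (\<lambda>\<omega>. H \<omega> * \<phi> (Y u \<omega>) (z u \<omega>)) \<in> borel_measurable M"
    "0 \<le> u \<Longrightarrow> integrable M (\<lambda>\<omega>. H \<omega> * \<phi> (Y u \<omega>) (z u \<omega>))"
    "0 \<le> s \<Longrightarrow> s \<le> t \<Longrightarrow>
      (\<lambda>(u, \<omega>). indicator {s..t} u * (H \<omega> * \<phi> (Y u \<omega>) (z u \<omega>))) \<in> borel_measurable (lborel \<Otimes>\<^sub>M M)"
    "0 \<le> s \<Longrightarrow> s \<le> t \<Longrightarrow> set_integrable lborel {s..t} (\<lambda>u. \<integral>\<omega>. H \<omega> * \<phi> (Y u \<omega>) (z u \<omega>) \<partial>M)"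
proof -
  show b: "\<bar>H \<omega> * \<phi> (Y u \<omega>) (z u \<omega>)\<bar> \<le> \<bar>K\<bar> * \<bar>B\<bar>" if "\<omega> \<in> space M" for u \<omega>
    unfolding abs_mult using order_trans[OF K[rule_format, OF that] abs_ge_self] order_trans[OF B[OF Y_in] abs_ge_self]
    by (rule mult_mono) simp_all
  show m: "(\<lambda>\<omega>. H \<omega> * \<phi> (Y u \<omega>) (z u \<omega>)) \<in> borel_measurable M" if "0 \<le> u" for u
    by (rule borel_measurable_times[OF H bcont_meas[OF bcont that]])
  show "0 \<le> u \<Longrightarrow> integrable M (\<lambda>\<omega>. H \<omega> * \<phi> (Y u \<omega>) (z u \<omega>))"
    by (rule integrable_const_bound[of _ "\<bar>K\<bar> * \<bar>B\<bar>", OF _ m]) (auto intro!: AE_I2 b)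
  show j: "(\<lambda>(u, \<omega>). indicator {s..t} u * (H \<omega> * \<phi> (Y u \<omega>) (z u \<omega>))) \<in> borel_measurable (lborel \<Otimes>\<^sub>M M)"
    if "0 \<le> s" "s \<le> t" for s t
    using borel_measurable_times[OF measurable_compose[OF measurable_snd H] bcont_joint[OF bcont that]]
    by (simp add: split_beta' mult.left_commute)
  show "0 \<le> s \<Longrightarrow> s \<le> t \<Longrightarrow> set_integrable lborel {s..t} (\<lambda>u. \<integral>\<omega>. H \<omega> * \<phi> (Y u \<omega>) (z u \<omega>) \<partial>M)"
    by (rule fubini_bounded(3)[OF j b])
qed

text \<open>Dominated convergence is used twice, under the expectation at a fixed time and then
  under the time integral. The common bound B supplies the majorant for both.\<close>

lemma dynkin_limit:
  assumes m: "\<And>n. dynkin_pair (\<phi>n n) (\<psi>n n)" and bcn: "\<And>n. bcont (\<phi>n n)" "\<And>n. bcont (\<psi>n n)" and bcont: "bcont \<phi>" "bcont \<psi>"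
    and B: "\<And>n y z. y \<in> {0<..1} \<Longrightarrow> \<bar>\<phi>n n y z\<bar> \<le> B" "\<And>n y z. y \<in> {0<..1} \<Longrightarrow> \<bar>\<psi>n n y z\<bar> \<le> B"
    and lim: "\<And>y z. y \<in> {0<..1} \<Longrightarrow> (\<lambda>n. \<phi>n n y z) \<longlonglongrightarrow> \<phi> y z" "\<And>y z. y \<in> {0<..1} \<Longrightarrow> (\<lambda>n. \<psi>n n y z) \<longlonglongrightarrow> \<psi> y z"
  shows "dynkin_pair \<phi> \<psi>"
  unfolding dynkin_pair_def
proof (intro allI impI)
  fix s t H K
  assume st: "0 \<le> s" "s \<le> t" and H: "H \<in> borel_measurable (F s)" and K: "\<forall>\<omega>\<in>space M. \<bar>H \<omega>\<bar> \<le> (K :: real)"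
  have HM: "H \<in> borel_measurable M" using measurable_from_subalg[OF subalgebra_F[OF st(1)] H] .
  have conv: "(\<lambda>n. \<integral>\<omega>. H \<omega> * f n (Y u \<omega>) (z u \<omega>) \<partial>M) \<longlonglongrightarrow> (\<integral>\<omega>. H \<omega> * g (Y u \<omega>) (z u \<omega>) \<partial>M)"
    if "\<And>n. bcont (f n)" "bcont g" "\<And>n y z. y \<in> {0<..1} \<Longrightarrow> \<bar>f n y z\<bar> \<le> B"
      "\<And>y z. y \<in> {0<..1} \<Longrightarrow> (\<lambda>n. f n y z) \<longlonglongrightarrow> g y z" "u \<ge> 0" for f g u
  proof (rule integral_dominated_convergence[where w = "\<lambda>_. \<bar>K\<bar> * \<bar>B\<bar>"])
    show "(\<lambda>\<omega>. H \<omega> * f n (Y u \<omega>) (z u \<omega>)) \<in> borel_measurable M" for n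
      by (rule borel_measurable_times[OF HM bcont_meas[OF that(1,5)]])
    show "(\<lambda>\<omega>. H \<omega> * g (Y u \<omega>) (z u \<omega>)) \<in> borel_measurable M"
      by (rule borel_measurable_times[OF HM bcont_meas[OF that(2,5)]])
    show "AE \<omega> in M. (\<lambda>n. H \<omega> * f n (Y u \<omega>) (z u \<omega>)) \<longlonglongrightarrow> H \<omega> * g (Y u \<omega>) (z u \<omega>)"
      by (intro AE_I2 tendsto_mult tendsto_const that(4) Y_in)
    show "AE \<omega> in M. norm (H \<omega> * f n (Y u \<omega>) (z u \<omega>)) \<le> \<bar>K\<bar> * \<bar>B\<bar>" for n
      unfolding real_norm_def using weighted_dynkin(1)[OF that(1) that(3) HM K] by (intro AE_I2)
  qed simp
  have wb: "\<bar>H \<omega> * \<psi>n n (Y u \<omega>) (z u \<omega>)\<bar> \<le> \<bar>K\<bar> * \<bar>B\<bar>" if "\<omega> \<in> space M" for n u \<omega>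
    by (rule weighted_dynkin(1)[OF bcn(2) B(2) HM K that])
  have wi: "integrable M (\<lambda>\<omega>. H \<omega> * \<psi>n n (Y u \<omega>) (z u \<omega>))" if "0 \<le> u" for n u
    by (rule weighted_dynkin(3)[OF bcn(2) B(2) HM K that])
  have L1: "(\<lambda>n. (\<integral>\<omega>. H \<omega> * \<phi>n n (Y t \<omega>) (z t \<omega>) \<partial>M) - (\<integral>\<omega>. H \<omega> * \<phi>n n (Y s \<omega>) (z s \<omega>) \<partial>M)) \<longlonglongrightarrow>
    (\<integral>\<omega>. H \<omega> * \<phi> (Y t \<omega>) (z t \<omega>) \<partial>M) - (\<integral>\<omega>. H \<omega> * \<phi> (Y s \<omega>) (z s \<omega>) \<partial>M)"
    using st by (intro tendsto_diff conv[OF bcn(1) bcont(1) B(1) lim(1)]) auto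
  have L2: "(\<lambda>n. LBINT u:{s..t}. (\<integral>\<omega>. H \<omega> * \<psi>n n (Y u \<omega>) (z u \<omega>) \<partial>M)) \<longlonglongrightarrow>
    (LBINT u:{s..t}. (\<integral>\<omega>. H \<omega> * \<psi> (Y u \<omega>) (z u \<omega>) \<partial>M))"
    unfolding set_lebesgue_integral_def
  proof (rule integral_dominated_convergence[where w = "\<lambda>u. indicator {s..t} u * (\<bar>K\<bar> * \<bar>B\<bar>)"])
    show "(\<lambda>u. indicator {s..t} u *\<^sub>R (\<integral>\<omega>. H \<omega> * \<psi>n n (Y u \<omega>) (z u \<omega>) \<partial>M)) \<in> borel_measurable lborel" for n
      using weighted_dynkin(5)[OF bcn(2) B(2) HM K st] unfolding set_integrable_def by (rule borel_measurable_integrable)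
    obtain B' where "\<And>y z. y \<in> {0<..1} \<Longrightarrow> \<bar>\<psi> y z\<bar> \<le> B'" using bcont(2) unfolding bcont_def by blast
    from weighted_dynkin(5)[OF bcont(2) this HM K st]
    show "(\<lambda>u. indicator {s..t} u *\<^sub>R (\<integral>\<omega>. H \<omega> * \<psi> (Y u \<omega>) (z u \<omega>) \<partial>M)) \<in> borel_measurable lborel"
      unfolding set_integrable_def by (rule borel_measurable_integrable)
    show "integrable lborel (\<lambda>u. indicator {s..t} u * (\<bar>K\<bar> * \<bar>B\<bar>))"
      by (intro integrable_mult_left integrable_real_indicator) (auto simp: emeasure_lborel_Icc_eq)
    show "AE u in lborel. (\<lambda>n. indicator {s..t} u *\<^sub>R (\<integral>\<omega>. H \<omega> * \<psi>n n (Y u \<omega>) (z u \<omega>) \<partial>M)) \<longlonglongrightarrow>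
       indicator {s..t} u *\<^sub>R (\<integral>\<omega>. H \<omega> * \<psi> (Y u \<omega>) (z u \<omega>) \<partial>M)"
    proof (rule AE_I2)
      fix u
      show "(\<lambda>n. indicator {s..t} u *\<^sub>R (\<integral>\<omega>. H \<omega> * \<psi>n n (Y u \<omega>) (z u \<omega>) \<partial>M)) \<longlonglongrightarrow>
         indicator {s..t} u *\<^sub>R (\<integral>\<omega>. H \<omega> * \<psi> (Y u \<omega>) (z u \<omega>) \<partial>M)"
      proof (cases "u \<in> {s..t}")
        case True
        then have "u \<ge> 0" using st by simp
        then show ?thesis by (intro tendsto_scaleR tendsto_const conv[OF bcn(2) bcont(2) B(2) lim(2)])
      qed simp
    qed
    show "AE u in lborel. norm (indicator {s..t} u *\<^sub>R (\<integral>\<omega>. H \<omega> * \<psi>n n (Y u \<omega>) (z u \<omega>) \<partial>M)) \<le> indicator {s..t} u * (\<bar>K\<bar> * \<bar>B\<bar>)" for n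
    proof (rule AE_I2)
      fix u
      have "norm (\<integral>\<omega>. H \<omega> * \<psi>n n (Y u \<omega>) (z u \<omega>) \<partial>M) \<le> \<bar>K\<bar> * \<bar>B\<bar>" if "u \<ge> 0"
        unfolding real_norm_def by (rule abs_expectation_le[OF wi[OF that] wb])
      then show "norm (indicator {s..t} u *\<^sub>R (\<integral>\<omega>. H \<omega> * \<psi>n n (Y u \<omega>) (z u \<omega>) \<partial>M)) \<le> indicator {s..t} u * (\<bar>K\<bar> * \<bar>B\<bar>)"
        using st by (cases "u \<in> {s..t}") auto
    qed
  qed
  have "(\<integral>\<omega>. H \<omega> * \<phi>n n (Y t \<omega>) (z t \<omega>) \<partial>M) - (\<integral>\<omega>. H \<omega> * \<phi>n n (Y s \<omega>) (z s \<omega>) \<partial>M) =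
    (LBINT u:{s..t}. (\<integral>\<omega>. H \<omega> * \<psi>n n (Y u \<omega>) (z u \<omega>) \<partial>M))" for n
    using m[of n] st H K unfolding dynkin_pair_def by blast
  with L2 LIMSEQ_unique[OF L1] show "(\<integral>\<omega>. H \<omega> * \<phi> (Y t \<omega>) (z t \<omega>) \<partial>M) - (\<integral>\<omega>. H \<omega> * \<phi> (Y s \<omega>) (z s \<omega>) \<partial>M)
     = (LBINT u:{s..t}. (\<integral>\<omega>. H \<omega> * \<psi> (Y u \<omega>) (z u \<omega>) \<partial>M))" by simp
qed

lemma dynkin_compact:
  assumes G: "radial_adm G G1 G2 B" and h: "vertical_adm h h1 h2 C"
    and \<eta>: "\<eta> > 0" "\<And>y. y \<le> \<eta> \<Longrightarrow> G y = 0" and R: "\<And>z. \<bar>z\<bar> > R \<Longrightarrow> h z = 0"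
  shows "dynkin_pair (\<lambda>y z. G y * h z) (drift G G1 G2 h h2)"
proof -
  define f :: "real \<Rightarrow> real \<Rightarrow> real \<Rightarrow> real" where "f = (\<lambda>x y z. G (sech2_sqrt (x\<^sup>2 + y\<^sup>2)) * h z)"
  have G': "\<And>n. Cn_on {0<..1} n G" "\<And>y. y \<in> {0<..1} \<Longrightarrow> (G has_real_derivative G1 y) (at y within {0<..1})"
    "\<And>y. y \<in> {0<..1} \<Longrightarrow> (G1 has_real_derivative G2 y) (at y within {0<..1})"
    using G unfolding radial_adm_def by blast+
  have h': "\<And>n. Cn_on UNIV n h" "\<And>z. (h has_real_derivative h1 z) (at z)" "\<And>z. (h1 has_real_derivative h2 z) (at z)"
    using h unfolding vertical_adm_def by blast+
  note a = G' h' \<eta> R f_def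
  have tf: "test_fun f" by (rule test_fun_radial[OF a])
  have cy: "cyl f \<rho> \<theta> z = G (sech2 \<rho>) * h z" for \<rho> \<theta> z by (rule cyl_radial[OF a])
  have L: "(1/2) * subLap f \<rho> \<theta> z = drift G G1 G2 h h2 (sech2 \<rho>) z" if "\<rho> \<ge> 0" for \<rho> \<theta> z
    unfolding drift_def by (rule subLap_radial[OF a that])
  show ?thesis
    by (rule dynkin_test_fun[OF tf drift_bounds(1,2)[OF G h] cy L])
qed

text \<open>Powers of y and trigonometric functions of z do not have compact support. Cutting off
  both factors gives approximations with bounds uniform in n, to which \<open>dynkin_limit\<close>
  applies.\<close>

lemma dynkin_adm:
  assumes G: "radial_adm G G1 G2 B" and yG: "\<And>y. y \<in> {0<..1} \<Longrightarrow> \<bar>y * G1 y\<bar> \<le> B"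
    and h: "vertical_adm h h1 h2 C" and h1C: "\<And>z. \<bar>h1 z\<bar> \<le> C"
  shows "dynkin_pair (\<lambda>y z. G y * h z) (drift G G1 G2 h h2)"
proof -
  obtain Gn Gn1 Gn2 where Gn: "\<And>n. radial_adm (Gn n) (Gn1 n) (Gn2 n) (100 * B)"
     and \<eta>: "\<And>n. \<exists>\<eta>>0. \<forall>y\<le>\<eta>. Gn n y = 0"
     and Glim: "\<And>y. y \<in> {0<..1} \<Longrightarrow> (\<lambda>n. Gn n y) \<longlonglongrightarrow> G y"
       "\<And>y. y \<in> {0<..1} \<Longrightarrow> (\<lambda>n. radial_gen (Gn1 n) (Gn2 n) y) \<longlonglongrightarrow> radial_gen G1 G2 y"
    using radial_cutoff[OF G yG] by blast
  obtain hn hn1 hn2 D where hn: "\<And>n. vertical_adm (hn n) (hn1 n) (hn2 n) D" and R: "\<And>n. \<exists>R. \<forall>z. \<bar>z\<bar> > R \<longrightarrow> hn n z = 0"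
     and hlim: "\<And>z. (\<lambda>n. hn n z) \<longlonglongrightarrow> h z" "\<And>z. (\<lambda>n. hn2 n z) \<longlonglongrightarrow> h2 z"
    using vertical_cutoff[OF h h1C] by blast
  show ?thesis
  proof (rule dynkin_limit)
    fix n
    show "dynkin_pair (\<lambda>y z. Gn n y * hn n z) (drift (Gn n) (Gn1 n) (Gn2 n) (hn n) (hn2 n))"
      using \<eta>[of n] R[of n] by (elim exE conjE) (rule dynkin_compact[OF Gn hn], blast+)
    show "bcont (\<lambda>y z. Gn n y * hn n z)" "bcont (drift (Gn n) (Gn1 n) (Gn2 n) (hn n) (hn2 n))"
      by (rule drift_bounds(1)[OF Gn hn], rule drift_bounds(2)[OF Gn hn])
    fix y z :: real assume y: "y \<in> {0<..1}"
    show "\<bar>Gn n y * hn n z\<bar> \<le> 100 * B * D" "\<bar>drift (Gn n) (Gn1 n) (Gn2 n) (hn n) (hn2 n) y z\<bar> \<le> 100 * B * D"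
      by (rule drift_bounds(3)[OF Gn hn y], rule drift_bounds(4)[OF Gn hn y])
  next
    fix y z :: real assume y: "y \<in> {0<..1}"
    show "(\<lambda>n. Gn n y * hn n z) \<longlonglongrightarrow> G y * h z" by (intro tendsto_mult Glim hlim y)
    show "(\<lambda>n. drift (Gn n) (Gn1 n) (Gn2 n) (hn n) (hn2 n) y z) \<longlonglongrightarrow> drift G G1 G2 h h2 y z"
      unfolding drift_def by (intro tendsto_intros Glim hlim y)
  qed (rule drift_bounds(1)[OF G h], rule drift_bounds(2)[OF G h])
qed

end

section \<open>Evolution of the power moments\<close>

lemma lborel_integral_continuous:
  fixes f :: "real \<Rightarrow> real"
  assumes "continuous_on {a..b} f"
  shows "(LBINT u:{a..b}. f u) = integral {a..b} f" "set_integrable lborel {a..b} f"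
  using borel_integrable_atLeastAtMost'[OF assms] set_borel_integral_eq_integral(2) by auto

lemma measurable_integral_snd:
  fixes f :: "real \<times> 'b \<Rightarrow> real"
  assumes "f \<in> borel_measurable (lborel \<Otimes>\<^sub>M N)"
  shows "(\<lambda>\<omega>. LBINT u. f (u, \<omega>)) \<in> borel_measurable N"
proof -
  have "(\<lambda>p. f (snd p, fst p)) \<in> borel_measurable (N \<Otimes>\<^sub>M lborel)"
    by (rule measurable_compose[OF measurable_Pair[OF measurable_snd measurable_fst] assms])
  then have "(\<lambda>(\<omega>, u). f (u, \<omega>)) \<in> borel_measurable (N \<Otimes>\<^sub>M lborel)" by (simp add: split_beta')
  then show ?thesis by (rule lborel.borel_measurable_lebesgue_integral)
qed

text \<open>V solves V' = - \<kappa> q V with V 0 = 1. The last claim is integration by parts: (V s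
  - 1) (I t - I s) vanishes at s = 0 by its first factor and at s = t by its second.\<close>

lemma exponential_weight:
  fixes q f :: "real \<Rightarrow> real" and \<kappa> :: real
  assumes t: "0 \<le> t" and q: "continuous_on {0..t} q" and f: "continuous_on {0..t} f"
  defines "A \<equiv> \<lambda>s. integral {0..s} q" and "I \<equiv> \<lambda>s. integral {0..s} f"
  defines "V \<equiv> \<lambda>s. exp (- \<kappa> * A s)"
  shows "continuous_on {0..t} A" "continuous_on {0..t} I"
    "integral {0..t} (\<lambda>s. - \<kappa> * q s * V s) = V t - 1"
    "integral {0..t} (\<lambda>s. - \<kappa> * q s * V s * (I t - I s)) = integral {0..t} (\<lambda>s. (V s - 1) * f s)"
proof -
  have dA: "(A has_real_derivative q s) (at s within {0..t})" if "s \<in> {0..t}" for s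
    unfolding A_def by (rule integral_has_real_derivative[OF q that])
  have dI: "(I has_real_derivative f s) (at s within {0..t})" if "s \<in> {0..t}" for s
    unfolding I_def by (rule integral_has_real_derivative[OF f that])
  show cA: "continuous_on {0..t} A" and cI: "continuous_on {0..t} I"
    by (rule DERIV_continuous_on[OF dA], assumption, rule DERIV_continuous_on[OF dI], assumption)
  have cV: "continuous_on {0..t} V" unfolding V_def by (intro continuous_intros cA)
  have dV: "(V has_real_derivative - \<kappa> * q s * V s) (at s within {0..t})" if "s \<in> {0..t}" for s
    unfolding V_def using DERIV_chain2[OF DERIV_exp DERIV_cmult[OF dA[OF that], of "- \<kappa>"]]
    by (simp add: mult.commute mult.left_commute)
  have V0: "V 0 = 1" by (simp add: V_def A_def)
  have "((\<lambda>s. - \<kappa> * q s * V s) has_integral (V t - V 0)) {0..t}"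
    using dV by (intro fundamental_theorem_of_calculus t) (simp add: has_real_derivative_iff_has_vector_derivative)
  then show "integral {0..t} (\<lambda>s. - \<kappa> * q s * V s) = V t - 1"
    unfolding V0 by (rule integral_unique)
  have "((\<lambda>s. (V s - 1) * (I t - I s)) has_real_derivative
      (- \<kappa> * q s * V s * (I t - I s) - (V s - 1) * f s)) (at s within {0..t})" if "s \<in> {0..t}" for s
    using DERIV_mult[OF DERIV_diff[OF dV[OF that] DERIV_const[of 1]] DERIV_diff[OF DERIV_const[of "I t"] dI[OF that]]]
    by (rule DERIV_cong) simp
  then have "((\<lambda>s. - \<kappa> * q s * V s * (I t - I s) - (V s - 1) * f s) has_integral
      ((V t - 1) * (I t - I t) - (V 0 - 1) * (I t - I 0))) {0..t}"
    by (intro fundamental_theorem_of_calculus t) (simp add: has_real_derivative_iff_has_vector_derivative)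
  then have "integral {0..t} (\<lambda>s. - \<kappa> * q s * V s * (I t - I s) - (V s - 1) * f s) = 0"
    using V0 by (simp add: integral_unique)
  moreover have "(\<lambda>s. - \<kappa> * q s * V s * (I t - I s)) integrable_on {0..t}"
    by (intro integrable_continuous_real continuous_intros q cV cI)
  moreover have "(\<lambda>s. (V s - 1) * f s) integrable_on {0..t}"
    by (intro integrable_continuous_real continuous_intros f cV)
  ultimately show "integral {0..t} (\<lambda>s. - \<kappa> * q s * V s * (I t - I s)) = integral {0..t} (\<lambda>s. (V s - 1) * f s)"
    by (simp add: Henstock_Kurzweil_Integration.integral_diff)
qed

text \<open>Half the radial generator with the potential -(l^2/2)(1-y), applied to y^k.\<close>
definition power_drift :: "real \<Rightarrow> real \<Rightarrow> real \<Rightarrow> real" where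
  "power_drift l k y = (1/2) * ((k\<^sup>2 - k - l\<^sup>2) * y powr k - (k\<^sup>2 - l\<^sup>2) * y powr (k + 1))"

lemma powr_le_one: "0 < y \<Longrightarrow> y \<le> 1 \<Longrightarrow> 0 \<le> k \<Longrightarrow> y powr k \<le> (1::real)"
  using powr_mono2[of k y 1] by simp

lemma powr_facts:
  assumes "(y::real) > 0"
  shows "y powr (k - 1) * y = y powr k" "y powr (k - 2) * y\<^sup>2 = y powr k" "y powr (k + 1) = y powr k * y"
proof -
  show "y powr (k - 1) * y = y powr k" using assms by (simp add: powr_diff)
  have "y powr 2 = y\<^sup>2" using assms by simp
  then show "y powr (k - 2) * y\<^sup>2 = y powr k" using assms by (simp add: powr_diff del: powr_numeral)
  show "y powr (k + 1) = y powr k * y" using assms by (simp add: powr_add)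
qed

lemma radial_gen_powr:
  assumes "y > 0"
  shows "radial_gen (\<lambda>y. k * y powr (k - 1)) (\<lambda>y. k * ((k - 1) * y powr (k - 2))) y =
    (k\<^sup>2 - k) * y powr k - k\<^sup>2 * y powr (k + 1)"
proof -
  have "radial_gen (\<lambda>y. k * y powr (k - 1)) (\<lambda>y. k * ((k - 1) * y powr (k - 2))) y =
    k * (k - 1) * (1 - y) * (y powr (k - 2) * y\<^sup>2) - k * y * (y powr (k - 1) * y)"
    unfolding radial_gen_def by algebra
  also have "\<dots> = (k\<^sup>2 - k) * y powr k - k\<^sup>2 * (y powr k * y)"
    unfolding powr_facts[OF assms] by algebra
  finally show ?thesis by (simp add: powr_facts(3)[OF assms])
qed

text \<open>The powers of y in \<open>radial_gen\<close> and in y G' compensate the singularity of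
  the derivatives at y = 0. The bound adds 1 for y^k, k^2 + k for |k^2 - k|, and k^2 for the second
  term of the generator.\<close>

lemma radial_adm_powr:
  assumes "k \<ge> 0"
  shows "radial_adm (\<lambda>y. y powr k) (\<lambda>y. k * y powr (k - 1)) (\<lambda>y. k * ((k - 1) * y powr (k - 2))) (1 + k + 2 * k\<^sup>2)"
    and "y \<in> {0<..1} \<Longrightarrow> \<bar>y * (k * y powr (k - 1))\<bar> \<le> 1 + k + 2 * k\<^sup>2"
proof -
  have d: "((\<lambda>x. x powr p) has_real_derivative p * x powr (p - 1)) (at x within S)"
    if "x > 0" for x p :: real and S
    using that by (intro DERIV_subset[OF has_real_derivative_powr]) auto
  show "radial_adm (\<lambda>y. y powr k) (\<lambda>y. k * y powr (k - 1)) (\<lambda>y. k * ((k - 1) * y powr (k - 2))) (1 + k + 2 * k\<^sup>2)"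
    unfolding radial_adm_def
  proof (intro conjI allI ballI)
    show "Cn_on {0<..1} n (\<lambda>y. y powr k)" for n by (rule Cn_on_subset[OF Cn_on_powr]) auto
    show "continuous_on {0<..1} (\<lambda>y. k * ((k - 1) * y powr (k - 2)))" by (intro continuous_intros) auto
    fix y :: real assume y: "y \<in> {0<..1}"
    then show "((\<lambda>y. y powr k) has_real_derivative k * y powr (k - 1)) (at y within {0<..1})" by (intro d) auto
    show "((\<lambda>y. k * y powr (k - 1)) has_real_derivative k * ((k - 1) * y powr (k - 2))) (at y within {0<..1})"
      using DERIV_cmult[OF d[of y "k - 1"], of k] y by simp
    have p: "0 \<le> y powr k" "y powr k \<le> 1" "0 \<le> y powr (k + 1)" "y powr (k + 1) \<le> 1"
      using y assms powr_le_one[of y k] powr_le_one[of y "k + 1"] by auto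
    moreover have "0 \<le> k\<^sup>2" by simp
    ultimately show "\<bar>y powr k\<bar> \<le> 1 + k + 2 * k\<^sup>2" using assms by linarith
    have "\<bar>(k\<^sup>2 - k) * y powr k\<bar> \<le> \<bar>k\<^sup>2 - k\<bar> * 1" unfolding abs_mult using p by (intro mult_left_mono) auto
    moreover have "\<bar>k\<^sup>2 * y powr (k + 1)\<bar> \<le> k\<^sup>2" using p by (simp add: abs_mult mult_left_le)
    moreover have "\<bar>k\<^sup>2 - k\<bar> \<le> k\<^sup>2 + k" using assms by (auto simp: abs_le_iff)
    moreover have "\<bar>a - b\<bar> \<le> 1 + k + 2 * k\<^sup>2" if "\<bar>a\<bar> \<le> c * 1" "\<bar>b\<bar> \<le> k\<^sup>2" "c \<le> k\<^sup>2 + k" for a b c :: real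
      using that by (simp add: abs_le_iff)
    moreover have "y > 0" using y by simp
    ultimately show "\<bar>radial_gen (\<lambda>y. k * y powr (k - 1)) (\<lambda>y. k * ((k - 1) * y powr (k - 2))) y\<bar> \<le> 1 + k + 2 * k\<^sup>2"
      unfolding radial_gen_powr[OF \<open>y > 0\<close>] by blast
  qed
  show "\<bar>y * (k * y powr (k - 1))\<bar> \<le> 1 + k + 2 * k\<^sup>2" if y: "y \<in> {0<..1}"
  proof -
    have eq: "y * (k * y powr (k - 1)) = k * y powr k" using powr_facts(1)[of y k] y by (simp add: mult_ac)
    have "\<bar>k * y powr k\<bar> \<le> k * 1"
      unfolding abs_mult using powr_le_one[of y k] y assms by (intro mult_mono) auto
    also have "\<dots> \<le> 1 + k + 2 * k\<^sup>2" by simp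
    finally show ?thesis unfolding eq .
  qed
qed

text \<open>\<open>dynkin_adm\<close> takes one constant for h, h1 and h2; here 1 + |l| + l^2
  dominates the factors 1, |l| and l^2 that the three carry.\<close>

lemma vertical_adm_trig:
  fixes a b l :: real
  defines "h \<equiv> \<lambda>z. a * cos (l * z) + b * sin (l * z)"
  shows "vertical_adm h (\<lambda>z. l * (b * cos (l * z) - a * sin (l * z))) (\<lambda>z. - l\<^sup>2 * h z) ((1 + \<bar>l\<bar> + l\<^sup>2) * (\<bar>a\<bar> + \<bar>b\<bar>))"
    and "\<bar>l * (b * cos (l * z) - a * sin (l * z))\<bar> \<le> (1 + \<bar>l\<bar> + l\<^sup>2) * (\<bar>a\<bar> + \<bar>b\<bar>)"
proof -
  have m: "\<bar>c * cos w\<bar> \<le> \<bar>c\<bar>" "\<bar>c * sin w\<bar> \<le> \<bar>c\<bar>" for c w :: real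
    unfolding abs_mult by (simp_all add: mult_left_le)
  have hb: "\<bar>h z\<bar> \<le> \<bar>a\<bar> + \<bar>b\<bar>" for z
    using m(1)[of a "l * z"] m(2)[of b "l * z"] unfolding h_def by linarith
  have h1b: "\<bar>b * cos (l * z) - a * sin (l * z)\<bar> \<le> \<bar>a\<bar> + \<bar>b\<bar>" for z
    using m(1)[of b "l * z"] m(2)[of a "l * z"] by linarith
  have w: "\<bar>c * x\<bar> \<le> (1 + \<bar>l\<bar> + l\<^sup>2) * (\<bar>a\<bar> + \<bar>b\<bar>)" if "\<bar>x\<bar> \<le> \<bar>a\<bar> + \<bar>b\<bar>" "\<bar>c\<bar> \<le> 1 + \<bar>l\<bar> + l\<^sup>2" for c x
    unfolding abs_mult using that by (intro mult_mono) auto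
  show "\<bar>l * (b * cos (l * z) - a * sin (l * z))\<bar> \<le> (1 + \<bar>l\<bar> + l\<^sup>2) * (\<bar>a\<bar> + \<bar>b\<bar>)"
    by (rule w[OF h1b]) simp
  show "vertical_adm h (\<lambda>z. l * (b * cos (l * z) - a * sin (l * z))) (\<lambda>z. - l\<^sup>2 * h z) ((1 + \<bar>l\<bar> + l\<^sup>2) * (\<bar>a\<bar> + \<bar>b\<bar>))"
    unfolding vertical_adm_def
  proof (intro conjI allI)
    show "Cn_on UNIV n h" for n unfolding h_def by (rule Cn_on_trig)
    show "continuous_on UNIV (\<lambda>z. - l\<^sup>2 * h z)" unfolding h_def by (intro continuous_intros)
    fix z
    show "(h has_real_derivative l * (b * cos (l * z) - a * sin (l * z))) (at z)"
      unfolding h_def by (auto intro!: derivative_eq_intros simp: algebra_simps)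
    show "((\<lambda>z. l * (b * cos (l * z) - a * sin (l * z))) has_real_derivative - l\<^sup>2 * h z) (at z)"
      unfolding h_def by (auto intro!: derivative_eq_intros simp: algebra_simps power2_eq_square)
    show "\<bar>h z\<bar> \<le> (1 + \<bar>l\<bar> + l\<^sup>2) * (\<bar>a\<bar> + \<bar>b\<bar>)" using w[OF hb, of 1] by simp
    show "\<bar>- l\<^sup>2 * h z\<bar> \<le> (1 + \<bar>l\<bar> + l\<^sup>2) * (\<bar>a\<bar> + \<bar>b\<bar>)" by (rule w[OF hb]) simp
  qed
qed

section \<open>Expectations of powers of Y times cos, sin or exp\<close>

context sl2bm begin

lemma dynkinD:
  assumes "dynkin_pair \<phi> \<psi>" "0 \<le> s" "s \<le> t" "H \<in> borel_measurable (F s)" "\<forall>\<omega>\<in>space M. \<bar>H \<omega>\<bar> \<le> K"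
  shows "(\<integral>\<omega>. H \<omega> * \<phi> (Y t \<omega>) (z t \<omega>) \<partial>M) - (\<integral>\<omega>. H \<omega> * \<phi> (Y s \<omega>) (z s \<omega>) \<partial>M)
     = (LBINT u:{s..t}. (\<integral>\<omega>. H \<omega> * \<psi> (Y u \<omega>) (z u \<omega>) \<partial>M))"
  using assms unfolding dynkin_pair_def by blast

lemma dynkin_cong:
  "dynkin_pair \<phi> \<psi> \<Longrightarrow> (\<And>y z. y \<in> {0<..1} \<Longrightarrow> \<psi> y z = \<psi>' y z) \<Longrightarrow> dynkin_pair \<phi> \<psi>'"
  unfolding dynkin_pair_def using Y_in by simp

lemma dynkin_power:
  assumes "k \<ge> 0"
  shows "dynkin_pair (\<lambda>y z. y powr k * (a * cos (l * z) + b * sin (l * z)))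
     (\<lambda>y z. power_drift l k y * (a * cos (l * z) + b * sin (l * z)))"
proof -
  have "dynkin_pair (\<lambda>y z. y powr k * (a * cos (l * z) + b * sin (l * z)))
    (drift (\<lambda>y. y powr k) (\<lambda>y. k * y powr (k - 1)) (\<lambda>y. k * ((k - 1) * y powr (k - 2)))
      (\<lambda>z. a * cos (l * z) + b * sin (l * z)) (\<lambda>z. - l\<^sup>2 * (a * cos (l * z) + b * sin (l * z))))"
    by (rule dynkin_adm[OF radial_adm_powr[OF assms] vertical_adm_trig])
  then show ?thesis
  proof (rule dynkin_cong)
    fix y z :: real assume "y \<in> {0<..1}"
    then have y: "y > 0" by simp
    show "drift (\<lambda>y. y powr k) (\<lambda>y. k * y powr (k - 1)) (\<lambda>y. k * ((k - 1) * y powr (k - 2)))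
      (\<lambda>z. a * cos (l * z) + b * sin (l * z)) (\<lambda>z. - l\<^sup>2 * (a * cos (l * z) + b * sin (l * z))) y z
      = power_drift l k y * (a * cos (l * z) + b * sin (l * z))"
      unfolding drift_def radial_gen_powr[OF y] power_drift_def powr_facts(3)[OF y] by algebra
  qed
qed

text \<open>At time 0 the process sits at y = 1 and z = 0, which leaves the initial value a for
  every exponent k.\<close>

lemma expectation_trig:
  assumes "k \<ge> 0" "t \<ge> 0"
  shows "(\<integral>\<omega>. Y t \<omega> powr k * (a * cos (l * z t \<omega>) + b * sin (l * z t \<omega>)) \<partial>M) - a =
    (LBINT u:{0..t}. (\<integral>\<omega>. power_drift l k (Y u \<omega>) * (a * cos (l * z u \<omega>) + b * sin (l * z u \<omega>)) \<partial>M))"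
proof -
  have "(\<integral>\<omega>. 1 * (Y t \<omega> powr k * (a * cos (l * z t \<omega>) + b * sin (l * z t \<omega>))) \<partial>M) -
    (\<integral>\<omega>. 1 * (Y 0 \<omega> powr k * (a * cos (l * z 0 \<omega>) + b * sin (l * z 0 \<omega>))) \<partial>M) =
    (LBINT u:{0..t}. (\<integral>\<omega>. 1 * (power_drift l k (Y u \<omega>) * (a * cos (l * z u \<omega>) + b * sin (l * z u \<omega>))) \<partial>M))"
    by (rule dynkinD[OF dynkin_power[OF assms(1), of a l b] order_refl assms(2), of _ 1]) simp_all
  moreover have "(\<integral>\<omega>. 1 * (Y 0 \<omega> powr k * (a * cos (l * z 0 \<omega>) + b * sin (l * z 0 \<omega>))) \<partial>M) = (\<integral>\<omega>. a \<partial>M)"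
    by (rule Bochner_Integration.integral_cong) (simp_all add: Y_start start_at_origin)
  ultimately show ?thesis by (simp add: prob_space)
qed

text \<open>By \<open>tanh_half_sq\<close> the integrand is tanh^2(r/2), so A is the random clock of
  z, and \<open>V l\<close> is the characteristic function at l of a centred normal variable with
  variance A.\<close>

definition A :: "real \<Rightarrow> 'a \<Rightarrow> real" where "A t \<omega> = integral {0..t} (\<lambda>u. 1 - Y u \<omega>)"
definition V :: "real \<Rightarrow> real \<Rightarrow> 'a \<Rightarrow> real" where "V l t \<omega> = exp (- (l\<^sup>2 / 2) * A t \<omega>)"

lemma q_cont: "\<omega> \<in> space M \<Longrightarrow> continuous_on {0..t} (\<lambda>u. 1 - Y u \<omega>)"
  by (intro continuous_intros continuous_on_subset[OF Y_cont]) auto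

lemma A_cont:
  assumes "\<omega> \<in> space M" shows "continuous_on {0..t} (\<lambda>s. A s \<omega>)"
proof (cases "0 \<le> t")
  case True
  show ?thesis unfolding A_def by (rule exponential_weight(1)[OF True q_cont[OF assms] q_cont[OF assms]])
qed simp

lemma V_cont: "\<omega> \<in> space M \<Longrightarrow> continuous_on {0..t} (\<lambda>s. V l s \<omega>)"
  unfolding V_def by (intro continuous_intros A_cont)

lemma A_bounds:
  assumes "\<omega> \<in> space M" "0 \<le> t" shows "0 \<le> A t \<omega>" "A t \<omega> \<le> t"
proof -
  have i: "(\<lambda>u. 1 - Y u \<omega>) integrable_on {0..t}" by (rule integrable_continuous_real[OF q_cont[OF assms(1)]])
  show "0 \<le> A t \<omega>" unfolding A_def
    by (rule Henstock_Kurzweil_Integration.integral_nonneg[OF i]) (use Y_in in auto)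
  have "A t \<omega> \<le> integral {0..t} (\<lambda>u. 1)" unfolding A_def
    by (rule integral_le[OF i]) (use Y_in in \<open>auto simp: less_imp_le\<close>)
  then show "A t \<omega> \<le> t" using assms(2) by simp
qed

lemma V_bounds: "\<omega> \<in> space M \<Longrightarrow> 0 \<le> t \<Longrightarrow> 0 < V l t \<omega> \<and> V l t \<omega> \<le> 1"
  using A_bounds[of \<omega> t] by (simp add: V_def)

lemma bcont_of_y: "continuous_on {0<..1} g \<Longrightarrow> (\<And>y. y \<in> {0<..1} \<Longrightarrow> \<bar>g y\<bar> \<le> B) \<Longrightarrow> bcont (\<lambda>y z. g y)"
  using bcont_prodI[of g "\<lambda>_. 1" B 1] by simp

text \<open>Measurability with respect to the past up to s is what admits \<open>V l s\<close>, a
  function of A, as part of the weight H in \<open>dynkin_pair\<close>.\<close>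

lemma A_meas_F:
  assumes "0 \<le> s" shows "A s \<in> borel_measurable (F s)"
proof -
  have bcont: "bcont (\<lambda>y z. 1 - y)" by (rule bcont_of_y[where B=1]) (auto intro!: continuous_intros)
  have "(\<lambda>(u, \<omega>). indicator {0..s} u * (1 - Y u \<omega>)) \<in> borel_measurable (lborel \<Otimes>\<^sub>M F s)"
    by (rule joint_measurable[OF assms]) (use bcont_meas_F[OF bcont] q_cont in auto)
  from measurable_integral_snd[OF this]
  have "(\<lambda>\<omega>. LBINT u. indicator {0..s} u * (1 - Y u \<omega>)) \<in> borel_measurable (F s)" by simp
  then show ?thesis
  proof (rule measurable_cong[THEN iffD1, rotated])
    fix \<omega> assume "\<omega> \<in> space (F s)"
    then show "(LBINT u. indicator {0..s} u * (1 - Y u \<omega>)) = A s \<omega>"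
      using lborel_integral_continuous(1)[OF q_cont[of \<omega> s]] by (simp add: A_def set_lebesgue_integral_def)
  qed
qed

lemma V_meas_F: "0 \<le> s \<Longrightarrow> V l s \<in> borel_measurable (F s)"
  unfolding V_def[abs_def] using A_meas_F by measurable

lemma V_meas: "0 \<le> s \<Longrightarrow> V l s \<in> borel_measurable M"
  by (rule measurable_from_subalg[OF subalgebra_F V_meas_F])

lemma fubini_continuous:
  fixes X :: "real \<Rightarrow> 'a \<Rightarrow> real"
  assumes "a \<le> b" and "\<And>u. u \<in> {a..b} \<Longrightarrow> X u \<in> borel_measurable M"
    and "\<And>\<omega>. \<omega> \<in> space M \<Longrightarrow> continuous_on {a..b} (\<lambda>u. X u \<omega>)"
    and b: "\<And>u \<omega>. u \<in> {a..b} \<Longrightarrow> \<omega> \<in> space M \<Longrightarrow> \<bar>X u \<omega>\<bar> \<le> (B :: real)"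
  shows "(LBINT u:{a..b}. (\<integral>\<omega>. X u \<omega> \<partial>M)) = (\<integral>\<omega>. integral {a..b} (\<lambda>u. X u \<omega>) \<partial>M)"
    "set_integrable lborel {a..b} (\<lambda>u. \<integral>\<omega>. X u \<omega> \<partial>M)"
    "integrable M (\<lambda>\<omega>. integral {a..b} (\<lambda>u. X u \<omega>))"
    "\<And>u. u \<in> {a..b} \<Longrightarrow> integrable M (X u)"
proof -
  note fb = fubini_bounded[OF joint_measurable[OF assms(1-3)] b]
  have eq: "(LBINT u:{a..b}. X u \<omega>) = integral {a..b} (\<lambda>u. X u \<omega>)" if "\<omega> \<in> space M" for \<omega>
    using lborel_integral_continuous(1)[OF assms(3)[OF that]] .
  show "set_integrable lborel {a..b} (\<lambda>u. \<integral>\<omega>. X u \<omega> \<partial>M)" by (rule fb(3))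
  have "integrable M (\<lambda>\<omega>. LBINT u:{a..b}. X u \<omega>)" by (rule fb(1))
  then show "integrable M (\<lambda>\<omega>. integral {a..b} (\<lambda>u. X u \<omega>))"
    by (rule Bochner_Integration.integrable_cong[OF refl eq, THEN iffD1, rotated])
  have "(\<integral>\<omega>. (LBINT u:{a..b}. X u \<omega>) \<partial>M) = (LBINT u:{a..b}. (\<integral>\<omega>. X u \<omega> \<partial>M))" by (rule fb(2))
  moreover have "(\<integral>\<omega>. (LBINT u:{a..b}. X u \<omega>) \<partial>M) = (\<integral>\<omega>. integral {a..b} (\<lambda>u. X u \<omega>) \<partial>M)"
    by (rule Bochner_Integration.integral_cong[OF refl eq])
  ultimately show "(LBINT u:{a..b}. (\<integral>\<omega>. X u \<omega> \<partial>M)) = (\<integral>\<omega>. integral {a..b} (\<lambda>u. X u \<omega>) \<partial>M)" by simp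
  show "integrable M (X u)" if "u \<in> {a..b}" for u
    by (rule integrable_const_bound[of _ B, OF _ assms(2)[OF that]]) (use b[OF that] in auto)
qed

lemma power_drift_bound:
  assumes "k \<ge> 0" "y \<in> {0<..1}" shows "\<bar>power_drift l k y\<bar> \<le> \<bar>k\<^sup>2 - k - l\<^sup>2\<bar> + \<bar>k\<^sup>2 - l\<^sup>2\<bar>"
proof -
  have p: "0 \<le> y powr k" "y powr k \<le> 1" "0 \<le> y powr (k + 1)" "y powr (k + 1) \<le> 1"
    using assms powr_le_one[of y k] powr_le_one[of y "k + 1"] by auto
  have "\<bar>(k\<^sup>2 - k - l\<^sup>2) * y powr k\<bar> \<le> \<bar>k\<^sup>2 - k - l\<^sup>2\<bar>" "\<bar>(k\<^sup>2 - l\<^sup>2) * y powr (k + 1)\<bar> \<le> \<bar>k\<^sup>2 - l\<^sup>2\<bar>"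
    unfolding abs_mult using p by (simp_all add: mult_left_le)
  moreover have "\<bar>(1/2) * (a - b)\<bar> \<le> c + d" if "\<bar>a\<bar> \<le> c" "\<bar>b\<bar> \<le> d" for a b c d :: real
    using that by (simp add: abs_le_iff)
  ultimately show ?thesis unfolding power_drift_def by blast
qed

lemma power_drift_continuous: "continuous_on {0<..1} (power_drift l k)"
  unfolding power_drift_def[abs_def] by (intro continuous_intros) auto

lemma powr_continuous: "continuous_on {0<..1} (\<lambda>y::real. y powr k)"
  by (intro continuous_intros) auto

text \<open>V has paths of bounded variation with an adapted derivative, so the product rule needs only
  Fubini and the orthogonality in \<^const>\<open>dynkin_pair\<close>; no stochastic integral is involved.\<close>
lemma expectation_V:
  assumes k: "k \<ge> 0" and t: "t \<ge> 0"
  shows "(\<integral>\<omega>. Y t \<omega> powr k * V l t \<omega> \<partial>M) - 1 = (LBINT u:{0..t}. (\<integral>\<omega>. power_drift l k (Y u \<omega>) * V l u \<omega> \<partial>M))"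
proof -
  define \<kappa> where "\<kappa> = l\<^sup>2 / 2"
  define p where "p u \<omega> = Y u \<omega> powr k" for u \<omega>
  \<comment> \<open>f is the drift of y^k without the potential, hence the index 0, and W below is
    the time derivative of V.\<close>
  define f where "f u \<omega> = power_drift 0 k (Y u \<omega>)" for u \<omega>
  define W where "W s \<omega> = - \<kappa> * (1 - Y s \<omega>) * V l s \<omega>" for s \<omega>
  define I where "I s \<omega> = integral {0..s} (\<lambda>u. f u \<omega>)" for s \<omega>
  define B where "B = \<bar>k\<^sup>2 - k - 0\<^sup>2\<bar> + \<bar>k\<^sup>2 - 0\<^sup>2\<bar>"
  have B0: "0 \<le> B" by (simp add: B_def)
  have \<kappa>0: "0 \<le> \<kappa>" by (simp add: \<kappa>_def)
  have bcp: "bcont (\<lambda>y z. y powr k)"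
    by (rule bcont_of_y[OF powr_continuous, where B=1]) (use k powr_le_one in auto)
  have bcf: "bcont (\<lambda>y z. power_drift 0 k y)" by (rule bcont_of_y[OF power_drift_continuous power_drift_bound[OF k]])
  have bcq: "bcont (\<lambda>y z. 1 - y)" by (rule bcont_of_y[where B=1]) (auto intro!: continuous_intros)
  have fb: "\<bar>f u \<omega>\<bar> \<le> B" for u \<omega> unfolding f_def B_def by (rule power_drift_bound[OF k Y_in])
  have pb: "\<bar>p u \<omega>\<bar> \<le> 1" for u \<omega> unfolding p_def using Y_in[of u \<omega>] powr_le_one[OF _ _ k] by simp
  have Wb: "\<bar>W u \<omega>\<bar> \<le> \<kappa>" if "\<omega> \<in> space M" "0 \<le> u" for u \<omega>
  proof -
    have "\<bar>\<kappa> * (1 - Y u \<omega>)\<bar> * \<bar>V l u \<omega>\<bar> \<le> \<kappa> * 1"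
      unfolding abs_mult using Y_in[of u \<omega>] V_bounds[OF that, of l] \<kappa>0
      by (intro mult_mono) (auto simp: mult_left_le)
    then show ?thesis unfolding W_def by (simp add: abs_mult)
  qed
  have pc: "continuous_on {0..t} (\<lambda>u. p u \<omega>)" and fc: "continuous_on {0..s} (\<lambda>u. f u \<omega>)" if "\<omega> \<in> space M" for \<omega> s
    unfolding p_def f_def
    using continuous_on_subset[OF bcont_cont[OF bcp that]] continuous_on_subset[OF bcont_cont[OF bcf that]] by auto
  have Vc: "continuous_on {0..t} (\<lambda>u. V l u \<omega>)" if "\<omega> \<in> space M" for \<omega> by (rule V_cont[OF that])
  have Wc: "continuous_on {0..t} (\<lambda>u. W u \<omega>)" if "\<omega> \<in> space M" for \<omega>
    unfolding W_def by (intro continuous_on_mult continuous_on_const q_cont Vc that)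
  have pm: "p u \<in> borel_measurable M" and fm: "f u \<in> borel_measurable M"
    if "0 \<le> u" for u
    unfolding p_def f_def using bcont_meas[OF bcp that] bcont_meas[OF bcf that] by simp_all
  have WF: "W u \<in> borel_measurable (F u)" if "0 \<le> u" for u
    unfolding W_def[abs_def] using bcont_meas_F[OF bcq that order_refl] V_meas_F[OF that, of l]
    by (intro borel_measurable_times borel_measurable_const)
  have Wm: "W u \<in> borel_measurable M" if "0 \<le> u" for u
    by (rule measurable_from_subalg[OF subalgebra_F[OF that] WF[OF that]])
  note ew = exponential_weight(3,4)[OF t q_cont fc, where \<kappa>=\<kappa>]
  have Ic: "continuous_on {0..t} (\<lambda>s. I s \<omega>)" if "\<omega> \<in> space M" for \<omega>
    unfolding I_def by (rule exponential_weight(2)[OF t q_cont[OF that] fc[OF that]])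
  have Ieq: "I t \<omega> - I s \<omega> = (LBINT u:{s..t}. f u \<omega>)" if "\<omega> \<in> space M" "0 \<le> s" "s \<le> t" for s \<omega>
  proof -
    have "integral {0..s} (\<lambda>u. f u \<omega>) + integral {s..t} (\<lambda>u. f u \<omega>) = integral {0..t} (\<lambda>u. f u \<omega>)"
      using that by (intro Henstock_Kurzweil_Integration.integral_combine integrable_continuous_real fc) auto
    moreover have "continuous_on {s..t} (\<lambda>u. f u \<omega>)"
      by (rule continuous_on_subset[OF fc[OF that(1), of t]]) (use that in auto)
    ultimately show ?thesis unfolding I_def by (simp add: lborel_integral_continuous(1))
  qed
  have Im: "(\<lambda>\<omega>. I t \<omega> - I s \<omega>) \<in> borel_measurable M" if s: "0 \<le> s" "s \<le> t" for s
  proof -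
    have "(\<lambda>\<omega>. LBINT u:{s..t}. f u \<omega>) \<in> borel_measurable M"
      unfolding f_def by (rule borel_measurable_integrable[OF fubini_bounded(1)[OF bcont_joint[OF bcf s] power_drift_bound[OF k Y_in]]])
    then show ?thesis by (rule measurable_cong[THEN iffD1, rotated]) (simp add: Ieq s)
  qed
  have Ib: "\<bar>I t \<omega> - I s \<omega>\<bar> \<le> B * t" if "\<omega> \<in> space M" "0 \<le> s" "s \<le> t" for s \<omega>
  proof -
    have "\<bar>LBINT u:{s..t}. f u \<omega>\<bar> \<le> \<bar>B\<bar> * \<bar>t - s\<bar>"
      using fubini_bounded(5)[OF bcont_joint[OF bcf that(2,3)] power_drift_bound[OF k Y_in] that(1)] unfolding f_def B_def .
    also have "\<dots> \<le> B * t" using B0 that by (intro mult_mono) auto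
    finally show ?thesis using Ieq[OF that] by simp
  qed
  have mk: "(\<integral>\<omega>. H \<omega> * p v \<omega> \<partial>M) - (\<integral>\<omega>. H \<omega> * p s \<omega> \<partial>M) = (LBINT u:{s..v}. (\<integral>\<omega>. H \<omega> * f u \<omega> \<partial>M))"
    if "0 \<le> s" "s \<le> v" "H \<in> borel_measurable (F s)" "\<forall>\<omega>\<in>space M. \<bar>H \<omega>\<bar> \<le> K" for s v H K
    using dynkinD[OF dynkin_power[OF k, of 1 0 0] that] unfolding p_def f_def by simp
  \<comment> \<open>\<open>W s\<close> is known at time s, so y^k at time t may be replaced by its
    value at s plus the accumulated drift; the martingale part averages out.\<close>
  have step1: "(\<integral>\<omega>. W s \<omega> * p t \<omega> \<partial>M) = (\<integral>\<omega>. W s \<omega> * p s \<omega> \<partial>M) + (\<integral>\<omega>. W s \<omega> * (I t \<omega> - I s \<omega>) \<partial>M)"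
    if s: "s \<in> {0..t}" for s
  proof -
    have s': "0 \<le> s" "s \<le> t" using s by auto
    have Kb: "\<forall>\<omega>\<in>space M. \<bar>W s \<omega>\<bar> \<le> \<kappa>" using Wb s' by auto
    have "(LBINT u:{s..t}. (\<integral>\<omega>. W s \<omega> * f u \<omega> \<partial>M)) = (\<integral>\<omega>. (LBINT u:{s..t}. W s \<omega> * f u \<omega>) \<partial>M)"
      unfolding f_def
      by (rule fubini_bounded(2)[OF weighted_dynkin(4,1)[OF bcf power_drift_bound[OF k] Wm[OF s'(1)] Kb], symmetric]) (use s' in auto)
    also have "\<dots> = (\<integral>\<omega>. W s \<omega> * (I t \<omega> - I s \<omega>) \<partial>M)"
      by (rule Bochner_Integration.integral_cong) (simp_all add: Ieq s')
    finally show ?thesis using mk[OF s' WF[OF s'(1)] Kb] by simp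
  qed
  have b1: "\<bar>W s \<omega> * p u \<omega>\<bar> \<le> \<kappa> * 1" if "\<omega> \<in> space M" "0 \<le> s" for s u \<omega>
    unfolding abs_mult using Wb[OF that] pb \<kappa>0 by (intro mult_mono) auto
  have b3: "\<bar>W s \<omega> * (I t \<omega> - I s \<omega>)\<bar> \<le> \<kappa> * (B * t)" if "\<omega> \<in> space M" "s \<in> {0..t}" for s \<omega>
    unfolding abs_mult using Wb[OF that(1)] Ib[OF that(1)] \<kappa>0 that by (intro mult_mono) auto
  have b4: "\<bar>(V l s \<omega> - 1) * f s \<omega>\<bar> \<le> 1 * B" if "\<omega> \<in> space M" "0 \<le> s" for s \<omega>
    unfolding abs_mult using V_bounds[OF that, of l] fb by (intro mult_mono) auto
  have X1: "(LBINT s:{0..t}. (\<integral>\<omega>. W s \<omega> * p t \<omega> \<partial>M)) = (\<integral>\<omega>. integral {0..t} (\<lambda>s. W s \<omega> * p t \<omega>) \<partial>M)"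
    by (rule fubini_continuous(1)[OF t])
      (use t in \<open>auto intro!: borel_measurable_times Wm pm continuous_on_mult Wc continuous_on_const b1\<close>)
  note X2 = fubini_continuous[OF t, of "\<lambda>s \<omega>. W s \<omega> * p s \<omega>" "\<kappa> * 1"]
  have x2: "u \<in> {0..t} \<Longrightarrow> (\<lambda>\<omega>. W u \<omega> * p u \<omega>) \<in> borel_measurable M"
    "\<omega> \<in> space M \<Longrightarrow> continuous_on {0..t} (\<lambda>u. W u \<omega> * p u \<omega>)"
    "u \<in> {0..t} \<Longrightarrow> \<omega> \<in> space M \<Longrightarrow> \<bar>W u \<omega> * p u \<omega>\<bar> \<le> \<kappa> * 1" for u \<omega>
    by (auto intro!: borel_measurable_times Wm pm continuous_on_mult Wc pc) (use b1 in force)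
  note X3 = fubini_continuous[OF t, of "\<lambda>s \<omega>. W s \<omega> * (I t \<omega> - I s \<omega>)" "\<kappa> * (B * t)"]
  have x3: "u \<in> {0..t} \<Longrightarrow> (\<lambda>\<omega>. W u \<omega> * (I t \<omega> - I u \<omega>)) \<in> borel_measurable M"
    "\<omega> \<in> space M \<Longrightarrow> continuous_on {0..t} (\<lambda>u. W u \<omega> * (I t \<omega> - I u \<omega>))"
    "u \<in> {0..t} \<Longrightarrow> \<omega> \<in> space M \<Longrightarrow> \<bar>W u \<omega> * (I t \<omega> - I u \<omega>)\<bar> \<le> \<kappa> * (B * t)" for u \<omega>
    using b3[of \<omega> u] by (auto intro!: borel_measurable_times Wm Im continuous_on_mult continuous_on_diff continuous_on_const Wc Ic)
  note X4 = fubini_continuous[OF t, of "\<lambda>s \<omega>. (V l s \<omega> - 1) * f s \<omega>" "1 * B"]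
  have x4: "u \<in> {0..t} \<Longrightarrow> (\<lambda>\<omega>. (V l u \<omega> - 1) * f u \<omega>) \<in> borel_measurable M"
    "\<omega> \<in> space M \<Longrightarrow> continuous_on {0..t} (\<lambda>u. (V l u \<omega> - 1) * f u \<omega>)"
    "u \<in> {0..t} \<Longrightarrow> \<omega> \<in> space M \<Longrightarrow> \<bar>(V l u \<omega> - 1) * f u \<omega>\<bar> \<le> 1 * B" for u \<omega>
    using b4[of \<omega> u] by (auto intro!: borel_measurable_times borel_measurable_diff V_meas fm continuous_on_mult continuous_on_diff continuous_on_const Vc fc)
  note X5 = fubini_continuous[OF t, of f B]
  have x5: "u \<in> {0..t} \<Longrightarrow> f u \<in> borel_measurable M"
    "\<omega> \<in> space M \<Longrightarrow> continuous_on {0..t} (\<lambda>u. f u \<omega>)"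
    "u \<in> {0..t} \<Longrightarrow> \<omega> \<in> space M \<Longrightarrow> \<bar>f u \<omega>\<bar> \<le> B" for u \<omega>
    using fb[of u \<omega>] by (auto intro!: fm fc)
  \<comment> \<open>\<open>V l t\<close> - 1 is the time integral of W, which brings the expectation
    into the form covered by \<open>step1\<close>.\<close>
  have "(\<integral>\<omega>. (V l t \<omega> - 1) * p t \<omega> \<partial>M) = (\<integral>\<omega>. integral {0..t} (\<lambda>s. W s \<omega> * p t \<omega>) \<partial>M)"
  proof (rule Bochner_Integration.integral_cong[OF refl])
    fix \<omega> assume w: "\<omega> \<in> space M"
    have "integral {0..t} (\<lambda>s. W s \<omega>) = V l t \<omega> - 1"
      using ew(1)[OF w w] unfolding W_def V_def A_def \<kappa>_def .
    then show "(V l t \<omega> - 1) * p t \<omega> = integral {0..t} (\<lambda>s. W s \<omega> * p t \<omega>)" by simp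
  qed
  also have "\<dots> = (LBINT s:{0..t}. (\<integral>\<omega>. W s \<omega> * p s \<omega> \<partial>M) + (\<integral>\<omega>. W s \<omega> * (I t \<omega> - I s \<omega>) \<partial>M))"
    unfolding X1[symmetric] by (rule set_lebesgue_integral_cong) (auto simp: step1)
  also have "\<dots> = (LBINT s:{0..t}. (\<integral>\<omega>. W s \<omega> * p s \<omega> \<partial>M)) + (LBINT s:{0..t}. (\<integral>\<omega>. W s \<omega> * (I t \<omega> - I s \<omega>) \<partial>M))"
    by (rule set_integral_add(2)[OF X2(2)[OF x2] X3(2)[OF x3]])
  also have "(LBINT s:{0..t}. (\<integral>\<omega>. W s \<omega> * (I t \<omega> - I s \<omega>) \<partial>M)) =
      (\<integral>\<omega>. integral {0..t} (\<lambda>s. W s \<omega> * (I t \<omega> - I s \<omega>)) \<partial>M)"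
    by (rule X3(1)[OF x3])
  \<comment> \<open>Integration by parts turns the double time integral into a single one.\<close>
  also have "\<dots> = (\<integral>\<omega>. integral {0..t} (\<lambda>s. (V l s \<omega> - 1) * f s \<omega>) \<partial>M)"
  proof (rule Bochner_Integration.integral_cong[OF refl])
    fix \<omega> assume w: "\<omega> \<in> space M"
    show "integral {0..t} (\<lambda>s. W s \<omega> * (I t \<omega> - I s \<omega>)) = integral {0..t} (\<lambda>s. (V l s \<omega> - 1) * f s \<omega>)"
      using ew(2)[OF w w] unfolding W_def V_def A_def I_def \<kappa>_def .
  qed
  also have "\<dots> = (LBINT s:{0..t}. (\<integral>\<omega>. (V l s \<omega> - 1) * f s \<omega> \<partial>M))"
    by (rule X4(1)[OF x4, symmetric])
  finally have e1: "(\<integral>\<omega>. (V l t \<omega> - 1) * p t \<omega> \<partial>M) = (LBINT s:{0..t}. (\<integral>\<omega>. W s \<omega> * p s \<omega> \<partial>M)) +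
     (LBINT s:{0..t}. (\<integral>\<omega>. (V l s \<omega> - 1) * f s \<omega> \<partial>M))" .
  have "(\<integral>\<omega>. p 0 \<omega> \<partial>M) = (\<integral>\<omega>. 1 \<partial>M)"
    by (rule Bochner_Integration.integral_cong) (simp_all add: p_def Y_start)
  then have e2: "(\<integral>\<omega>. p t \<omega> \<partial>M) - 1 = (LBINT u:{0..t}. (\<integral>\<omega>. f u \<omega> \<partial>M))"
    using mk[of 0 t "\<lambda>_. 1" 1] t by (simp add: prob_space)
  have "integrable M (p t)"
    by (rule integrable_const_bound[of _ 1, OF _ pm[OF t]]) (use pb in auto)
  moreover have "integrable M (\<lambda>\<omega>. V l t \<omega> * p t \<omega>)"
  proof (rule integrable_const_bound[of _ "1 * 1"])
    show "AE \<omega> in M. norm (V l t \<omega> * p t \<omega>) \<le> 1 * 1"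
    proof (rule AE_I2)
      fix \<omega> assume "\<omega> \<in> space M"
      from V_bounds[OF this t, of l] pb[of t \<omega>] show "norm (V l t \<omega> * p t \<omega>) \<le> 1 * 1"
        unfolding real_norm_def abs_mult by (intro mult_mono) auto
    qed
  qed (intro borel_measurable_times V_meas pm t)
  ultimately have "(\<integral>\<omega>. V l t \<omega> * p t \<omega> \<partial>M) = (\<integral>\<omega>. (V l t \<omega> - 1) * p t \<omega> \<partial>M) + (\<integral>\<omega>. p t \<omega> \<partial>M)"
    by (simp add: left_diff_distrib)
  then have "(\<integral>\<omega>. V l t \<omega> * p t \<omega> \<partial>M) - 1 = (LBINT s:{0..t}. (\<integral>\<omega>. W s \<omega> * p s \<omega> \<partial>M)) +
     (LBINT s:{0..t}. (\<integral>\<omega>. (V l s \<omega> - 1) * f s \<omega> \<partial>M)) + (LBINT u:{0..t}. (\<integral>\<omega>. f u \<omega> \<partial>M))"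
    using e1 e2 by simp
  also have "\<dots> = (LBINT s:{0..t}. (\<integral>\<omega>. W s \<omega> * p s \<omega> \<partial>M) + (\<integral>\<omega>. (V l s \<omega> - 1) * f s \<omega> \<partial>M) + (\<integral>\<omega>. f s \<omega> \<partial>M))"
    using X2(2)[OF x2] X4(2)[OF x4] X5(2)[OF x5] by (simp only: set_integral_add)
  also have "\<dots> = (LBINT u:{0..t}. (\<integral>\<omega>. power_drift l k (Y u \<omega>) * V l u \<omega> \<partial>M))"
  proof (rule set_lebesgue_integral_cong)
    show "\<forall>s. s \<in> {0..t} \<longrightarrow> (\<integral>\<omega>. W s \<omega> * p s \<omega> \<partial>M) + (\<integral>\<omega>. (V l s \<omega> - 1) * f s \<omega> \<partial>M) + (\<integral>\<omega>. f s \<omega> \<partial>M)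
      = (\<integral>\<omega>. power_drift l k (Y s \<omega>) * V l s \<omega> \<partial>M)"
    proof (intro allI impI)
      fix s assume s: "s \<in> {0..t}"
      have "(\<integral>\<omega>. W s \<omega> * p s \<omega> \<partial>M) + (\<integral>\<omega>. (V l s \<omega> - 1) * f s \<omega> \<partial>M) + (\<integral>\<omega>. f s \<omega> \<partial>M) =
        (\<integral>\<omega>. W s \<omega> * p s \<omega> + (V l s \<omega> - 1) * f s \<omega> + f s \<omega> \<partial>M)"
        using X2(4)[OF x2 s] X4(4)[OF x4 s] X5(4)[OF x5 s] by simp
      \<comment> \<open>This is the product rule V' p + V f: its first summand supplies the
        potential -(l^2/2)(1-y) by which \<open>power_drift l k\<close> differs from
        \<open>power_drift 0 k\<close>.\<close>
      also have "\<dots> = (\<integral>\<omega>. power_drift l k (Y s \<omega>) * V l s \<omega> \<partial>M)"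
      proof (rule Bochner_Integration.integral_cong[OF refl])
        fix \<omega>
        have "Y s \<omega> > 0" using Y_in[of s \<omega>] by simp
        then show "W s \<omega> * p s \<omega> + (V l s \<omega> - 1) * f s \<omega> + f s \<omega> = power_drift l k (Y s \<omega>) * V l s \<omega>"
          unfolding W_def p_def f_def power_drift_def \<kappa>_def by (simp only: powr_facts(3)) (simp add: field_simps)
      qed
      finally show "(\<integral>\<omega>. W s \<omega> * p s \<omega> \<partial>M) + (\<integral>\<omega>. (V l s \<omega> - 1) * f s \<omega> \<partial>M) + (\<integral>\<omega>. f s \<omega> \<partial>M)
        = (\<integral>\<omega>. power_drift l k (Y s \<omega>) * V l s \<omega> \<partial>M)" .
    qed
  qed simp
  finally show ?thesis by (simp add: p_def mult.commute)
qed

end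

section \<open>Uniqueness for the moment system\<close>

text \<open>By Weierstrass \<phi> is uniformly within e of a polynomial, whose contribution is 0;
  the error is at most e times the L1 norm of g. It is applied once in \<open>lerch\<close> and once
  in \<open>laplace_zero\<close>, there to remove a power of Y.\<close>

lemma moments_zero:
  fixes g X :: "'b \<Rightarrow> real" and \<phi> :: "real \<Rightarrow> real"
  assumes g: "integrable \<mu> g" and X: "X \<in> borel_measurable \<mu>" "\<And>x. x \<in> space \<mu> \<Longrightarrow> X x \<in> {0..1}"
    and zero: "\<And>j. (\<integral>x. X x ^ j * g x \<partial>\<mu>) = 0"
    and \<phi>: "continuous_on {0..1} \<phi>" "(\<lambda>x. \<phi> (X x)) \<in> borel_measurable \<mu>"
  shows "(\<integral>x. \<phi> (X x) * g x \<partial>\<mu>) = 0"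
proof -
  have gm: "g \<in> borel_measurable \<mu>" using g by simp
  define G where "G = (\<integral>x. \<bar>g x\<bar> \<partial>\<mu>)"
  have G0: "0 \<le> G" by (simp add: G_def)
  have ip: "integrable \<mu> (\<lambda>x. X x ^ j * g x)" for j
  proof (rule Bochner_Integration.integrable_bound[OF g])
    show "AE x in \<mu>. norm (X x ^ j * g x) \<le> norm (g x)"
    proof (rule AE_I2)
      fix x assume "x \<in> space \<mu>"
      then have "\<bar>X x ^ j\<bar> * \<bar>g x\<bar> \<le> 1 * \<bar>g x\<bar>"
        using X(2)[of x] by (intro mult_right_mono) (auto simp: power_le_one)
      then show "norm (X x ^ j * g x) \<le> norm (g x)" by (simp add: abs_mult)
    qed
  qed (use X(1) gm in measurable)
  have le: "\<bar>\<integral>x. \<phi> (X x) * g x \<partial>\<mu>\<bar> \<le> e * G" if e: "e > 0" for e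
  proof -
    obtain P where P: "real_polynomial_function P" "\<And>u. u \<in> {0..1} \<Longrightarrow> \<bar>\<phi> u - P u\<bar> < e"
      using Stone_Weierstrass_real_polynomial_function[OF _ \<phi>(1) e] by auto
    then obtain a n where Pe: "P = (\<lambda>u. \<Sum>i\<le>n. a i * u ^ i)" unfolding real_polynomial_function_iff_sum by blast
    have Pg: "P (X x) * g x = (\<Sum>i\<le>n. a i * (X x ^ i * g x))" for x
      by (simp add: Pe sum_distrib_right mult.assoc)
    have iP: "integrable \<mu> (\<lambda>x. P (X x) * g x)" unfolding Pg
      by (intro Bochner_Integration.integrable_sum integrable_mult_right ip)
    have P0: "(\<integral>x. P (X x) * g x \<partial>\<mu>) = 0" unfolding Pg
      by (subst Bochner_Integration.integral_sum) (auto intro!: integrable_mult_right ip simp: zero)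
    have bd: "\<bar>(\<phi> (X x) - P (X x)) * g x\<bar> \<le> e * \<bar>g x\<bar>" if "x \<in> space \<mu>" for x
      unfolding abs_mult using P(2)[OF X(2)[OF that]] by (intro mult_right_mono) auto
    have iD: "integrable \<mu> (\<lambda>x. (\<phi> (X x) - P (X x)) * g x)"
    proof (rule Bochner_Integration.integrable_bound)
      show "integrable \<mu> (\<lambda>x. e * \<bar>g x\<bar>)" using g by simp
      have "(\<lambda>x. P (X x)) \<in> borel_measurable \<mu>" unfolding Pe using X(1) by measurable
      then show "(\<lambda>x. (\<phi> (X x) - P (X x)) * g x) \<in> borel_measurable \<mu>" using \<phi>(2) gm by measurable
      show "AE x in \<mu>. norm ((\<phi> (X x) - P (X x)) * g x) \<le> norm (e * \<bar>g x\<bar>)"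
        unfolding real_norm_def using bd by (intro AE_I2 order_trans[OF bd abs_ge_self])
    qed
    have "(\<integral>x. \<phi> (X x) * g x \<partial>\<mu>) = (\<integral>x. (\<phi> (X x) - P (X x)) * g x + P (X x) * g x \<partial>\<mu>)"
      by (simp add: algebra_simps)
    also have "\<dots> = (\<integral>x. (\<phi> (X x) - P (X x)) * g x \<partial>\<mu>)" using iD iP P0 by simp
    finally have "\<bar>\<integral>x. \<phi> (X x) * g x \<partial>\<mu>\<bar> \<le> (\<integral>x. \<bar>(\<phi> (X x) - P (X x)) * g x\<bar> \<partial>\<mu>)"
      by (simp only: integral_abs_bound)
    also have "\<dots> \<le> (\<integral>x. e * \<bar>g x\<bar> \<partial>\<mu>)" using iD g bd by (intro integral_mono) auto
    finally show ?thesis by (simp add: G_def)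
  qed
  have "\<bar>\<integral>x. \<phi> (X x) * g x \<partial>\<mu>\<bar> \<le> 0"
  proof (rule field_le_epsilon)
    fix e :: real assume e: "e > 0"
    \<comment> \<open>G may be 0, hence the division by G + 1.\<close>
    have "\<bar>\<integral>x. \<phi> (X x) * g x \<partial>\<mu>\<bar> \<le> e / (G + 1) * G" using e G0 by (intro le) simp
    also have "\<dots> \<le> e" using e G0 by (simp add: field_simps)
    finally show "\<bar>\<integral>x. \<phi> (X x) * g x \<partial>\<mu>\<bar> \<le> 0 + e" by simp
  qed
  then show ?thesis by simp
qed

section \<open>Laplace transforms and Lerch's theorem\<close>

definition laplace :: "real \<Rightarrow> (real \<Rightarrow> real) \<Rightarrow> real" where
  "laplace \<alpha> f = (LBINT t. indicator {0..} t * (exp (- \<alpha> * t) * f t))"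

lemma exp_integrable:
  fixes \<alpha> :: real
  assumes "\<alpha> > 0" shows "integrable lborel (\<lambda>t. indicator {0..} t * exp (- \<alpha> * t))"
proof -
  interpret P: prob_space "density lborel (exponential_density \<alpha>)" by (rule prob_space_exponential_density[OF assms])
  have "integrable (density lborel (exponential_density \<alpha>)) (\<lambda>t. 1 / \<alpha> :: real)" by simp
  then have "integrable lborel (\<lambda>t. exponential_density \<alpha> t *\<^sub>R (1 / \<alpha>))"
    by (subst (asm) integrable_density) (use assms in \<open>auto simp: erlang_density_def\<close>)
  also have "(\<lambda>t. exponential_density \<alpha> t *\<^sub>R (1 / \<alpha>)) = (\<lambda>t. indicator {0..} t * exp (- \<alpha> * t))"
    using assms by (auto simp: exponential_density_def fun_eq_iff mult.commute)
  finally show ?thesis .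
qed

lemma laplace_integrable:
  fixes \<alpha> :: real
  assumes "\<alpha> > 0" "(\<lambda>t. indicator {0..} t * f t) \<in> borel_measurable borel" "\<And>t. t \<ge> 0 \<Longrightarrow> \<bar>f t\<bar> \<le> C"
  shows "integrable lborel (\<lambda>t. indicator {0..} t * (exp (- \<alpha> * t) * f t))"
proof (rule Bochner_Integration.integrable_bound)
  show "integrable lborel (\<lambda>t. (indicator {0..} t * exp (- \<alpha> * t)) * C)"
    using exp_integrable[OF assms(1)] by (rule integrable_mult_left)
  have "(\<lambda>t. exp (- \<alpha> * t) * (indicator {0..} t * f t)) \<in> borel_measurable borel"
    using assms(2) by measurable
  then show "(\<lambda>t. indicator {0..} t * (exp (- \<alpha> * t) * f t)) \<in> borel_measurable lborel"
    by (simp add: mult.left_commute)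
  show "AE t in lborel. norm (indicator {0..} t * (exp (- \<alpha> * t) * f t)) \<le> norm (indicator {0..} t * exp (- \<alpha> * t) * C)"
  proof (rule AE_I2)
    fix t :: real
    show "norm (indicator {0..} t * (exp (- \<alpha> * t) * f t)) \<le> norm (indicator {0..} t * exp (- \<alpha> * t) * C)"
      using order_trans[OF assms(3)[of t] abs_ge_self] by (cases "t \<ge> 0") (auto simp: abs_mult)
  qed
qed

lemma halfline_measurable: "continuous_on {0..} f \<Longrightarrow> (\<lambda>t::real. indicator {0..} t * f t) \<in> borel_measurable borel"
  for f :: "real \<Rightarrow> real"
  using borel_measurable_continuous_on_indicator[of "{0..}" f] by simp

text \<open>Connects the Lebesgue integral over the half-line with integrals over bounded intervals,
  on which integration by parts is carried out.\<close>

lemma laplace_limit: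
  assumes \<alpha>: "\<alpha> > 0" and f: "continuous_on {0..} f" and C: "\<And>t. t \<ge> 0 \<Longrightarrow> \<bar>f t\<bar> \<le> C"
  shows "(\<lambda>n. integral {0..real n} (\<lambda>t. exp (- \<alpha> * t) * f t)) \<longlonglongrightarrow> laplace \<alpha> f"
proof -
  have i: "integrable lborel (\<lambda>t. indicator {0..} t * (exp (- \<alpha> * t) * f t))"
    by (rule laplace_integrable[OF \<alpha> halfline_measurable[OF f] C])
  have c: "continuous_on {0..real n} (\<lambda>t. exp (- \<alpha> * t) * f t)" for n
    by (intro continuous_intros continuous_on_subset[OF f]) auto
  have eq: "integral {0..real n} (\<lambda>t. exp (- \<alpha> * t) * f t) = (LBINT t. indicator {0..real n} t * (exp (- \<alpha> * t) * f t))" for n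
    using lborel_integral_continuous(1)[OF c] by (simp add: set_lebesgue_integral_def)
  show ?thesis unfolding eq laplace_def
  proof (rule integral_dominated_convergence[where w = "\<lambda>t. \<bar>indicator {0..} t * (exp (- \<alpha> * t) * f t)\<bar>"])
    show "integrable lborel (\<lambda>t. \<bar>indicator {0..} t * (exp (- \<alpha> * t) * f t)\<bar>)" using i by simp
    show "(\<lambda>t. indicator {0..} t * (exp (- \<alpha> * t) * f t)) \<in> borel_measurable lborel" using i by simp
    show "(\<lambda>t. indicator {0..real n} t * (exp (- \<alpha> * t) * f t)) \<in> borel_measurable lborel" for n
      using lborel_integral_continuous(2)[OF c[of n]] unfolding set_integrable_def by simp
    show "AE t in lborel. (\<lambda>n. indicator {0..real n} t * (exp (- \<alpha> * t) * f t)) \<longlonglongrightarrow> indicator {0..} t * (exp (- \<alpha> * t) * f t)"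
    proof (rule AE_I2)
      fix t :: real
      have "\<forall>\<^sub>F n in sequentially. indicator {0..} t * (exp (- \<alpha> * t) * f t) = indicator {0..real n} t * (exp (- \<alpha> * t) * f t)"
        using eventually_ge_at_top[of "nat \<lceil>t\<rceil>"]
        by eventually_elim (auto simp: indicator_def nat_le_iff ceiling_le_iff)
      then show "(\<lambda>n. indicator {0..real n} t * (exp (- \<alpha> * t) * f t)) \<longlonglongrightarrow> indicator {0..} t * (exp (- \<alpha> * t) * f t)"
        by (rule Lim_transform_eventually[OF tendsto_const])
    qed
    show "AE t in lborel. norm (indicator {0..real n} t * (exp (- \<alpha> * t) * f t)) \<le> \<bar>indicator {0..} t * (exp (- \<alpha> * t) * f t)\<bar>" for n
      by (intro AE_I2) (auto simp: indicator_def)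
  qed
qed

text \<open>With u = exp(-s) the Laplace transform at j + 1 is the j-th moment of u under exp(-s)
  b(s) ds. The function \<phi>(u) = u b(-ln u), continuous on [0, 1] thanks to the factor u, equals
  exp(-s) b(s) again, so the square of exp(-s) b(s) has integral 0.\<close>

lemma lerch:
  assumes b: "continuous_on {0..} b" and C: "\<And>t. t \<ge> 0 \<Longrightarrow> \<bar>b t\<bar> \<le> C"
    and zero: "\<And>\<alpha>. \<alpha> > 0 \<Longrightarrow> laplace \<alpha> b = 0" and t: "t \<ge> 0"
  shows "b t = (0 :: real)"
proof -
  define \<phi> where "\<phi> u = (if u \<le> 0 then 0 else u * b (- ln u))" for u :: real
  \<comment> \<open>\<open>max s 0\<close> keeps X in [0, 1] for negative s as well, where g
    vanishes.\<close>
  define X where "X s = exp (- max s 0)" for s :: real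
  define g where "g s = indicator {0..} s * (exp (- 1 * s) * b s)" for s :: real
  have C0: "0 \<le> C" using C[of 0] by linarith
  have c\<phi>: "continuous_on {0..1} \<phi>"
    unfolding continuous_on_eq_continuous_within
  proof
    fix u :: real assume u: "u \<in> {0..1}"
    show "continuous (at u within {0..1}) \<phi>"
    proof (cases "u = 0")
      case False
      have "continuous_on {0<..1} (\<lambda>u. u * b (- ln u))"
        by (intro continuous_intros continuous_on_compose2[OF b]) auto
      then have "continuous_on {0<..1} \<phi>" by (rule continuous_on_eq) (simp add: \<phi>_def)
      then have "continuous (at u within {0<..1}) \<phi>" using u False by (simp add: continuous_on_eq_continuous_within)
      moreover have "at u within {0<..1} = at u within {0..1}"
        using u False by (intro at_within_nhd[of _ "{0<..}"]) auto
      ultimately show ?thesis by (simp add: continuous_within)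
    next
      case True
      have "(\<phi> \<longlongrightarrow> 0) (at 0 within {0..1})"
      proof (rule Lim_null_comparison)
        show "\<forall>\<^sub>F u in at 0 within {0..1}. norm (\<phi> u) \<le> C * u"
        proof (rule eventually_at_topological[THEN iffD2], intro exI[of _ UNIV] conjI ballI impI)
          fix u :: real assume "u \<noteq> 0" "u \<in> {0..1}"
          then have u: "0 < u" "u \<le> 1" by auto
          then have "\<bar>b (- ln u)\<bar> \<le> C" by (intro C) simp
          then show "norm (\<phi> u) \<le> C * u" using u by (simp add: \<phi>_def abs_mult mult.commute)
        qed auto
        show "((\<lambda>u. C * u) \<longlongrightarrow> 0) (at 0 within {0..1})" by (auto intro!: tendsto_eq_intros)
      qed
      then show ?thesis using True by (simp add: continuous_within \<phi>_def[of 0])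
    qed
  qed
  have Xm: "X \<in> borel_measurable lborel" unfolding X_def[abs_def] by simp
  have X01: "X s \<in> {0..1}" for s unfolding X_def by simp
  have "(\<lambda>u. indicator {0..1} u *\<^sub>R \<phi> u) \<in> borel_measurable borel"
    by (rule borel_measurable_continuous_on_indicator[OF _ c\<phi>]) simp
  from measurable_compose[OF Xm this]
  have \<phi>m: "(\<lambda>s. \<phi> (X s)) \<in> borel_measurable lborel" using X01 by simp
  have \<phi>X: "\<phi> (X s) = exp (- s) * b s" if "s \<ge> 0" for s
    using that by (simp add: \<phi>_def X_def)
  have gi: "integrable lborel g" unfolding g_def[abs_def]
    by (rule laplace_integrable[OF _ halfline_measurable[OF b] C]) simp
  have "(\<integral>s. X s ^ j * g s \<partial>lborel) = laplace (real (Suc j)) b" for j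
    unfolding laplace_def
  proof (rule Bochner_Integration.integral_cong[OF refl])
    fix s :: real
    show "X s ^ j * g s = indicator {0..} s * (exp (- real (Suc j) * s) * b s)"
    proof (cases "s \<ge> 0")
      case True
      have "X s ^ j * exp (- s) = exp (- real (Suc j) * s)"
        using True by (simp add: X_def exp_of_nat_mult[symmetric] exp_add[symmetric] algebra_simps)
      then show ?thesis using True by (simp add: g_def)
    qed (simp add: g_def)
  qed
  then have "(\<integral>s. X s ^ j * g s \<partial>lborel) = 0" for j using zero by simp
  from moments_zero[OF gi Xm X01 this c\<phi> \<phi>m]
  have z: "(\<integral>s. \<phi> (X s) * g s \<partial>lborel) = 0" .
  \<comment> \<open>The interval reaches beyond t so that it is nondegenerate also for t =
    0.\<close>
  define T where "T = t + 1"
  have T: "0 < T" "t \<in> {0..T}" using t by (auto simp: T_def)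
  have bT: "continuous_on {0..T} b" by (rule continuous_on_subset[OF b]) auto
  have ceb: "continuous_on {0..T} (\<lambda>s. (exp (- s) * b s)\<^sup>2)" by (intro continuous_intros bT)
  have i\<phi>: "integrable lborel (\<lambda>s. \<phi> (X s) * g s)"
  proof (rule Bochner_Integration.integrable_bound)
    show "integrable lborel (\<lambda>s. C * g s)" using gi by simp
    show "(\<lambda>s. \<phi> (X s) * g s) \<in> borel_measurable lborel" using \<phi>m borel_measurable_integrable[OF gi] by measurable
    show "AE s in lborel. norm (\<phi> (X s) * g s) \<le> norm (C * g s)"
    proof (rule AE_I2)
      fix s
      have "\<bar>\<phi> (X s)\<bar> * \<bar>g s\<bar> \<le> C * \<bar>g s\<bar>"
      proof (cases "s \<ge> 0")
        case True
        have "\<bar>exp (- s) * b s\<bar> \<le> 1 * C" unfolding abs_mult using C[OF True] True by (intro mult_mono) auto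
        then show ?thesis unfolding \<phi>X[OF True] by (intro mult_right_mono) auto
      qed (simp add: g_def)
      then show "norm (\<phi> (X s) * g s) \<le> norm (C * g s)" using C0 by (simp add: abs_mult)
    qed
  qed
  have "integral {0..T} (\<lambda>s. (exp (- s) * b s)\<^sup>2) = (LBINT s. indicator {0..T} s * (exp (- s) * b s)\<^sup>2)"
    using lborel_integral_continuous(1)[OF ceb] by (simp add: set_lebesgue_integral_def)
  also have "\<dots> \<le> (\<integral>s. \<phi> (X s) * g s \<partial>lborel)"
  proof (rule integral_mono)
    show "integrable lborel (\<lambda>s. indicator {0..T} s * (exp (- s) * b s)\<^sup>2)"
      using lborel_integral_continuous(2)[OF ceb] by (simp add: set_integrable_def)
    fix s
    show "indicator {0..T} s * (exp (- s) * b s)\<^sup>2 \<le> \<phi> (X s) * g s"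
    proof (cases "s \<ge> 0")
      case True
      have "\<phi> (X s) * g s = (exp (- s) * b s)\<^sup>2"
        using True by (simp add: \<phi>X g_def power2_eq_square)
      then show ?thesis by (simp add: indicator_def)
    qed (simp add: g_def)
  qed (rule i\<phi>)
  finally have "integral {0..T} (\<lambda>s. (exp (- s) * b s)\<^sup>2) \<le> 0" using z by simp
  moreover have "0 \<le> integral {0..T} (\<lambda>s. (exp (- s) * b s)\<^sup>2)"
    by (intro Henstock_Kurzweil_Integration.integral_nonneg integrable_continuous_real ceb) auto
  ultimately have "integral {0..T} (\<lambda>s. (exp (- s) * b s)\<^sup>2) = 0" by simp
  then have "(exp (- t) * b t)\<^sup>2 = 0"
    using integral_eq_0_iff[OF ceb T(1)] T(2) by simp
  then show ?thesis by simp
qed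

lemma joint_measurable_halfline:
  fixes X :: "real \<Rightarrow> 'b \<Rightarrow> real"
  assumes "\<And>u. 0 \<le> u \<Longrightarrow> X u \<in> borel_measurable N"
    and "\<And>\<omega>. \<omega> \<in> space N \<Longrightarrow> continuous_on {0..} (\<lambda>u. X u \<omega>)"
  shows "(\<lambda>(u, \<omega>). indicator {0..} u * X u \<omega>) \<in> borel_measurable (lborel \<Otimes>\<^sub>M N)"
proof (rule borel_measurable_LIMSEQ_real)
  show "(\<lambda>(u, \<omega>). indicator {0..real n} u * X u \<omega>) \<in> borel_measurable (lborel \<Otimes>\<^sub>M N)" for n
    by (rule joint_measurable[OF _ _ continuous_on_subset[OF assms(2)]]) (use assms(1) in auto)
  fix p :: "real \<times> 'b"
  have "\<forall>\<^sub>F n in sequentially. indicator {0..} (fst p) * X (fst p) (snd p) = indicator {0..real n} (fst p) * X (fst p) (snd p)"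
    using eventually_ge_at_top[of "nat \<lceil>fst p\<rceil>"]
    by eventually_elim (auto simp: indicator_def nat_le_iff ceiling_le_iff)
  from Lim_transform_eventually[OF tendsto_const this]
  show "(\<lambda>n. case p of (u, \<omega>) \<Rightarrow> indicator {0..real n} u * X u \<omega>) \<longlonglongrightarrow> (case p of (u, \<omega>) \<Rightarrow> indicator {0..} u * X u \<omega>)"
    by (simp add: split_beta')
qed

lemma (in prob_space) fubini_laplace:
  fixes X :: "real \<Rightarrow> 'a \<Rightarrow> real"
  assumes \<alpha>: "\<alpha> > 0" and m: "\<And>u. 0 \<le> u \<Longrightarrow> X u \<in> borel_measurable M"
    and c: "\<And>\<omega>. \<omega> \<in> space M \<Longrightarrow> continuous_on {0..} (\<lambda>u. X u \<omega>)"
    and B: "\<And>u \<omega>. 0 \<le> u \<Longrightarrow> \<omega> \<in> space M \<Longrightarrow> \<bar>X u \<omega>\<bar> \<le> B"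
  shows "integrable (lborel \<Otimes>\<^sub>M M) (\<lambda>p. indicator {0..} (fst p) * (exp (- \<alpha> * fst p) * X (fst p) (snd p)))"
    and "(\<integral>p. indicator {0..} (fst p) * (exp (- \<alpha> * fst p) * X (fst p) (snd p)) \<partial>(lborel \<Otimes>\<^sub>M M)) =
      laplace \<alpha> (\<lambda>t. \<integral>\<omega>. X t \<omega> \<partial>M)"
proof -
  interpret P: pair_sigma_finite lborel M ..
  have "(\<lambda>p. exp (- \<alpha> * fst p) * (case p of (u, \<omega>) \<Rightarrow> indicator {0..} u * X u \<omega>)) \<in> borel_measurable (lborel \<Otimes>\<^sub>M M)"
    using joint_measurable_halfline[OF m c] by measurable
  then have jm: "(\<lambda>p. indicator {0..} (fst p) * (exp (- \<alpha> * fst p) * X (fst p) (snd p))) \<in> borel_measurable (lborel \<Otimes>\<^sub>M M)"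
    by (simp add: split_beta' mult.left_commute)
  have ei: "integrable (lborel \<Otimes>\<^sub>M M) (\<lambda>p :: real \<times> 'a. (indicator {0..} (fst p) * exp (- \<alpha> * fst p)) * \<bar>B\<bar>)"
  proof (rule integrable_mult_left)
    show "integrable (lborel \<Otimes>\<^sub>M M) (\<lambda>p :: real \<times> 'a. indicator {0..} (fst p) * exp (- \<alpha> * fst p))"
      by (rule P.Fubini_integrable) (use exp_integrable[OF \<alpha>] in \<open>simp_all add: abs_mult prob_space\<close>)
  qed
  show i: "integrable (lborel \<Otimes>\<^sub>M M) (\<lambda>p. indicator {0..} (fst p) * (exp (- \<alpha> * fst p) * X (fst p) (snd p)))"
  proof (rule Bochner_Integration.integrable_bound[OF ei jm], rule AE_I2)
    fix p :: "real \<times> 'a" assume "p \<in> space (lborel \<Otimes>\<^sub>M M)"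
    then have s: "snd p \<in> space M" by (auto simp: space_pair_measure)
    show "norm (indicator {0..} (fst p) * (exp (- \<alpha> * fst p) * X (fst p) (snd p))) \<le>
      norm (indicator {0..} (fst p) * exp (- \<alpha> * fst p) * \<bar>B\<bar>)"
      using order_trans[OF B[OF _ s, of "fst p"] abs_ge_self] by (cases "0 \<le> fst p") (auto simp: abs_mult)
  qed
  have "(\<integral>p. indicator {0..} (fst p) * (exp (- \<alpha> * fst p) * X (fst p) (snd p)) \<partial>(lborel \<Otimes>\<^sub>M M)) =
    (\<integral>u. (\<integral>\<omega>. indicator {0..} u * (exp (- \<alpha> * u) * X u \<omega>) \<partial>M) \<partial>lborel)"
    using P.integral_fst'[OF i] by simp
  also have "\<dots> = laplace \<alpha> (\<lambda>t. \<integral>\<omega>. X t \<omega> \<partial>M)" unfolding laplace_def by simp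
  finally show "(\<integral>p. indicator {0..} (fst p) * (exp (- \<alpha> * fst p) * X (fst p) (snd p)) \<partial>(lborel \<Otimes>\<^sub>M M)) =
      laplace \<alpha> (\<lambda>t. \<integral>\<omega>. X t \<omega> \<partial>M)" .
qed

section \<open>The recursion in the exponent\<close>

context sl2bm begin

lemma Y_meas: "0 \<le> t \<Longrightarrow> Y t \<in> borel_measurable M"
  using bcont_meas[OF bcont_of_y[of "\<lambda>y. y" 1]] by (simp add: continuous_on_id)

lemma Y_nonzero: "Y t \<omega> \<noteq> 0" using Y_in[of t \<omega>] by simp

text \<open>D stands for the difference of two solutions bounded by 1 with equal initial values:
  hence the bound 2 and the absence of an initial term in \<open>fwd\<close>.\<close>

context
  fixes l :: real and D :: "real \<Rightarrow> 'a \<Rightarrow> real"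
  assumes Dm: "\<And>t. 0 \<le> t \<Longrightarrow> D t \<in> borel_measurable M"
    and Dc: "\<And>\<omega>. \<omega> \<in> space M \<Longrightarrow> continuous_on {0..} (\<lambda>t. D t \<omega>)"
    and Db: "\<And>t \<omega>. 0 \<le> t \<Longrightarrow> \<omega> \<in> space M \<Longrightarrow> \<bar>D t \<omega>\<bar> \<le> 2"
    and fwd: "\<And>k t. 0 \<le> k \<Longrightarrow> 0 \<le> t \<Longrightarrow>
      (\<integral>\<omega>. Y t \<omega> powr k * D t \<omega> \<partial>M) = (LBINT u:{0..t}. (\<integral>\<omega>. power_drift l k (Y u \<omega>) * D u \<omega> \<partial>M))"
begin

lemma weighted_D:
  assumes g: "continuous_on {0<..1} g" "\<And>y. y \<in> {0<..1} \<Longrightarrow> \<bar>g y\<bar> \<le> B"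
  shows "0 \<le> t \<Longrightarrow> (\<lambda>\<omega>. g (Y t \<omega>) * D t \<omega>) \<in> borel_measurable M"
    "\<omega> \<in> space M \<Longrightarrow> continuous_on {0..} (\<lambda>t. g (Y t \<omega>) * D t \<omega>)"
    "0 \<le> t \<Longrightarrow> \<omega> \<in> space M \<Longrightarrow> \<bar>g (Y t \<omega>) * D t \<omega>\<bar> \<le> B * 2"
    "0 \<le> t \<Longrightarrow> integrable M (\<lambda>\<omega>. g (Y t \<omega>) * D t \<omega>)"
    "0 \<le> t \<Longrightarrow> \<bar>\<integral>\<omega>. g (Y t \<omega>) * D t \<omega> \<partial>M\<bar> \<le> B * 2"
    "continuous_on {0..} (\<lambda>t. \<integral>\<omega>. g (Y t \<omega>) * D t \<omega> \<partial>M)"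
proof -
  note bcont = bcont_of_y[OF g]
  show m: "(\<lambda>\<omega>. g (Y t \<omega>) * D t \<omega>) \<in> borel_measurable M" if "0 \<le> t" for t
    using bcont_meas[OF bcont that] Dm[OF that] by (rule borel_measurable_times)
  show c: "continuous_on {0..} (\<lambda>t. g (Y t \<omega>) * D t \<omega>)" if "\<omega> \<in> space M" for \<omega>
    using bcont_cont[OF bcont that] Dc[OF that] by (rule continuous_on_mult)
  have B0: "0 \<le> B" using g(2)[of 1] by auto
  show b: "\<bar>g (Y t \<omega>) * D t \<omega>\<bar> \<le> B * 2" if "0 \<le> t" "\<omega> \<in> space M" for t \<omega>
    unfolding abs_mult using g(2)[OF Y_in] Db[OF that] B0 by (intro mult_mono) auto
  show i: "integrable M (\<lambda>\<omega>. g (Y t \<omega>) * D t \<omega>)" if "0 \<le> t" for t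
    by (rule integrable_const_bound[of _ "B * 2", OF _ m[OF that]]) (use b[OF that] in auto)
  show "0 \<le> t \<Longrightarrow> \<bar>\<integral>\<omega>. g (Y t \<omega>) * D t \<omega> \<partial>M\<bar> \<le> B * 2"
    by (rule abs_expectation_le[OF i b])
  show "continuous_on {0..} (\<lambda>t. \<integral>\<omega>. g (Y t \<omega>) * D t \<omega> \<partial>M)"
    unfolding continuous_on_sequentially comp_def
  proof (intro allI ballI impI, elim conjE)
    fix x :: "nat \<Rightarrow> real" and a assume a: "a \<in> {0..}" and x: "\<forall>n. x n \<in> {0..}" "x \<longlonglongrightarrow> a"
    show "(\<lambda>n. \<integral>\<omega>. g (Y (x n) \<omega>) * D (x n) \<omega> \<partial>M) \<longlonglongrightarrow> (\<integral>\<omega>. g (Y a \<omega>) * D a \<omega> \<partial>M)"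
    proof (rule integral_dominated_convergence[where w = "\<lambda>_. B * 2"])
      show "AE \<omega> in M. (\<lambda>n. g (Y (x n) \<omega>) * D (x n) \<omega>) \<longlonglongrightarrow> g (Y a \<omega>) * D a \<omega>"
      proof (rule AE_I2)
        fix \<omega> assume w: "\<omega> \<in> space M"
        show "(\<lambda>n. g (Y (x n) \<omega>) * D (x n) \<omega>) \<longlonglongrightarrow> g (Y a \<omega>) * D a \<omega>"
          using continuous_on_tendsto_compose[OF c[OF w] x(2) a] x(1) by simp
      qed
    qed (use m a x b in auto)
  qed
qed

definition power_moment :: "real \<Rightarrow> real \<Rightarrow> real" where "power_moment k t = (\<integral>\<omega>. Y t \<omega> powr k * D t \<omega> \<partial>M)"

lemma power_moment_facts:
  assumes "k \<ge> 0"
  shows "continuous_on {0..} (power_moment k)" "t \<ge> 0 \<Longrightarrow> \<bar>power_moment k t\<bar> \<le> 2"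
    "t \<ge> 0 \<Longrightarrow> (\<integral>\<omega>. power_drift l k (Y t \<omega>) * D t \<omega> \<partial>M) =
       (1/2) * ((k\<^sup>2 - k - l\<^sup>2) * power_moment k t - (k\<^sup>2 - l\<^sup>2) * power_moment (k + 1) t)"
proof -
  have b: "\<bar>y powr k\<bar> \<le> 1" if "y \<in> {0<..1}" "k \<ge> 0" for y k :: real
    using powr_le_one[of y k] that by simp
  note w = weighted_D[OF powr_continuous b[OF _ assms]]
  have k1: "k + 1 \<ge> 0" using assms by simp
  note w1 = weighted_D[OF powr_continuous b[OF _ k1]]
  show "continuous_on {0..} (power_moment k)" unfolding power_moment_def[abs_def] by (rule w(6))
  show "t \<ge> 0 \<Longrightarrow> \<bar>power_moment k t\<bar> \<le> 2" unfolding power_moment_def by (rule order_trans[OF w(5)[of t]]) auto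
  show "(\<integral>\<omega>. power_drift l k (Y t \<omega>) * D t \<omega> \<partial>M) =
       (1/2) * ((k\<^sup>2 - k - l\<^sup>2) * power_moment k t - (k\<^sup>2 - l\<^sup>2) * power_moment (k + 1) t)" if "t \<ge> 0"
  proof -
    have i0: "integrable M (\<lambda>\<omega>. Y t \<omega> powr k * D t \<omega>)" by (rule w(4)) (use that in auto)
    have i1: "integrable M (\<lambda>\<omega>. Y t \<omega> powr (k + 1) * D t \<omega>)" by (rule w1(4)) (use that in auto)
    have "(\<integral>\<omega>. power_drift l k (Y t \<omega>) * D t \<omega> \<partial>M) =
      (\<integral>\<omega>. (1/2) * (k\<^sup>2 - k - l\<^sup>2) * (Y t \<omega> powr k * D t \<omega>) - (1/2) * (k\<^sup>2 - l\<^sup>2) * (Y t \<omega> powr (k + 1) * D t \<omega>) \<partial>M)"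
      by (rule Bochner_Integration.integral_cong) (simp_all add: power_drift_def field_simps)
    also have "\<dots> = (1/2) * (k\<^sup>2 - k - l\<^sup>2) * power_moment k t - (1/2) * (k\<^sup>2 - l\<^sup>2) * power_moment (k + 1) t"
      unfolding power_moment_def using i0 i1
      by (subst Bochner_Integration.integral_diff) (auto intro!: integrable_mult_right)
    finally show ?thesis by (simp add: algebra_simps)
  qed
qed

text \<open>Integration by parts against exp(-\<alpha> t). There is no boundary term at 0, where the
  moment vanishes by the equation in integral form, and none at infinity, where the moment stays
  bounded.\<close>

lemma laplace_recursion:
  assumes k: "k \<ge> 0" and \<alpha>: "\<alpha> > 0"
  shows "((1/2) * (k\<^sup>2 - k - l\<^sup>2) - \<alpha>) * laplace \<alpha> (power_moment k) = (1/2) * (k\<^sup>2 - l\<^sup>2) * laplace \<alpha> (power_moment (k + 1))"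
proof -
  have k1: "k + 1 \<ge> 0" using k by simp
  note f = power_moment_facts[OF k] and f1 = power_moment_facts[OF k1]
  define c where "c t = (1/2) * ((k\<^sup>2 - k - l\<^sup>2) * power_moment k t - (k\<^sup>2 - l\<^sup>2) * power_moment (k + 1) t)" for t
  have sub: "{0..T} \<subseteq> {0..}" for T :: real by auto
  note fc = continuous_on_subset[OF f(1) sub] and f1c = continuous_on_subset[OF f1(1) sub]
  have cc: "continuous_on {0..T} c" for T unfolding c_def by (intro continuous_intros fc f1c)
  have bint: "power_moment k t = integral {0..t} c" if "t \<ge> 0" for t
  proof -
    have "power_moment k t = (LBINT u:{0..t}. (\<integral>\<omega>. power_drift l k (Y u \<omega>) * D u \<omega> \<partial>M))"
      unfolding power_moment_def by (rule fwd[OF k that])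
    also have "\<dots> = (LBINT u:{0..t}. c u)"
      by (rule set_lebesgue_integral_cong) (auto simp: f(3) c_def)
    finally show ?thesis unfolding lborel_integral_continuous(1)[OF cc] .
  qed
  have parts: "((1/2) * (k\<^sup>2 - k - l\<^sup>2) - \<alpha>) * integral {0..T} (\<lambda>t. exp (- \<alpha> * t) * power_moment k t) -
     (1/2) * (k\<^sup>2 - l\<^sup>2) * integral {0..T} (\<lambda>t. exp (- \<alpha> * t) * power_moment (k + 1) t) = exp (- \<alpha> * T) * power_moment k T"
    if T: "T \<ge> 0" for T
  proof -
    have "((\<lambda>t. exp (- \<alpha> * t) * integral {0..t} c) has_real_derivative
       exp (- \<alpha> * t) * (- \<alpha>) * integral {0..t} c + c t * exp (- \<alpha> * t)) (at t within {0..T})" if "t \<in> {0..T}" for t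
      by (rule DERIV_mult[OF _ integral_has_real_derivative[OF cc that]])
        (auto intro!: derivative_eq_intros)
    then have "((\<lambda>t. exp (- \<alpha> * t) * (- \<alpha>) * integral {0..t} c + c t * exp (- \<alpha> * t)) has_integral
       (exp (- \<alpha> * T) * integral {0..T} c - exp (- \<alpha> * 0) * integral {0..0} c)) {0..T}"
      by (intro fundamental_theorem_of_calculus T) (simp add: has_real_derivative_iff_has_vector_derivative)
    from integral_unique[OF this]
    have "exp (- \<alpha> * T) * power_moment k T = integral {0..T} (\<lambda>t. exp (- \<alpha> * t) * (- \<alpha>) * integral {0..t} c + c t * exp (- \<alpha> * t))"
      using bint[OF T] by simp
    also have "\<dots> = integral {0..T} (\<lambda>t. ((1/2) * (k\<^sup>2 - k - l\<^sup>2) - \<alpha>) * (exp (- \<alpha> * t) * power_moment k t) -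
       (1/2) * (k\<^sup>2 - l\<^sup>2) * (exp (- \<alpha> * t) * power_moment (k + 1) t))"
    proof (rule Henstock_Kurzweil_Integration.integral_cong)
      fix t assume "t \<in> {0..T}"
      then have "integral {0..t} c = power_moment k t" using bint[of t] by simp
      then show "exp (- \<alpha> * t) * (- \<alpha>) * integral {0..t} c + c t * exp (- \<alpha> * t) =
        ((1/2) * (k\<^sup>2 - k - l\<^sup>2) - \<alpha>) * (exp (- \<alpha> * t) * power_moment k t) - (1/2) * (k\<^sup>2 - l\<^sup>2) * (exp (- \<alpha> * t) * power_moment (k + 1) t)"
        unfolding c_def by (simp add: algebra_simps)
    qed
    also have "\<dots> = integral {0..T} (\<lambda>t. ((1/2) * (k\<^sup>2 - k - l\<^sup>2) - \<alpha>) * (exp (- \<alpha> * t) * power_moment k t)) -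
       integral {0..T} (\<lambda>t. (1/2) * (k\<^sup>2 - l\<^sup>2) * (exp (- \<alpha> * t) * power_moment (k + 1) t))"
      by (intro Henstock_Kurzweil_Integration.integral_diff integrable_continuous_real continuous_intros fc f1c)
    finally show ?thesis by simp
  qed
  have "(\<lambda>n. exp (- \<alpha> * real n) * power_moment k (real n)) \<longlonglongrightarrow> 0"
  proof (rule Lim_null_comparison)
    show "\<forall>\<^sub>F n in sequentially. norm (exp (- \<alpha> * real n) * power_moment k (real n)) \<le> exp (- \<alpha> * real n) * 2"
      using f(2) by (intro always_eventually allI) (simp add: abs_mult)
    show "(\<lambda>n. exp (- \<alpha> * real n) * 2) \<longlonglongrightarrow> 0" using \<alpha> by real_asymp
  qed
  moreover have "(\<lambda>n. ((1/2) * (k\<^sup>2 - k - l\<^sup>2) - \<alpha>) * integral {0..real n} (\<lambda>t. exp (- \<alpha> * t) * power_moment k t) -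
     (1/2) * (k\<^sup>2 - l\<^sup>2) * integral {0..real n} (\<lambda>t. exp (- \<alpha> * t) * power_moment (k + 1) t)) \<longlonglongrightarrow>
    ((1/2) * (k\<^sup>2 - k - l\<^sup>2) - \<alpha>) * laplace \<alpha> (power_moment k) - (1/2) * (k\<^sup>2 - l\<^sup>2) * laplace \<alpha> (power_moment (k + 1))"
    by (intro tendsto_diff tendsto_mult tendsto_const laplace_limit[OF \<alpha> f(1) f(2)] laplace_limit[OF \<alpha> f1(1) f1(2)])
  ultimately have "((1/2) * (k\<^sup>2 - k - l\<^sup>2) - \<alpha>) * laplace \<alpha> (power_moment k) - (1/2) * (k\<^sup>2 - l\<^sup>2) * laplace \<alpha> (power_moment (k + 1)) = 0"
    unfolding parts[OF of_nat_0_le_iff] by (rule LIMSEQ_unique[rotated])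
  then show ?thesis by simp
qed

text \<open>Vanishing propagates from \<kappa> + 1 upwards because k^2 - l^2 stays positive. Under
  the product of exp(-\<alpha> t) dt and M this makes D times y^(\<kappa>+1) orthogonal to all
  powers of Y. It remains to divide out the weight y^(\<kappa>+1), which is possible because Y is
  positive.\<close>

lemma laplace_zero:
  assumes \<alpha>: "\<alpha> > 0" shows "laplace \<alpha> (power_moment 0) = 0"
proof -
  \<comment> \<open>The root at which the left factor in the recursion vanishes while the right factor is positive.\<close>
  define \<kappa> where "\<kappa> = 1/2 + sqrt (1/4 + l\<^sup>2 + 2 * \<alpha>)"
  have "(\<kappa> - 1/2)\<^sup>2 = 1/4 + l\<^sup>2 + 2 * \<alpha>" unfolding \<kappa>_def using \<alpha> by (simp add: add_nonneg_nonneg)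
  then have \<kappa>2: "\<kappa>\<^sup>2 - \<kappa> = l\<^sup>2 + 2 * \<alpha>" by (simp add: power2_eq_square algebra_simps)
  have \<kappa>0: "\<kappa> > 0" unfolding \<kappa>_def using \<alpha> by (simp add: add_pos_nonneg)
  \<comment> \<open>At the root itself \<kappa>^2 - l^2 = \<kappa> + 2 \<alpha>.\<close>
  have pos: "k\<^sup>2 - l\<^sup>2 > 0" if "k \<ge> \<kappa>" for k
  proof -
    have "\<kappa>\<^sup>2 \<le> k\<^sup>2" using that \<kappa>0 by (intro power_mono) auto
    then show ?thesis using \<kappa>2 \<kappa>0 \<alpha> by linarith
  qed
  have base: "laplace \<alpha> (power_moment (\<kappa> + 1)) = 0"
    using laplace_recursion[of \<kappa> \<alpha>] \<kappa>0 \<alpha> \<kappa>2 pos[of \<kappa>] by simp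
  have rec: "laplace \<alpha> (power_moment (\<kappa> + 1 + real j)) = 0" for j
  proof (induction j)
    case (Suc j)
    have "k\<^sup>2 - l\<^sup>2 \<noteq> 0" if "k = \<kappa> + 1 + real j" for k using pos[of k] that by simp
    then show ?case using laplace_recursion[of "\<kappa> + 1 + real j" \<alpha>] \<kappa>0 \<alpha> Suc by (simp add: add_ac)
  qed (simp add: base)
  define \<mu> where "\<mu> = (lborel :: real measure) \<Otimes>\<^sub>M M"
  define X where "X p = indicator {0..} (fst p) * Y (fst p) (snd p)" for p
  define g where "g p = indicator {0..} (fst p) * (exp (- \<alpha> * fst p) * (Y (fst p) (snd p) powr (\<kappa> + 1) * D (fst p) (snd p)))" for p
  have bb: "\<bar>y powr k\<bar> \<le> 1" if "y \<in> {0<..1}" "k \<ge> 0" for y k :: real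
    using powr_le_one[of y k] that by simp
  have fl: "integrable \<mu> (\<lambda>p. indicator {0..} (fst p) * (exp (- \<alpha> * fst p) * (h (Y (fst p) (snd p)) * D (fst p) (snd p))))"
    "(\<integral>p. indicator {0..} (fst p) * (exp (- \<alpha> * fst p) * (h (Y (fst p) (snd p)) * D (fst p) (snd p))) \<partial>\<mu>) =
      laplace \<alpha> (\<lambda>t. \<integral>\<omega>. h (Y t \<omega>) * D t \<omega> \<partial>M)"
    if "continuous_on {0<..1} h" "\<And>y. y \<in> {0<..1} \<Longrightarrow> \<bar>h y\<bar> \<le> B" for h B
    unfolding \<mu>_def by (rule fubini_laplace[OF \<alpha> weighted_D(1-3)[OF that]]; assumption)+
  have k1: "\<kappa> + 1 \<ge> 0" using \<kappa>0 by simp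
  have gi: "integrable \<mu> g" unfolding g_def by (rule fl(1)[OF powr_continuous bb[OF _ k1]])
  have Xm: "X \<in> borel_measurable \<mu>" unfolding \<mu>_def X_def[abs_def]
    using joint_measurable_halfline[OF Y_meas Y_cont] by (simp add: split_beta')
  have X01: "X p \<in> {0..1}" for p
    using Y_in[of "fst p" "snd p"] by (auto simp: X_def indicator_def)
  have zero: "(\<integral>p. X p ^ j * g p \<partial>\<mu>) = 0" for j
  proof -
    have kj: "\<kappa> + 1 + real j \<ge> 0" using \<kappa>0 by simp
    have "(\<integral>p. X p ^ j * g p \<partial>\<mu>) = (\<integral>p. indicator {0..} (fst p) * (exp (- \<alpha> * fst p) *
        (Y (fst p) (snd p) powr (\<kappa> + 1 + real j) * D (fst p) (snd p))) \<partial>\<mu>)"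
    proof (rule Bochner_Integration.integral_cong[OF refl])
      fix p
      have "Y (fst p) (snd p) > 0" using Y_in[of "fst p" "snd p"] by simp
      then have "Y (fst p) (snd p) powr (\<kappa> + 1 + real j) = Y (fst p) (snd p) powr (\<kappa> + 1) * Y (fst p) (snd p) ^ j"
        by (simp add: powr_add powr_realpow)
      then show "X p ^ j * g p = indicator {0..} (fst p) * (exp (- \<alpha> * fst p) *
        (Y (fst p) (snd p) powr (\<kappa> + 1 + real j) * D (fst p) (snd p)))"
        by (simp add: X_def g_def indicator_def)
    qed
    also have "\<dots> = laplace \<alpha> (power_moment (\<kappa> + 1 + real j))"
      unfolding power_moment_def[abs_def] by (rule fl(2)[OF powr_continuous bb[OF _ kj]])
    finally show ?thesis using rec by simp
  qed
  \<comment> \<open>Continuous approximations of u^(-\<kappa>-1), which is itself singular at 0 and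
    outside the reach of \<open>moments_zero\<close>; \<open>max u 0\<close> extends them to
    negative u.\<close>
  define \<phi> where "\<phi> n u = (max u 0 + 1 / real (Suc n)) powr - (\<kappa> + 1)" for n u
  have np: "max u 0 + 1 / real (Suc n) > 0" for u n by (simp add: add_nonneg_pos)
  have c\<phi>: "continuous_on UNIV (\<phi> n)" for n
    unfolding \<phi>_def[abs_def] by (intro continuous_intros) (metis np less_irrefl)
  have \<phi>m: "(\<lambda>p. \<phi> n (X p)) \<in> borel_measurable \<mu>" for n
    by (rule measurable_compose[OF Xm borel_measurable_continuous_onI[OF c\<phi>]])
  have z: "(\<integral>p. \<phi> n (X p) * g p \<partial>\<mu>) = 0" for n
    by (rule moments_zero[OF gi Xm X01 zero continuous_on_subset[OF c\<phi>] \<phi>m]) auto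
  define w where "w p = indicator {0..} (fst p) * (exp (- \<alpha> * fst p) * (1 * D (fst p) (snd p)))" for p
  have wi: "integrable \<mu> w" and wl: "(\<integral>p. w p \<partial>\<mu>) = laplace \<alpha> (\<lambda>t. \<integral>\<omega>. 1 * D t \<omega> \<partial>M)"
    unfolding w_def using fl[of "\<lambda>_. 1" 1] by (simp_all add: continuous_on_const)
  \<comment> \<open>The ratio lies between 0 and 1 and tends to 1, so w is the limit and |w| the
    majorant.\<close>
  have e: "\<phi> n (X p) * g p = (Y (fst p) (snd p) / (Y (fst p) (snd p) + 1 / real (Suc n))) powr (\<kappa> + 1) * w p" for n p
  proof (cases "fst p \<ge> 0")
    case True
    define y where "y = Y (fst p) (snd p)"
    have y: "y > 0" using Y_in[of "fst p" "snd p"] by (simp add: y_def)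
    have X: "X p = y" using True by (simp add: X_def y_def)
    have "\<phi> n (X p) * y powr (\<kappa> + 1) = (y / (y + 1 / real (Suc n))) powr (\<kappa> + 1)"
      unfolding \<phi>_def X powr_minus using y
      by (subst powr_divide) (auto simp: divide_inverse max_def mult.commute)
    then show ?thesis unfolding y_def[symmetric] g_def w_def by (simp add: y_def mult_ac)
  qed (simp add: g_def w_def)
  have "(\<lambda>n. \<integral>p. \<phi> n (X p) * g p \<partial>\<mu>) \<longlonglongrightarrow> (\<integral>p. w p \<partial>\<mu>)"
  proof (rule integral_dominated_convergence[where w = "\<lambda>p. \<bar>w p\<bar>"])
    show "w \<in> borel_measurable \<mu>" "integrable \<mu> (\<lambda>p. \<bar>w p\<bar>)" using wi by auto
    show "(\<lambda>p. \<phi> n (X p) * g p) \<in> borel_measurable \<mu>" for n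
      by (rule borel_measurable_times[OF \<phi>m borel_measurable_integrable[OF gi]])
    show "AE p in \<mu>. (\<lambda>n. \<phi> n (X p) * g p) \<longlonglongrightarrow> w p"
    proof (rule AE_I2)
      fix p
      define y where "y = Y (fst p) (snd p)"
      have y: "y > 0" using Y_in[of "fst p" "snd p"] by (simp add: y_def)
      have "(\<lambda>n. (y / (y + 1 / real (Suc n)))) \<longlonglongrightarrow> y / (y + 0)"
        by (intro tendsto_divide tendsto_add tendsto_const LIMSEQ_Suc[OF lim_1_over_n]) (use y in simp)
      then have "(\<lambda>n. (y / (y + 1 / real (Suc n)))) \<longlonglongrightarrow> 1" using y by simp
      from tendsto_powr[OF this tendsto_const[of "\<kappa> + 1"]]
      have "(\<lambda>n. (y / (y + 1 / real (Suc n))) powr (\<kappa> + 1) * w p) \<longlonglongrightarrow> 1 * w p"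
        by (intro tendsto_mult tendsto_const) simp
      then show "(\<lambda>n. \<phi> n (X p) * g p) \<longlonglongrightarrow> w p" unfolding e y_def by simp
    qed
    show "AE p in \<mu>. norm (\<phi> n (X p) * g p) \<le> \<bar>w p\<bar>" for n
    proof (rule AE_I2)
      fix p
      define y where "y = Y (fst p) (snd p)"
      have y: "y > 0" using Y_in[of "fst p" "snd p"] by (simp add: y_def)
      have "y + 1 / real (Suc n) > 0" using y by (intro add_pos_nonneg) auto
      then have "y / (y + 1 / real (Suc n)) \<le> 1" "0 \<le> y / (y + 1 / real (Suc n))"
        using y by (auto simp: divide_le_eq_1_pos simp del: of_nat_Suc)
      then have "(y / (y + 1 / real (Suc n))) powr (\<kappa> + 1) \<le> 1"
        using powr_mono2[of "\<kappa> + 1" "y / (y + 1 / real (Suc n))" 1] k1 by simp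
      then show "norm (\<phi> n (X p) * g p) \<le> \<bar>w p\<bar>" unfolding e y_def[symmetric] real_norm_def abs_mult
        by (intro mult_left_le_one_le) auto
    qed
  qed
  then have "(\<integral>p. w p \<partial>\<mu>) = 0" unfolding z by (simp add: LIMSEQ_const_iff)
  moreover have "power_moment 0 t = (\<integral>\<omega>. 1 * D t \<omega> \<partial>M)" for t
    unfolding power_moment_def using Y_nonzero by (intro Bochner_Integration.integral_cong) simp_all
  ultimately show ?thesis using wl by (simp add: power_moment_def[abs_def])
qed

lemma uniqueness:
  assumes "t \<ge> 0" shows "(\<integral>\<omega>. D t \<omega> \<partial>M) = 0"
proof -
  have "power_moment 0 t = 0" by (rule lerch[OF power_moment_facts(1,2) laplace_zero assms]) auto
  moreover have "power_moment 0 t = (\<integral>\<omega>. D t \<omega> \<partial>M)"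
    unfolding power_moment_def using Y_nonzero by (intro Bochner_Integration.integral_cong) simp_all
  ultimately show ?thesis by simp
qed

end

end

section \<open>The law of the height and the bounds\<close>

context sl2bm begin

text \<open>Both families solve the moment system with the same initial value a, so their difference
  solves the homogeneous system to which \<open>uniqueness\<close> applies.\<close>

lemma forward_diff:
  fixes U1 U2 :: "real \<Rightarrow> 'a \<Rightarrow> real"
  assumes m: "\<And>t. 0 \<le> t \<Longrightarrow> U1 t \<in> borel_measurable M" "\<And>t. 0 \<le> t \<Longrightarrow> U2 t \<in> borel_measurable M"
    and c: "\<And>\<omega>. \<omega> \<in> space M \<Longrightarrow> continuous_on {0..} (\<lambda>t. U1 t \<omega>)" "\<And>\<omega>. \<omega> \<in> space M \<Longrightarrow> continuous_on {0..} (\<lambda>t. U2 t \<omega>)"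
    and b: "\<And>t \<omega>. 0 \<le> t \<Longrightarrow> \<omega> \<in> space M \<Longrightarrow> \<bar>U1 t \<omega>\<bar> \<le> 1" "\<And>t \<omega>. 0 \<le> t \<Longrightarrow> \<omega> \<in> space M \<Longrightarrow> \<bar>U2 t \<omega>\<bar> \<le> 1"
    and f: "\<And>k t. 0 \<le> k \<Longrightarrow> 0 \<le> t \<Longrightarrow>
      (\<integral>\<omega>. Y t \<omega> powr k * U1 t \<omega> \<partial>M) - a = (LBINT u:{0..t}. (\<integral>\<omega>. power_drift l k (Y u \<omega>) * U1 u \<omega> \<partial>M))"
      "\<And>k t. 0 \<le> k \<Longrightarrow> 0 \<le> t \<Longrightarrow>
      (\<integral>\<omega>. Y t \<omega> powr k * U2 t \<omega> \<partial>M) - a = (LBINT u:{0..t}. (\<integral>\<omega>. power_drift l k (Y u \<omega>) * U2 u \<omega> \<partial>M))"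
    and t: "0 \<le> t"
  shows "(\<integral>\<omega>. U1 t \<omega> \<partial>M) = (\<integral>\<omega>. U2 t \<omega> \<partial>M)"
proof -
  have i: "integrable M (\<lambda>\<omega>. g (Y u \<omega>) * U u \<omega>)"
    and si: "set_integrable lborel {0..s} (\<lambda>u. \<integral>\<omega>. g (Y u \<omega>) * U u \<omega> \<partial>M)"
    if U: "\<And>t. 0 \<le> t \<Longrightarrow> U t \<in> borel_measurable M" "\<And>\<omega>. \<omega> \<in> space M \<Longrightarrow> continuous_on {0..} (\<lambda>t. U t \<omega>)"
      "\<And>t \<omega>. 0 \<le> t \<Longrightarrow> \<omega> \<in> space M \<Longrightarrow> \<bar>U t \<omega>\<bar> \<le> (1 :: real)"
      and g: "continuous_on {0<..1} g" "\<And>y. y \<in> {0<..1} \<Longrightarrow> \<bar>g y\<bar> \<le> B" and u: "0 \<le> u" and s: "0 \<le> s"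
    for g B U u s
  proof -
    note bcont = bcont_of_y[OF g]
    have B0: "0 \<le> B" using g(2)[of 1] by auto
    have m': "(\<lambda>\<omega>. g (Y t \<omega>) * U t \<omega>) \<in> borel_measurable M" if "0 \<le> t" for t
      using bcont_meas[OF bcont that] U(1)[OF that] by (rule borel_measurable_times)
    have b': "\<bar>g (Y t \<omega>) * U t \<omega>\<bar> \<le> B * 1" if "0 \<le> t" "\<omega> \<in> space M" for t \<omega>
      unfolding abs_mult using g(2)[OF Y_in] U(3)[OF that] B0 by (intro mult_mono) auto
    show "integrable M (\<lambda>\<omega>. g (Y u \<omega>) * U u \<omega>)"
      by (rule integrable_const_bound[of _ "B * 1", OF _ m'[OF u]]) (use b'[OF u] in auto)
    have c': "continuous_on {0..s} (\<lambda>t. g (Y t \<omega>) * U t \<omega>)" if "\<omega> \<in> space M" for \<omega>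
      by (rule continuous_on_subset[OF continuous_on_mult[OF bcont_cont[OF bcont that] U(2)[OF that]]]) auto
    show "set_integrable lborel {0..s} (\<lambda>u. \<integral>\<omega>. g (Y u \<omega>) * U u \<omega> \<partial>M)"
      by (rule fubini_continuous(2)[OF s m' c' b']) auto
  qed
  have bp: "\<bar>y powr k\<bar> \<le> 1" if "y \<in> {0<..1}" "k \<ge> 0" for y k :: real
    using powr_le_one[of y k] that by simp
  have "(\<integral>\<omega>. U1 t \<omega> - U2 t \<omega> \<partial>M) = 0"
  proof (rule uniqueness[where D = "\<lambda>t \<omega>. U1 t \<omega> - U2 t \<omega>" and l = l])
    show "(\<lambda>\<omega>. U1 t \<omega> - U2 t \<omega>) \<in> borel_measurable M" if "0 \<le> t" for t
      using m[OF that] by (rule borel_measurable_diff)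
    show "continuous_on {0..} (\<lambda>t. U1 t \<omega> - U2 t \<omega>)" if "\<omega> \<in> space M" for \<omega>
      using c[OF that] by (rule continuous_on_diff)
    show "\<bar>U1 t \<omega> - U2 t \<omega>\<bar> \<le> 2" if "0 \<le> t" "\<omega> \<in> space M" for t \<omega> using b[OF that] by linarith
    fix k s :: real assume k: "0 \<le> k" and s: "0 \<le> s"
    have p1: "integrable M (\<lambda>\<omega>. Y s \<omega> powr k * U1 s \<omega>)" by (rule i[OF m(1) c(1) b(1) powr_continuous bp[OF _ k] s s])
    have p2: "integrable M (\<lambda>\<omega>. Y s \<omega> powr k * U2 s \<omega>)" by (rule i[OF m(2) c(2) b(2) powr_continuous bp[OF _ k] s s])
    have l1: "integrable M (\<lambda>\<omega>. power_drift l k (Y u \<omega>) * U1 u \<omega>)" if "0 \<le> u" for u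
      by (rule i[OF m(1) c(1) b(1) power_drift_continuous power_drift_bound[OF k] that s])
    have l2: "integrable M (\<lambda>\<omega>. power_drift l k (Y u \<omega>) * U2 u \<omega>)" if "0 \<le> u" for u
      by (rule i[OF m(2) c(2) b(2) power_drift_continuous power_drift_bound[OF k] that s])
    have s1: "set_integrable lborel {0..s} (\<lambda>u. \<integral>\<omega>. power_drift l k (Y u \<omega>) * U1 u \<omega> \<partial>M)"
      by (rule si[OF m(1) c(1) b(1) power_drift_continuous power_drift_bound[OF k] s s])
    have s2: "set_integrable lborel {0..s} (\<lambda>u. \<integral>\<omega>. power_drift l k (Y u \<omega>) * U2 u \<omega> \<partial>M)"
      by (rule si[OF m(2) c(2) b(2) power_drift_continuous power_drift_bound[OF k] s s])
    have "(\<integral>\<omega>. Y s \<omega> powr k * (U1 s \<omega> - U2 s \<omega>) \<partial>M) =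
      (LBINT u:{0..s}. (\<integral>\<omega>. power_drift l k (Y u \<omega>) * U1 u \<omega> \<partial>M)) - (LBINT u:{0..s}. (\<integral>\<omega>. power_drift l k (Y u \<omega>) * U2 u \<omega> \<partial>M))"
      using f(1)[OF k s] f(2)[OF k s] p1 p2 by (simp add: right_diff_distrib)
    also have "\<dots> = (LBINT u:{0..s}. (\<integral>\<omega>. power_drift l k (Y u \<omega>) * U1 u \<omega> \<partial>M) - (\<integral>\<omega>. power_drift l k (Y u \<omega>) * U2 u \<omega> \<partial>M))"
      by (rule set_integral_diff(2)[OF s1 s2, symmetric])
    also have "\<dots> = (LBINT u:{0..s}. (\<integral>\<omega>. power_drift l k (Y u \<omega>) * (U1 u \<omega> - U2 u \<omega>) \<partial>M))"
      by (rule set_lebesgue_integral_cong) (use l1 l2 in \<open>simp_all add: right_diff_distrib\<close>)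
    finally show "(\<integral>\<omega>. Y s \<omega> powr k * (U1 s \<omega> - U2 s \<omega>) \<partial>M) =
      (LBINT u:{0..s}. (\<integral>\<omega>. power_drift l k (Y u \<omega>) * (U1 u \<omega> - U2 u \<omega>) \<partial>M))" .
  qed (rule t)
  moreover have "integrable M (U1 t)" "integrable M (U2 t)"
    using m[OF t] b[OF t] by (auto intro!: integrable_const_bound[of _ 1])
  ultimately show ?thesis by simp
qed

lemma expectation_cos: "0 \<le> t \<Longrightarrow> (\<integral>\<omega>. cos (l * z t \<omega>) \<partial>M) = (\<integral>\<omega>. V l t \<omega> \<partial>M)"
proof (rule forward_diff[where a = 1 and l = l])
  fix k t :: real assume k: "0 \<le> k" "0 \<le> t"
  show "(\<integral>\<omega>. Y t \<omega> powr k * cos (l * z t \<omega>) \<partial>M) - 1 = (LBINT u:{0..t}. (\<integral>\<omega>. power_drift l k (Y u \<omega>) * cos (l * z u \<omega>) \<partial>M))"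
    using expectation_trig[OF k, of 1 l 0] by simp
  show "(\<integral>\<omega>. Y t \<omega> powr k * V l t \<omega> \<partial>M) - 1 = (LBINT u:{0..t}. (\<integral>\<omega>. power_drift l k (Y u \<omega>) * V l u \<omega> \<partial>M))"
    by (rule expectation_V[OF k])
next
  fix \<omega> assume w: "\<omega> \<in> space M"
  show "continuous_on {0..} (\<lambda>t. cos (l * z t \<omega>))" by (intro continuous_intros z_cont w)
  show "continuous_on {0..} (\<lambda>t. V l t \<omega>)"
    unfolding continuous_on_eq_continuous_within
  proof
    fix t :: real assume t: "t \<in> {0..}"
    have "continuous (at t within {0..t + 1}) (\<lambda>t. V l t \<omega>)"
      using V_cont[OF w, of "t + 1" l] t by (auto simp: continuous_on_eq_continuous_within)
    moreover have "at t within {0..t + 1} = at t within {0..}"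
      using t by (intro at_within_nhd[of _ "{..<t + 1}"]) auto
    ultimately show "continuous (at t within {0..}) (\<lambda>t. V l t \<omega>)" by (simp add: continuous_within)
  qed
next
  fix t :: real assume t: "0 \<le> t"
  show "(\<lambda>\<omega>. cos (l * z t \<omega>)) \<in> borel_measurable M" using process_measurable(3)[OF t] by measurable
  show "V l t \<in> borel_measurable M" by (rule V_meas[OF t])
  fix \<omega> assume w: "\<omega> \<in> space M"
  show "\<bar>cos (l * z t \<omega>)\<bar> \<le> 1" by simp
  show "\<bar>V l t \<omega>\<bar> \<le> 1" using V_bounds[OF w t, of l] by simp
qed

text \<open>The sine starts from 0, so it is compared with the zero solution.\<close>

lemma expectation_sin: "0 \<le> t \<Longrightarrow> (\<integral>\<omega>. sin (l * z t \<omega>) \<partial>M) = 0"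
proof -
  assume t: "0 \<le> t"
  have "(\<integral>\<omega>. sin (l * z t \<omega>) \<partial>M) = (\<integral>\<omega>. 0 \<partial>M)"
  proof (rule forward_diff[where a = 0 and l = l and ?U2.0 = "\<lambda>_ _. 0"])
    fix k t :: real assume k: "0 \<le> k" "0 \<le> t"
    show "(\<integral>\<omega>. Y t \<omega> powr k * sin (l * z t \<omega>) \<partial>M) - 0 = (LBINT u:{0..t}. (\<integral>\<omega>. power_drift l k (Y u \<omega>) * sin (l * z u \<omega>) \<partial>M))"
      using expectation_trig[OF k, of 0 l 1] by simp
  next
    fix \<omega> assume w: "\<omega> \<in> space M"
    show "continuous_on {0..} (\<lambda>t. sin (l * z t \<omega>))" by (intro continuous_intros z_cont w)
  next
    fix t :: real assume t: "0 \<le> t"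
    show "(\<lambda>\<omega>. sin (l * z t \<omega>)) \<in> borel_measurable M" using process_measurable(3)[OF t] by measurable
  qed (use t in auto)
  then show ?thesis by simp
qed

lemma A_meas: "0 \<le> t \<Longrightarrow> A t \<in> borel_measurable M"
  by (rule measurable_from_subalg[OF subalgebra_F A_meas_F])

abbreviation "\<gamma> \<equiv> std_normal_distribution"

text \<open>The normal variable is realised as a second, independent coordinate. Given the first,
  sqrt A times it has characteristic function \<open>V l t\<close>, so averaging over M gives the
  values found in \<open>expectation_cos\<close> and \<open>expectation_sin\<close>. The identity is
  one of laws at a fixed time, not of paths.\<close>

lemma law_z:
  assumes t: "0 \<le> t"
  shows "distr M borel (z t) = distr (M \<Otimes>\<^sub>M \<gamma>) borel (\<lambda>p. sqrt (A t (fst p)) * snd p)"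
proof (rule Levy_uniqueness)
  interpret N: real_distribution \<gamma> by (rule real_dist_normal_dist)
  interpret P: pair_prob_space M \<gamma> ..
  have Am[measurable]: "A t \<in> borel_measurable M" by (rule A_meas[OF t])
  have zm[measurable]: "z t \<in> borel_measurable M" by (rule process_measurable(3)[OF t])
  have Xm[measurable]: "(\<lambda>p. sqrt (A t (fst p)) * snd p) \<in> borel_measurable (M \<Otimes>\<^sub>M \<gamma>)" by measurable
  show "real_distribution (distr M borel (z t))" by (rule real_distribution_distr) simp
  show "real_distribution (distr (M \<Otimes>\<^sub>M \<gamma>) borel (\<lambda>p. sqrt (A t (fst p)) * snd p))"
    by (rule P.real_distribution_distr) simp
  show "char (distr M borel (z t)) = char (distr (M \<Otimes>\<^sub>M \<gamma>) borel (\<lambda>p. sqrt (A t (fst p)) * snd p))"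
  proof
    fix l :: real
    have i1: "integrable M (\<lambda>\<omega>. iexp (l * z t \<omega>))"
      by (rule integrable_const_bound[of _ 1]) auto
    have Vi: "integrable M (V l t)"
    proof (rule integrable_const_bound[of _ 1, OF _ V_meas[OF t]], rule AE_I2)
      fix \<omega> assume "\<omega> \<in> space M"
      then show "norm (V l t \<omega>) \<le> 1" using V_bounds[of \<omega> t l] t by simp
    qed
    have "char (distr M borel (z t)) l = (\<integral>\<omega>. iexp (l * z t \<omega>) \<partial>M)"
      unfolding char_def by (simp add: integral_distr)
    also have "\<dots> = complex_of_real (\<integral>\<omega>. V l t \<omega> \<partial>M)"
    proof (rule complex_eqI)
      show "Re (\<integral>\<omega>. iexp (l * z t \<omega>) \<partial>M) = Re (complex_of_real (\<integral>\<omega>. V l t \<omega> \<partial>M))"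
        using expectation_cos[OF t, of l] i1 Vi by (subst integral_Re[symmetric]) (auto simp: Re_exp)
      show "Im (\<integral>\<omega>. iexp (l * z t \<omega>) \<partial>M) = Im (complex_of_real (\<integral>\<omega>. V l t \<omega> \<partial>M))"
        using expectation_sin[OF t, of l] i1 Vi by (subst integral_Im[symmetric]) (auto simp: Im_exp)
    qed
    also have "\<dots> = (\<integral>\<omega>. complex_of_real (V l t \<omega>) \<partial>M)" by (rule integral_of_real[OF Vi, symmetric])
    also have "\<dots> = (\<integral>\<omega>. (\<integral>y. iexp (l * (sqrt (A t \<omega>) * y)) \<partial>\<gamma>) \<partial>M)"
    proof (rule Bochner_Integration.integral_cong[OF refl])
      fix \<omega> assume w: "\<omega> \<in> space M"
      have "(\<integral>y. iexp (l * (sqrt (A t \<omega>) * y)) \<partial>\<gamma>) = char \<gamma> (l * sqrt (A t \<omega>))"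
        unfolding char_def by (simp add: mult.assoc)
      also have "\<dots> = complex_of_real (V l t \<omega>)"
        using A_bounds(1)[OF w t] by (simp add: char_std_normal_distribution V_def power_mult_distrib)
      finally show "complex_of_real (V l t \<omega>) = (\<integral>y. iexp (l * (sqrt (A t \<omega>) * y)) \<partial>\<gamma>)" ..
    qed
    also have "\<dots> = (\<integral>p. iexp (l * (sqrt (A t (fst p)) * snd p)) \<partial>(M \<Otimes>\<^sub>M \<gamma>))"
    proof -
      have "integrable (M \<Otimes>\<^sub>M \<gamma>) (\<lambda>p. iexp (l * (sqrt (A t (fst p)) * snd p)))"
        by (rule P.integrable_const_bound[of _ 1]) auto
      from P.integral_fst'[OF this] show ?thesis by simp
    qed
    also have "\<dots> = char (distr (M \<Otimes>\<^sub>M \<gamma>) borel (\<lambda>p. sqrt (A t (fst p)) * snd p)) l"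
      unfolding char_def by (simp add: integral_distr)
    finally show "char (distr M borel (z t)) l = char (distr (M \<Otimes>\<^sub>M \<gamma>) borel (\<lambda>p. sqrt (A t (fst p)) * snd p)) l" .
  qed
qed

section \<open>Inverse moments of the clock A\<close>

lemma vertical_adm_one: "vertical_adm (\<lambda>_. 1) (\<lambda>_. 0) (\<lambda>_. 0) 1"
  unfolding vertical_adm_def by (auto intro!: continuous_intros)

text \<open>The left side is the tangent at m to the convex function w^(-1/2). With s = sqrt w and n
  = sqrt m the gap is a positive multiple of (s - n)^2 (s + 2n).\<close>

lemma inverse_sqrt_tangent:
  fixes w m :: real
  assumes "w > 0" "m > 0"
  shows "(3/2) * (1 / sqrt m) - (1/2) * (1 / (m * sqrt m)) * w \<le> 1 / sqrt w"
proof -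
  define s where "s = sqrt w"
  define n where "n = sqrt m"
  have s: "s > 0" "w = s\<^sup>2" and n: "n > 0" "m = n\<^sup>2" using assms by (auto simp: s_def n_def)
  have "0 \<le> (s - n)\<^sup>2 * (s + 2 * n)" using s n by (intro mult_nonneg_nonneg) auto
  also have "\<dots> = s ^ 3 - 3 * n\<^sup>2 * s + 2 * n ^ 3" by algebra
  finally have "(3 * n\<^sup>2 * s - s ^ 3) / (2 * n ^ 3 * s) \<le> (2 * n ^ 3) / (2 * n ^ 3 * s)"
    using s n by (intro divide_right_mono) auto
  moreover have "(3 * n\<^sup>2 * s - s ^ 3) / (2 * n ^ 3 * s) = (3/2) * (1 / n) - (1/2) * (1 / (n\<^sup>2 * n)) * s\<^sup>2"
    using s n by (simp add: field_simps eval_nat_numeral)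
  moreover have "(2 * n ^ 3) / (2 * n ^ 3 * s) = 1 / s" using s n by simp
  ultimately show ?thesis unfolding s_def[symmetric] n_def[symmetric] s(2) n(2) using s(1) n(1) by simp
qed

text \<open>The point is uniformity in e. Up to a factor 8 the drift of sqrt(1 + e - y) dominates
  y^2 / sqrt(1 + e - y), and the rest of 1 / sqrt(1 + e - y) is at most 2. Convexity carries the
  resulting bound on the time average over to A.\<close>

lemma inverse_moment:
  assumes t: "t \<ge> 1" and e: "0 < e" "e \<le> 1"
  shows "(\<integral>\<omega>. 1 / sqrt (A t \<omega> / t + e) \<partial>M) \<le> 18" "integrable M (\<lambda>\<omega>. 1 / sqrt (A t \<omega> / t + e))"
proof -
  \<comment> \<open>A smooth version of tanh(r/2), to which it reduces for e = 0.\<close>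
  define G where "G y = sqrt (1 + e - y)" for y
  define G1 where "G1 y = - (1/2) * (1 / sqrt (1 + e - y))" for y
  define G2 where "G2 y = - (1/4) * (1 / ((1 + e - y) * sqrt (1 + e - y)))" for y
  \<comment> \<open>B blows up as e tends to 0. It secures admissibility and does not enter the
    bound 18.\<close>
  define B where "B = 2 + 1 / sqrt e + 1 / (e * sqrt e)"
  have t0: "0 \<le> t" "0 < t" using t by auto
  have w: "1 + e - y \<ge> e" "1 + e - y > 0" if "y \<in> {0<..1}" for y using that e by auto
  have dw: "((\<lambda>y. sqrt (1 + e - y)) has_real_derivative - (1/2) * (1 / sqrt (1 + e - y))) (at y within S)" if "1 + e - y > 0" for y S
    using that by (auto intro!: derivative_eq_intros simp: field_simps)
  have inv: "1 / sqrt (1 + e - y) \<le> 1 / sqrt e" "1 / ((1 + e - y) * sqrt (1 + e - y)) \<le> 1 / (e * sqrt e)"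
    "0 < 1 / sqrt (1 + e - y)" "0 < 1 / ((1 + e - y) * sqrt (1 + e - y))" if "y \<in> {0<..1}" for y
    using w[OF that] e by (auto intro!: divide_left_mono mult_mono)
  have G: "radial_adm G G1 G2 B"
    unfolding radial_adm_def
  proof (intro conjI allI ballI)
    fix n
    have "Cn_on {0<..1} n (\<lambda>y. (1 + e - y) powr (1/2))"
      by (rule Cn_on_compose[OF Cn_on_powr]) (use e(1) in \<open>auto intro!: Cn_on_diff Cn_on_const Cn_on_id\<close>)
    then show "Cn_on {0<..1} n G"
    proof (rule Cn_on_cong[THEN iffD1, rotated])
      fix y :: real assume "y \<in> {0<..1}"
      from w(2)[OF this] show "(1 + e - y) powr (1/2) = G y" by (simp add: G_def powr_half_sqrt)
    qed
  next
    show "continuous_on {0<..1} G2" unfolding G2_def using w(2) by (intro continuous_intros) fastforce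
  next
    fix y :: real assume y: "y \<in> {0<..1}"
    show "(G has_real_derivative G1 y) (at y within {0<..1})"
      unfolding G_def[abs_def] G1_def by (rule dw[OF w(2)[OF y]])
    show "(G1 has_real_derivative G2 y) (at y within {0<..1})"
    proof -
      define s where "s = sqrt (1 + e - y)"
      have s: "s > 0" "1 + e - y = s\<^sup>2" using w(2)[OF y] by (auto simp: s_def)
      have "((\<lambda>y. - (1/2) * (1 / sqrt (1 + e - y))) has_real_derivative
         - (1/2) * ((0 * s - 1 * (- (1/2) * (1 / s))) / (s * s))) (at y within {0<..1})"
        unfolding s_def using w(2)[OF y] by (intro DERIV_cmult DERIV_divide DERIV_const dw) auto
      then show ?thesis unfolding G1_def[abs_def] G2_def s_def[symmetric] s(2)
        by (rule DERIV_cong) (use s(1) in \<open>simp add: power2_eq_square\<close>)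
    qed
    have "sqrt (1 + e - y) \<le> sqrt (2\<^sup>2)" using y e by (intro real_sqrt_le_mono) auto
    then have "sqrt (1 + e - y) \<le> 2" by simp
    moreover have pos: "0 \<le> 1 / sqrt e" "0 \<le> 1 / (e * sqrt e)" using e by auto
    moreover have "0 \<le> sqrt (1 + e - y)" using w(2)[OF y] by simp
    ultimately show "\<bar>G y\<bar> \<le> B" unfolding G_def B_def by linarith
    have p: "0 \<le> y\<^sup>2" "y\<^sup>2 \<le> 1" "0 \<le> y\<^sup>2 * (1 - y)" "y\<^sup>2 * (1 - y) \<le> 1"
      using y by (auto simp: power_le_one mult_le_one)
    have g1: "\<bar>G1 y\<bar> \<le> 1 / sqrt e" and g2: "\<bar>G2 y\<bar> \<le> 1 / (e * sqrt e)"
      using inv[OF y] unfolding G1_def G2_def by linarith+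
    have "\<bar>y\<^sup>2 * (1 - y) * G2 y\<bar> \<le> 1 * (1 / (e * sqrt e))"
      unfolding abs_mult[of "y\<^sup>2 * (1 - y)"] using p g2 by (intro mult_mono) auto
    moreover have "\<bar>y\<^sup>2 * G1 y\<bar> \<le> 1 * (1 / sqrt e)"
      unfolding abs_mult[of "y\<^sup>2"] using p g1 by (intro mult_mono) auto
    ultimately show "\<bar>radial_gen G1 G2 y\<bar> \<le> B" unfolding radial_gen_def B_def using pos by linarith
  qed
  have yG: "\<bar>y * G1 y\<bar> \<le> B" if y: "y \<in> {0<..1}" for y
  proof -
    have "\<bar>G1 y\<bar> \<le> 1 / sqrt e" using inv[OF y] unfolding G1_def by linarith
    then have "\<bar>y\<bar> * \<bar>G1 y\<bar> \<le> 1 * (1 / sqrt e)" using y by (intro mult_mono) auto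
    moreover have "0 \<le> 1 / (e * sqrt e)" using e by auto
    ultimately show ?thesis unfolding B_def abs_mult by linarith
  qed
  have m: "dynkin_pair (\<lambda>y z. G y * 1) (drift G G1 G2 (\<lambda>_. 1) (\<lambda>_. 0))"
    by (rule dynkin_adm[OF G yG vertical_adm_one]) auto
  have cw: "continuous_on {0<..1} (\<lambda>y. 1 / sqrt (1 + e - y))"
    using w(2) by (intro continuous_intros) fastforce
  have bw: "\<bar>1 / sqrt (1 + e - y)\<bar> \<le> 1 / sqrt e" if "y \<in> {0<..1}" for y using inv[OF that] by linarith
  note bcw = bcont_of_y[OF cw bw]
  define S where "S u \<omega> = 1 / sqrt (1 + e - Y u \<omega>)" for u \<omega>
  have Sm: "S u \<in> borel_measurable M" if "0 \<le> u" for u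
    unfolding S_def[abs_def] using bcont_meas[OF bcw that] by simp
  have Sc: "continuous_on {0..t} (\<lambda>u. S u \<omega>)" if "\<omega> \<in> space M" for \<omega>
    unfolding S_def by (rule continuous_on_subset[OF bcont_cont[OF bcw that]]) auto
  have Sb: "\<bar>S u \<omega>\<bar> \<le> 1 / sqrt e" for u \<omega> unfolding S_def by (rule bw[OF Y_in])
  have S: "(LBINT u:{0..t}. (\<integral>\<omega>. S u \<omega> \<partial>M)) = (\<integral>\<omega>. integral {0..t} (\<lambda>u. S u \<omega>) \<partial>M)"
    "set_integrable lborel {0..t} (\<lambda>u. \<integral>\<omega>. S u \<omega> \<partial>M)"
    "integrable M (\<lambda>\<omega>. integral {0..t} (\<lambda>u. S u \<omega>))"
    "\<And>u. u \<in> {0..t} \<Longrightarrow> integrable M (S u)"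
    by (rule fubini_continuous[OF t0(1) Sm Sc Sb]; simp)+
  define dr where "dr y = drift G G1 G2 (\<lambda>_. 1) (\<lambda>_. 0) y 0" for y
  have dr_eq: "drift G G1 G2 (\<lambda>_. 1) (\<lambda>_. 0) y z = dr y" for y z by (simp add: dr_def drift_def)
  note ab = drift_bounds[OF G vertical_adm_one]
  have one: "\<forall>\<omega>\<in>space M. \<bar>1 :: real\<bar> \<le> 1" by simp
  have di: "integrable M (\<lambda>\<omega>. dr (Y u \<omega>))" if "0 \<le> u" for u
    using weighted_dynkin(3)[OF ab(2) ab(4) _ one that] unfolding dr_eq by simp
  have ds: "set_integrable lborel {0..t} (\<lambda>u. \<integral>\<omega>. dr (Y u \<omega>) \<partial>M)"
    using weighted_dynkin(5)[OF ab(2) ab(4) _ one order_refl t0(1)] unfolding dr_eq by simp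
  \<comment> \<open>1 / s splits into y^2 / s, at most 8 times the drift, and (1 - y^2) / s, at most
    2.\<close>
  have pt: "S u \<omega> \<le> 8 * dr (Y u \<omega>) + 2" for u \<omega>
  proof -
    define y where "y = Y u \<omega>"
    have y: "y \<in> {0<..1}" using Y_in by (simp add: y_def)
    define s where "s = sqrt (1 + e - y)"
    have s: "s > 0" "s\<^sup>2 = 1 + e - y" using w(2)[OF y] by (auto simp: s_def)
    have ys: "1 - y \<le> s\<^sup>2" using s(2) e by simp
    have "dr y = (1/2) * (y\<^sup>2 / s) * ((1/2) - (1/4) * ((1 - y) / s\<^sup>2))"
      unfolding dr_def drift_def radial_gen_def G1_def G2_def s_def[symmetric] s(2)[symmetric]
      using s(1) by (simp add: field_simps power2_eq_square)
    \<comment> \<open>Since 1 - y \<le> s^2, the bracket is at least 1/2 - 1/4; times the outer 1/2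
      this is 1/8, the origin of the factor 8.\<close>
    moreover have "(1/2) * (y\<^sup>2 / s) * ((1/2) - (1/4) * 1) \<le> (1/2) * (y\<^sup>2 / s) * ((1/2) - (1/4) * ((1 - y) / s\<^sup>2))"
      using s(1) ys y by (intro mult_left_mono diff_left_mono) (auto simp: divide_le_eq_1_pos)
    ultimately have "(1/2) * (y\<^sup>2 / s) * ((1/2) - (1/4) * 1) \<le> dr y" by (simp only:)
    moreover have "q \<le> 8 * d" if "(1/2) * q * ((1/2) - (1/4) * 1) \<le> d" for q d :: real
      using that by simp
    ultimately have d: "y\<^sup>2 / s \<le> 8 * dr y" by blast
    have "0 \<le> (1 - y)\<^sup>2" by simp
    then have y2: "1 - y\<^sup>2 \<le> 2 * (1 - y)" by (simp add: power2_eq_square algebra_simps)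
    \<comment> \<open>For s \<le> 1 use 1 - y \<le> s^2 \<le> s, otherwise 1 - y \<le> 1 <
      s.\<close>
    have "(1 - y) / s \<le> 1"
    proof (cases "s \<le> 1")
      case True
      have "1 - y \<le> s * s" using ys by (simp add: power2_eq_square)
      also have "\<dots> \<le> s" using True s(1) by (simp add: mult_left_le)
      finally show ?thesis using s(1) by simp
    next
      case False
      then show ?thesis using y s(1) by simp
    qed
    moreover have "(1 - y\<^sup>2) / s \<le> 2 * ((1 - y) / s)" using divide_right_mono[OF y2, of s] s(1) by simp
    ultimately have "1 / s - y\<^sup>2 / s \<le> 2" by (simp add: diff_divide_distrib)
    with d show ?thesis unfolding S_def y_def[symmetric] s_def[symmetric] by linarith
  qed
  have "(\<integral>\<omega>. 1 * (G (Y t \<omega>) * 1) \<partial>M) - (\<integral>\<omega>. 1 * (G (Y 0 \<omega>) * 1) \<partial>M) =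
    (LBINT u:{0..t}. (\<integral>\<omega>. 1 * drift G G1 G2 (\<lambda>_. 1) (\<lambda>_. 0) (Y u \<omega>) (z u \<omega>) \<partial>M))"
    by (rule dynkinD[OF m order_refl t0(1), of _ 1]) auto
  then have dint: "(LBINT u:{0..t}. (\<integral>\<omega>. dr (Y u \<omega>) \<partial>M)) = (\<integral>\<omega>. G (Y t \<omega>) \<partial>M) - (\<integral>\<omega>. G (Y 0 \<omega>) \<partial>M)"
    unfolding dr_eq by simp
  have Gb: "0 \<le> G (Y u \<omega>)" "G (Y u \<omega>) \<le> 2" for u \<omega>
  proof -
    have "sqrt (1 + e - Y u \<omega>) \<le> sqrt (2\<^sup>2)" using Y_in[of u \<omega>] e by (intro real_sqrt_le_mono) auto
    then show "G (Y u \<omega>) \<le> 2" by (simp add: G_def)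
    show "0 \<le> G (Y u \<omega>)" using w(2)[OF Y_in, of u \<omega>] by (simp add: G_def)
  qed
  have Gi: "integrable M (\<lambda>\<omega>. G (Y u \<omega>))" if "0 \<le> u" for u
    using weighted_dynkin(3)[OF ab(1) ab(3) _ one that] by simp
  have "(\<integral>\<omega>. G (Y t \<omega>) \<partial>M) \<le> 2"
    using abs_expectation_le[OF Gi[OF t0(1)], of 2] Gb by (simp add: abs_le_iff)
  moreover have "0 \<le> (\<integral>\<omega>. G (Y 0 \<omega>) \<partial>M)" using Gb by (intro Bochner_Integration.integral_nonneg) auto
  ultimately have dle: "(LBINT u:{0..t}. (\<integral>\<omega>. dr (Y u \<omega>) \<partial>M)) \<le> 2" unfolding dint by linarith
  have "(\<integral>\<omega>. integral {0..t} (\<lambda>u. S u \<omega>) \<partial>M) = (LBINT u:{0..t}. (\<integral>\<omega>. S u \<omega> \<partial>M))" using S(1) ..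
  also have "\<dots> \<le> (LBINT u:{0..t}. 8 * (\<integral>\<omega>. dr (Y u \<omega>) \<partial>M) + 2)"
  proof (rule set_integral_mono[OF S(2)])
    show "set_integrable lborel {0..t} (\<lambda>u. 8 * (\<integral>\<omega>. dr (Y u \<omega>) \<partial>M) + 2)"
      by (intro set_integral_add set_integrable_mult_right ds lborel_integral_continuous(2) continuous_intros)
    fix u assume u: "u \<in> {0..t}"
    have "(\<integral>\<omega>. S u \<omega> \<partial>M) \<le> (\<integral>\<omega>. 8 * dr (Y u \<omega>) + 2 \<partial>M)"
      using di[of u] u by (intro integral_mono S(4)[OF u] pt) auto
    then show "(\<integral>\<omega>. S u \<omega> \<partial>M) \<le> 8 * (\<integral>\<omega>. dr (Y u \<omega>) \<partial>M) + 2"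
      using di[of u] u by (simp add: prob_space)
  qed
  also have "\<dots> = 8 * (LBINT u:{0..t}. (\<integral>\<omega>. dr (Y u \<omega>) \<partial>M)) + (LBINT u:{0..t}. 2)"
    by (subst set_integral_add(2)) (auto intro!: set_integrable_mult_right ds lborel_integral_continuous(2) continuous_intros)
  also have "(LBINT u:{0..t}. (2::real)) = 2 * t"
    using lborel_integral_continuous(1)[of 0 t "\<lambda>_. 2"] t0 by simp
  \<comment> \<open>16 is 8 times the bound 2 on G.\<close>
  finally have Sle: "(\<integral>\<omega>. integral {0..t} (\<lambda>u. S u \<omega>) \<partial>M) \<le> 16 + 2 * t" using dle by simp
  have pw: "1 / sqrt (A t \<omega> / t + e) \<le> (1 / t) * integral {0..t} (\<lambda>u. S u \<omega>)" if wM: "\<omega> \<in> space M" for \<omega>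
  proof -
    define a where "a = A t \<omega> / t + e"
    have a: "a > 0" using A_bounds[OF wM t0(1)] t0 e by (simp add: a_def add_nonneg_pos)
    \<comment> \<open>c1 - c2 w is the tangent at a, which is the time average of w = 1 + e - Y.
      Averaging an affine function returns its value at the average, here the common value 1 / sqrt
      a at the point of contact.\<close>
    define c1 c2 where "c1 = (3/2) * (1 / sqrt a)" and "c2 = (1/2) * (1 / (a * sqrt a))"
    have qc: "continuous_on {0..t} (\<lambda>u. 1 - Y u \<omega>)" by (rule q_cont[OF wM])
    have "integral {0..t} (\<lambda>u. (c1 - c2 * e) - c2 * (1 - Y u \<omega>)) \<le> integral {0..t} (\<lambda>u. S u \<omega>)"
    proof (rule integral_le)
      show "(\<lambda>u. (c1 - c2 * e) - c2 * (1 - Y u \<omega>)) integrable_on {0..t}"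
        by (intro integrable_continuous_real continuous_on_diff continuous_on_mult continuous_on_const qc)
      show "(\<lambda>u. S u \<omega>) integrable_on {0..t}" by (intro integrable_continuous_real Sc wM)
      fix u
      show "(c1 - c2 * e) - c2 * (1 - Y u \<omega>) \<le> S u \<omega>"
      proof -
        have "(c1 - c2 * e) - c2 * (1 - Y u \<omega>) = c1 - c2 * (1 + e - Y u \<omega>)" by algebra
        also have "\<dots> \<le> S u \<omega>" unfolding c1_def c2_def S_def by (rule inverse_sqrt_tangent[OF w(2)[OF Y_in] a])
        finally show ?thesis .
      qed
    qed
    moreover have "integral {0..t} (\<lambda>u. (c1 - c2 * e) - c2 * (1 - Y u \<omega>)) = (c1 - c2 * e) * t - c2 * A t \<omega>"
    proof -
      have "integral {0..t} (\<lambda>u. (c1 - c2 * e) - c2 * (1 - Y u \<omega>)) =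
         integral {0..t} (\<lambda>u. c1 - c2 * e) - integral {0..t} (\<lambda>u. c2 * (1 - Y u \<omega>))"
        by (rule Henstock_Kurzweil_Integration.integral_diff) (intro integrable_continuous_real continuous_on_mult continuous_on_const qc)+
      also have "integral {0..t} (\<lambda>u. c2 * (1 - Y u \<omega>)) = c2 * A t \<omega>"
        unfolding A_def by (rule Henstock_Kurzweil_Integration.integral_mult_right)
      finally show ?thesis using t0 by simp
    qed
    moreover have "(c1 - c2 * e) * t - c2 * A t \<omega> = t * (1 / sqrt a)"
    proof -
      have "(c1 - c2 * e) * t - c2 * A t \<omega> = t * (c1 - c2 * a)"
        unfolding a_def using t0 by (simp add: field_simps)
      also have "c1 - c2 * a = 1 / sqrt a" unfolding c1_def c2_def using a by (simp add: field_simps)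
      finally show ?thesis .
    qed
    ultimately have "t * (1 / sqrt a) \<le> integral {0..t} (\<lambda>u. S u \<omega>)" by linarith
    then show ?thesis unfolding a_def[symmetric] using t0 by (simp add: field_simps)
  qed
  show ii: "integrable M (\<lambda>\<omega>. 1 / sqrt (A t \<omega> / t + e))"
  proof (rule integrable_const_bound)
    show "AE \<omega> in M. norm (1 / sqrt (A t \<omega> / t + e)) \<le> 1 / sqrt e"
    proof (rule AE_I2)
      fix \<omega> assume "\<omega> \<in> space M"
      then have "A t \<omega> / t \<ge> 0" using A_bounds[of \<omega> t] t0 by simp
      then show "norm (1 / sqrt (A t \<omega> / t + e)) \<le> 1 / sqrt e"
        using e by (auto intro!: divide_left_mono mult_pos_pos)
    qed
    show "(\<lambda>\<omega>. 1 / sqrt (A t \<omega> / t + e)) \<in> borel_measurable M" using A_meas[OF t0(1)] by measurable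
  qed
  have "(\<integral>\<omega>. 1 / sqrt (A t \<omega> / t + e) \<partial>M) \<le> (\<integral>\<omega>. (1 / t) * integral {0..t} (\<lambda>u. S u \<omega>) \<partial>M)"
    using S(3) pw by (intro integral_mono ii) auto
  also have "\<dots> \<le> (1 / t) * (16 + 2 * t)" using Sle t0 by (simp add: divide_right_mono)
  also have "\<dots> \<le> 18" using t by (simp add: field_simps)
  finally show "(\<integral>\<omega>. 1 / sqrt (A t \<omega> / t + e) \<partial>M) \<le> 18" .
qed

text \<open>The value of 1 / sqrt 0 is 0, so the moment bound alone would not see the set where A =
  0. A Markov estimate on the regularised moments gives this set probability at most 18
  sqrt(\<open>e n\<close>) for every n; off it Fatou's lemma lets \<open>e n\<close> tend to
  0.\<close>

lemma inverse_moment_zero: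
  assumes t: "t \<ge> 1"
  shows "AE \<omega> in M. A t \<omega> > 0" "(\<integral>\<^sup>+\<omega>. ennreal (1 / sqrt (A t \<omega> / t)) \<partial>M) \<le> 18"
proof -
  define e where "e n = inverse (real (Suc n))" for n
  have e: "0 < e n" "e n \<le> 1" for n by (simp_all add: e_def inverse_le_1_iff)
  have e0: "e \<longlonglongrightarrow> 0" unfolding e_def by (rule LIMSEQ_inverse_real_of_nat)
  have t0: "0 \<le> t" "0 < t" using t by auto
  have [measurable]: "A t \<in> borel_measurable M" by (rule A_meas[OF t0(1)])
  note im = inverse_moment[OF t e]
  define Z where "Z = {\<omega> \<in> space M. A t \<omega> = 0}"
  have Zm: "Z \<in> events" unfolding Z_def by measurable
  have "prob Z \<le> 18 * sqrt (e n)" for n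
  proof -
    have "prob Z * (1 / sqrt (e n)) = (\<integral>\<omega>. indicator Z \<omega> * (1 / sqrt (e n)) \<partial>M)" using Zm by simp
    also have "\<dots> \<le> (\<integral>\<omega>. 1 / sqrt (A t \<omega> / t + e n) \<partial>M)"
    proof (rule integral_mono[OF _ im(2)])
      show "integrable M (\<lambda>\<omega>. indicator Z \<omega> * (1 / sqrt (e n)))"
        using Zm by (intro integrable_mult_left integrable_real_indicator) (auto simp: emeasure_eq_measure)
      fix \<omega> assume w: "\<omega> \<in> space M"
      have "0 \<le> A t \<omega> / t + e n" using A_bounds(1)[OF w t0(1)] t0 e(1)[of n] by simp
      then show "indicator Z \<omega> * (1 / sqrt (e n)) \<le> 1 / sqrt (A t \<omega> / t + e n)"
        by (auto simp: Z_def indicator_def)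
    qed
    finally have "prob Z * (1 / sqrt (e n)) \<le> 18" using im(1)[of n] by linarith
    then show ?thesis using e(1)[of n] by (simp add: field_simps)
  qed
  then have Zle: "\<exists>N. \<forall>n\<ge>N. prob Z \<le> 18 * sqrt (e n)" by blast
  have "(\<lambda>n. 18 * sqrt (e n)) \<longlonglongrightarrow> 18 * sqrt 0" by (intro tendsto_intros e0)
  then have "prob Z \<le> 18 * sqrt 0" by (rule LIMSEQ_le_const[OF _ Zle])
  then have "prob Z = 0" using measure_nonneg[of M Z] by simp
  then have "AE \<omega> in M. \<omega> \<notin> Z" using prob_eq_0[OF Zm] by simp
  moreover have "AE \<omega> in M. \<omega> \<in> space M" by (rule AE_space)
  ultimately show pos: "AE \<omega> in M. A t \<omega> > 0"
  proof eventually_elim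
    fix \<omega> assume "\<omega> \<notin> Z" "\<omega> \<in> space M"
    then show "A t \<omega> > 0" using A_bounds(1)[of \<omega> t] t0 by (simp add: Z_def less_le)
  qed
  define u where "u n \<omega> = ennreal (1 / sqrt (A t \<omega> / t + e n))" for n \<omega>
  have um: "u n \<in> borel_measurable M" for n unfolding u_def[abs_def] by measurable
  have ule: "(\<integral>\<^sup>+\<omega>. u n \<omega> \<partial>M) \<le> 18" for n
  proof -
    have "(\<integral>\<^sup>+\<omega>. u n \<omega> \<partial>M) = ennreal (\<integral>\<omega>. 1 / sqrt (A t \<omega> / t + e n) \<partial>M)"
      unfolding u_def
    proof (rule nn_integral_eq_integral[OF im(2)], rule AE_I2)
      fix \<omega> assume w: "\<omega> \<in> space M"
      have "0 \<le> A t \<omega> / t + e n" using A_bounds(1)[OF w t0(1)] t0 e(1)[of n] by simp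
      then show "0 \<le> 1 / sqrt (A t \<omega> / t + e n)" by simp
    qed
    also have "\<dots> \<le> ennreal 18" by (rule ennreal_leI[OF im(1)])
    finally show ?thesis by simp
  qed
  have "(\<integral>\<^sup>+\<omega>. ennreal (1 / sqrt (A t \<omega> / t)) \<partial>M) = (\<integral>\<^sup>+\<omega>. liminf (\<lambda>n. u n \<omega>) \<partial>M)"
  proof (rule nn_integral_cong_AE)
    from pos show "AE \<omega> in M. ennreal (1 / sqrt (A t \<omega> / t)) = liminf (\<lambda>n. u n \<omega>)"
    proof eventually_elim
      fix \<omega> assume "A t \<omega> > 0"
      then have a: "A t \<omega> / t > 0" using t0 by simp
      have "(\<lambda>n. 1 / sqrt (A t \<omega> / t + e n)) \<longlonglongrightarrow> 1 / sqrt (A t \<omega> / t + 0)"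
        by (intro tendsto_intros e0) (use a in auto)
      then have "(\<lambda>n. u n \<omega>) \<longlonglongrightarrow> ennreal (1 / sqrt (A t \<omega> / t))"
        unfolding u_def by (intro tendsto_ennrealI) simp
      then show "ennreal (1 / sqrt (A t \<omega> / t)) = liminf (\<lambda>n. u n \<omega>)"
        using lim_imp_Liminf[OF sequentially_bot] by metis
    qed
  qed
  also have "\<dots> \<le> liminf (\<lambda>n. \<integral>\<^sup>+\<omega>. u n \<omega> \<partial>M)" by (rule nn_integral_liminf[OF um])
  also have "\<dots> \<le> liminf (\<lambda>n. 18 :: ennreal)" by (rule Liminf_mono) (simp add: ule)
  also have "\<dots> = 18" by (simp add: Liminf_const)
  finally show "(\<integral>\<^sup>+\<omega>. ennreal (1 / sqrt (A t \<omega> / t)) \<partial>M) \<le> 18" .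
qed

section \<open>Comparison of the distribution functions\<close>

lemma Phi_measure: "Phi x = measure \<gamma> {..x}"
proof -
  interpret N: real_distribution \<gamma> by (rule real_dist_normal_dist)
  have "measure \<gamma> {..x} = (\<integral>y. indicator {..x} y \<partial>\<gamma>)" by simp
  also have "\<dots> = (LBINT y. std_normal_density y *\<^sub>R indicator {..x} y)"
    by (rule integral_density) auto
  also have "\<dots> = Phi x" unfolding Phi_def set_lebesgue_integral_def by (simp add: mult.commute)
  finally show ?thesis ..
qed

text \<open>The density is at most 1 / sqrt(2 pi) < 1. For d < x both sides are 0.\<close>

lemma normal_interval_le: "emeasure \<gamma> {x..d} \<le> ennreal (d - x)"
proof -
  have le1: "std_normal_density y \<le> 1" for y
  proof -
    have "1 \<le> sqrt (2 * pi)" using pi_ge_two by (intro real_le_rsqrt) simp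
    then have "1 / sqrt (2 * pi) * exp (- y\<^sup>2 / 2) \<le> 1 * 1" by (intro mult_mono) auto
    then show ?thesis by (simp add: std_normal_density_def)
  qed
  have "emeasure \<gamma> {x..d} = (\<integral>\<^sup>+y. ennreal (std_normal_density y) * indicator {x..d} y \<partial>lborel)"
    by (rule emeasure_density) auto
  also have "\<dots> \<le> (\<integral>\<^sup>+y. indicator {x..d} y \<partial>lborel)"
    using le1 by (intro nn_integral_mono) (auto simp: indicator_def)
  also have "\<dots> \<le> ennreal (d - x)" by (simp add: emeasure_lborel_Icc_eq ennreal_neg)
  finally show ?thesis .
qed

lemma cdf_bounds:
  assumes t: "t > 1" and x: "x \<ge> 0"
  shows "Phi x \<le> measure M {\<omega> \<in> space M. z t \<omega> / sqrt t \<le> x}"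
    "measure M {\<omega> \<in> space M. z t \<omega> / sqrt t \<le> x} \<le> Phi x + 18 * x"
proof -
  interpret N: real_distribution \<gamma> by (rule real_dist_normal_dist)
  interpret P: pair_prob_space M \<gamma> ..
  have t0: "0 \<le> t" "0 < t" "1 \<le> t" using t by auto
  have [measurable]: "A t \<in> borel_measurable M" by (rule A_meas[OF t0(1)])
  have [measurable]: "z t \<in> borel_measurable M" by (rule process_measurable(3)[OF t0(1)])
  define E where "E = {p \<in> space (M \<Otimes>\<^sub>M \<gamma>). sqrt (A t (fst p)) * snd p \<le> x * sqrt t}"
  define L where "L = space M \<times> {..x}"
  \<comment> \<open>U is the strip by which E exceeds L. For A > 0 its section at a given path lies
    between x and x sqrt(t / A).\<close>
  define U where "U = {p \<in> space (M \<Otimes>\<^sub>M \<gamma>). x < snd p \<and> sqrt (A t (fst p)) * snd p \<le> x * sqrt t}"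
  have Em: "E \<in> sets (M \<Otimes>\<^sub>M \<gamma>)" unfolding E_def by measurable
  have Um: "U \<in> sets (M \<Otimes>\<^sub>M \<gamma>)" unfolding U_def by measurable
  have Lm: "L \<in> sets (M \<Otimes>\<^sub>M \<gamma>)" unfolding L_def by (intro pair_measureI) auto
  have "measure M {\<omega> \<in> space M. z t \<omega> / sqrt t \<le> x} = measure (distr M borel (z t)) {..x * sqrt t}"
    using t0 by (subst measure_distr) (auto simp: field_simps vimage_def Int_def conj_commute)
  also have "\<dots> = measure (M \<Otimes>\<^sub>M \<gamma>) E"
    unfolding law_z[OF t0(1)] E_def by (subst measure_distr) (auto simp: vimage_def Int_def conj_commute)
  finally have FE: "measure M {\<omega> \<in> space M. z t \<omega> / sqrt t \<le> x} = P.prob E" .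
  have "emeasure (M \<Otimes>\<^sub>M \<gamma>) L = emeasure M (space M) * emeasure \<gamma> {..x}"
    unfolding L_def by (rule N.emeasure_pair_measure_Times) auto
  then have LP: "P.prob L = Phi x"
    unfolding Phi_measure by (simp add: emeasure_space_1 P.emeasure_eq_measure N.emeasure_eq_measure)
  have "L \<subseteq> E"
  proof
    fix p assume "p \<in> L"
    then have p: "fst p \<in> space M" "snd p \<le> x" by (auto simp: L_def)
    \<comment> \<open>The factor sqrt A is kept while \<open>snd p\<close>, possibly negative, is
      raised to x; only then is A raised to t, which uses x \<ge> 0.\<close>
    have "sqrt (A t (fst p)) * snd p \<le> sqrt (A t (fst p)) * x" using A_bounds(1)[OF p(1) t0(1)] p by (intro mult_left_mono) auto
    also have "\<dots> \<le> sqrt t * x" using A_bounds(2)[OF p(1) t0(1)] x by (intro mult_right_mono) auto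
    finally show "p \<in> E" using p by (cases p) (simp add: E_def space_pair_measure mult.commute)
  qed
  then show "Phi x \<le> measure M {\<omega> \<in> space M. z t \<omega> / sqrt t \<le> x}"
    unfolding FE LP[symmetric] by (rule P.finite_measure_mono[OF _ Em])
  have "E \<subseteq> L \<union> U" by (auto simp: E_def L_def U_def space_pair_measure)
  then have "P.prob E \<le> P.prob (L \<union> U)" by (rule P.finite_measure_mono) (use Lm Um in auto)
  also have "\<dots> \<le> P.prob L + P.prob U" by (rule measure_Un_le[OF Lm Um])
  finally have EU: "P.prob E \<le> Phi x + P.prob U" unfolding LP .
  have "emeasure (M \<Otimes>\<^sub>M \<gamma>) U = (\<integral>\<^sup>+\<omega>. emeasure \<gamma> (Pair \<omega> -` U) \<partial>M)"
    by (rule N.emeasure_pair_measure_alt[OF Um])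
  also have "\<dots> \<le> (\<integral>\<^sup>+\<omega>. ennreal x * ennreal (1 / sqrt (A t \<omega> / t)) \<partial>M)"
  proof (rule nn_integral_mono_AE)
    from inverse_moment_zero(1)[OF t0(3)]
    show "AE \<omega> in M. emeasure \<gamma> (Pair \<omega> -` U) \<le> ennreal x * ennreal (1 / sqrt (A t \<omega> / t))"
    proof eventually_elim
      fix \<omega> assume a: "A t \<omega> > 0"
      define d where "d = x * (1 / sqrt (A t \<omega> / t))"
      have "Pair \<omega> -` U \<subseteq> {x..d}"
        using a t0 by (auto simp: U_def d_def real_sqrt_divide field_simps)
      then have "emeasure \<gamma> (Pair \<omega> -` U) \<le> emeasure \<gamma> {x..d}" by (rule emeasure_mono) simp
      also have "\<dots> \<le> ennreal (d - x)" by (rule normal_interval_le)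
      \<comment> \<open>Dropping -x affects the constant only and leaves x times the inverse
        moment.\<close>
      also have "\<dots> \<le> ennreal d" using x by (intro ennreal_leI) simp
      also have "\<dots> = ennreal x * ennreal (1 / sqrt (A t \<omega> / t))"
        unfolding d_def using x a t0 by (intro ennreal_mult) auto
      finally show "emeasure \<gamma> (Pair \<omega> -` U) \<le> ennreal x * ennreal (1 / sqrt (A t \<omega> / t))" .
    qed
  qed
  also have "\<dots> = ennreal x * (\<integral>\<^sup>+\<omega>. ennreal (1 / sqrt (A t \<omega> / t)) \<partial>M)"
    by (rule nn_integral_cmult) measurable
  also have "\<dots> \<le> ennreal x * ennreal 18"
    using inverse_moment_zero(2)[OF t0(3)] by (intro mult_left_mono) auto
  also have "\<dots> = ennreal (18 * x)" using x by (simp add: ennreal_mult[symmetric] mult.commute del: ennreal_numeral)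
  finally have "P.prob U \<le> 18 * x" using x by (simp add: P.emeasure_eq_measure)
  then show "measure M {\<omega> \<in> space M. z t \<omega> / sqrt t \<le> x} \<le> Phi x + 18 * x"
    unfolding FE using EU by linarith
qed

end

theorem theorem3p3:
  fixes M :: "'a measure" and r \<theta> z :: "real \<Rightarrow> 'a \<Rightarrow> real"
  assumes "SL2_brownian_motion_from_origin M r \<theta> z"
  defines "F \<equiv> \<lambda>t x. measure M {\<omega> \<in> space M. z t \<omega> / sqrt t \<le> x}"
  shows "\<exists>c T\<^sub>0. c > 0 \<and> T\<^sub>0 > 0 \<and>
           (\<forall>x\<ge>0. \<forall>t>T\<^sub>0. Phi x \<le> F t x \<and> F t x \<le> Phi x + c * x)"
proof -
  interpret sl2bm M r \<theta> z by unfold_locales (rule assms(1))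
  \<comment> \<open>The threshold 1 is the range in which (16 + 2t) / t \<le> 18.\<close>
  show ?thesis unfolding F_def
    by (intro exI[of _ 18] exI[of _ 1]) (auto intro!: cdf_bounds)
qed

end
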